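(* Let $A$ be a unital $C^\star$-algebra and let $B$ be a unital complex Banach algebra. Then $A$ is isomorphic to $B$ if and only if there exists a surjective map $\phi:A\to B$ (not assumed linear or multiplicative) such that (i) $\sigma\left(\phi(x)\phi(y)\phi(z)\right)=\sigma\left(xyz\right)$ for all $x,y,z\in A$; and (ii) $\phi$ is continuous at $\mathbf 1$.
   Context: All Banach algebras (including $C^\star$-algebras) are complex and unital (and nonzero), with unit denoted $\mathbf 1$. For an element $x$ of a Banach algebra with group of invertible elements $G$, the spectrum is $\sigma(x)=\{\lambda\in\mathbb C:\lambda\mathbf 1-x\notin G\}$; the spectrum on the left-hand side of (i) is taken in $B$ and the one on the right-hand side in $A$. "Isomorphic" means isomorphic as complex algebras, i.e. via a linear multiplicative bijection. Continuity is with respect to the norm topologies of $A$ and $B$. *)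

theory Defs
  imports Complex_Main
begin

text \<open>
  Unital complex Banach algebras. The library class hierarchy is real, so a complex scalar
  multiplication extending \<^term>\<open>scaleR\<close> is added. The class
  \<^class>\<open>real_algebra_1\<close> includes \<^prop>\<open>(0::'a::zero_neq_one) \<noteq> 1\<close>, so the algebra is nonzero, and
  \<^class>\<open>real_normed_algebra\<close> gives submultiplicativity of the norm. The normalisation
  that the unit has norm one (as in \<^class>\<open>real_normed_algebra_1\<close>) is not imposed.
\<close>

class complex_banach_algebra_1 = real_algebra_1 + real_normed_algebra + banach +
  fixes scaleC :: "complex \<Rightarrow> 'a \<Rightarrow> 'a" (infixr "*\<^sub>C" 75)
  assumes scaleR_scaleC: "r *\<^sub>R x = complex_of_real r *\<^sub>C x"
    and scaleC_add_right: "c *\<^sub>C (x + y) = c *\<^sub>C x + c *\<^sub>C y"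
    and scaleC_add_left: "(c + d) *\<^sub>C x = c *\<^sub>C x + d *\<^sub>C x"
    and scaleC_scaleC: "c *\<^sub>C (d *\<^sub>C x) = (c * d) *\<^sub>C x"
    and scaleC_one: "1 *\<^sub>C x = x"
    and mult_scaleC_left: "(c *\<^sub>C x) * y = c *\<^sub>C (x * y)"
    and mult_scaleC_right: "x * (c *\<^sub>C y) = c *\<^sub>C (x * y)"
    and norm_scaleC: "norm (c *\<^sub>C x) = cmod c * norm x"

class cstar_algebra = complex_banach_algebra_1 +
  fixes star :: "'a \<Rightarrow> 'a"
  assumes star_star: "star (star x) = x"
    and star_add: "star (x + y) = star x + star y"
    and star_scaleC: "star (c *\<^sub>C x) = cnj c *\<^sub>C star x"
    and star_mult: "star (x * y) = star y * star x"
    and cstar_identity: "norm (star x * x) = (norm x)\<^sup>2"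

definition invertibles :: "'a::ring_1 set" where
  "invertibles = {u. \<exists>v. u * v = 1 \<and> v * u = 1}"

definition spectrum :: "'a::complex_banach_algebra_1 \<Rightarrow> complex set" where
  "spectrum x = {c. c *\<^sub>C 1 - x \<notin> invertibles}"

definition algebra_isomorphism ::
  "('a::complex_banach_algebra_1 \<Rightarrow> 'b::complex_banach_algebra_1) \<Rightarrow> bool" where
  "algebra_isomorphism f \<longleftrightarrow>
     bij f \<and>
     (\<forall>x y. f (x + y) = f x + f y) \<and>
     (\<forall>c x. f (c *\<^sub>C x) = c *\<^sub>C f x) \<and>
     (\<forall>x y. f (x * y) = f x * f y)"

end

theory Submission
  imports Defs "HOL-Analysis.Analysis"
begin

text \<open>
  Write \<open>\<sigma>\<close> for the spectrum and \<open>r\<close> for the spectral radius, and call an element with spectrum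
  \<open>{0}\<close> quasinilpotent.

  \<^bold>\<open>An isomorphism gives such a map.\<close> An algebra isomorphism \<open>f\<close> preserves spectra, so only its
  continuity is in question. By the closed graph theorem it suffices that \<open>X\<^sub>n \<rightarrow> 0\<close> and
  \<open>f X\<^sub>n \<rightarrow> f w\<close> force \<open>w = 0\<close>. Put \<open>a\<^sub>n = w\<^sup>* X\<^sub>n\<close> and \<open>h = w\<^sup>* w\<close>, so that \<open>a\<^sub>n\<close> is small in the
  norm of the C*-algebra while \<open>f (h - a\<^sub>n)\<close> is small in the norm of the other algebra. Both norms
  dominate \<open>r\<close>. Bounding \<open>r (z a\<^sub>n + (h - a\<^sub>n))\<close> by the first norm on the circle of radius \<open>R\<close> and by the second
  on the circle of radius \<open>1/R\<close>, a three circles inequality gives \<open>r(h)\<^sup>2 = O(1/R)\<close>. Hence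
  \<open>norm h = r h = 0\<close>. This is Ransford's proof of the uniqueness of the complete norm.

  \<^bold>\<open>Such a map gives an isomorphism.\<close> In a C*-algebra, \<open>\<sigma>(a x) = \<sigma>(b x)\<close> for all \<open>x\<close> implies \<open>a = b\<close>
  (\<open>determined_by_spectra_of_multiples\<close>), and the surjection \<open>\<phi>\<close> transports this to the target algebra.
  Comparing the spectra of \<open>\<phi>(x) \<phi>(y) \<phi>(s)\<close> and \<open>\<phi>(1) \<phi>(x y) \<phi>(s)\<close> yields
  \<open>\<phi>(x) \<phi>(y) = \<phi>(1) \<phi>(x y)\<close>; therefore \<open>\<phi>(1)\<close> is central, \<open>\<phi>(1)\<^sup>3 = 1\<close>, and \<open>\<psi> = \<phi>(1)\<^sup>-\<^sup>1 \<phi>\<close> is a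
  multiplicative bijection which preserves spectra (\<open>normalize_triple_spectral_map\<close>).

  Additivity comes from a differential. Since \<open>\<psi>\<close> is continuous at \<open>1\<close>, it maps the one-parameter group
  \<open>exp (t a)\<close> to a norm continuous one-parameter group, hence to \<open>exp (t D(a))\<close> for a unique \<open>D(a)\<close>. By
  Trotter's product formula \<open>D\<close> is additive; it is bounded and real linear, and \<open>\<sigma>(D a) = \<sigma>(a)\<close>.
  That \<open>D\<close> respects the remaining structure is obtained each time from
  \<open>quasinilpotent_in_commutant_eq_0\<close>. Let \<open>h\<close> be self-adjoint and let \<open>n\<close> be quasinilpotent and commute
  with \<open>\<psi>(z)\<close> whenever \<open>z\<close> commutes with \<open>h\<close>. Write \<open>exp n = \<psi>(x)\<close>. Then \<open>x\<close> lies in the bicommutant of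
  \<open>h\<close>, so \<open>x\<close> is normal; its spectrum is \<open>{1}\<close>, so \<open>x = 1\<close>; and \<open>n = 0\<close> follows. It is applied to
  \<^item> \<open>n = D(1) - 1\<close>, so that \<open>D\<close> is unital;
  \<^item> \<open>n = i D(h) - D(i h)\<close>, whose spectrum lies on two different real lines through \<open>0\<close>, so that \<open>D\<close>
    is complex linear;
  \<^item> \<open>n = D(k) D(k\<^sup>-\<^sup>1) - 1\<close> for self-adjoint invertible \<open>k\<close>, whose spectrum is both real and imaginary
    because \<open>(k \<plusminus> i k\<^sup>-\<^sup>1)\<^sup>2 \<mp> 2i\<close> is self-adjoint.

  The last application and Hua's identity show that \<open>D\<close> preserves squares, so that
  \<open>D(exp a) = exp (D a) = \<psi>(exp a)\<close>. Every \<open>x\<close> with \<open>r (x - 1) < 1\<close> is an exponential; thus \<open>D\<close> and \<open>\<psi>\<close>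
  agree near \<open>1\<close>. Being linear, \<open>D\<close> inherits multiplicativity and surjectivity from \<open>\<psi>\<close>, and it is the
  required isomorphism.

  The spectral calculus behind this is elementary. Gelfand's formula for \<open>r\<close> is proved by averaging
  resolvents over roots of unity; it makes \<open>r\<close> submultiplicative on commuting elements and bounds the
  movement of the spectrum under commuting perturbations, which replaces the use of characters.
\<close>

text \<open>
  In \<^class>\<open>complex_banach_algebra_1\<close> the unit may have norm greater than \<open>1\<close>. The analysis is done
  where it has norm \<open>1\<close>; an equivalent norm reduces the general case to this one.
\<close>

class unital_banach = complex_banach_algebra_1 + real_normed_algebra_1

section \<open>Complex scalars and invertible elements\<close>

lemma scaleC_zero_left [simp]: "0 *\<^sub>C (x::'a::complex_banach_algebra_1) = 0"
  using scaleC_add_left[of 0 0 x] by simp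

lemma scaleC_zero_right [simp]: "c *\<^sub>C (0::'a::complex_banach_algebra_1) = 0"
  using scaleC_add_right[of c 0 "0::'a"] by simp

lemma scaleC_minus_left: "(- c) *\<^sub>C (x::'a::complex_banach_algebra_1) = - (c *\<^sub>C x)"
  using scaleC_add_left[of "- c" c x] by (simp add: eq_neg_iff_add_eq_0)

lemma scaleC_minus_right: "c *\<^sub>C (- (x::'a::complex_banach_algebra_1)) = - (c *\<^sub>C x)"
  using scaleC_add_right[of c "- x" x] by (simp add: eq_neg_iff_add_eq_0)

lemma scaleC_diff_left: "(c - d) *\<^sub>C (x::'a::complex_banach_algebra_1) = c *\<^sub>C x - d *\<^sub>C x"
  using scaleC_add_left[of c "- d" x] by (simp add: scaleC_minus_left)

lemma scaleC_diff_right: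
  "c *\<^sub>C ((x::'a::complex_banach_algebra_1) - y) = c *\<^sub>C x - c *\<^sub>C y"
  using scaleC_add_right[of c x "- y"] by (simp add: scaleC_minus_right)

lemma scaleC_sum_left:
  "(\<Sum>i\<in>I. f i) *\<^sub>C (x::'a::complex_banach_algebra_1) = (\<Sum>i\<in>I. f i *\<^sub>C x)"
  by (induction I rule: infinite_finite_induct) (auto simp: scaleC_add_left)

lemma scaleC_sum_right:
  "c *\<^sub>C (\<Sum>i\<in>I. f i :: 'a::complex_banach_algebra_1) = (\<Sum>i\<in>I. c *\<^sub>C f i)"
  by (induction I rule: infinite_finite_induct) (auto simp: scaleC_add_right)

lemma power_scaleC: "(c *\<^sub>C (x::'a::complex_banach_algebra_1)) ^ n = c ^ n *\<^sub>C x ^ n"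
  by (induction n)
     (auto simp: scaleC_one mult_scaleC_left mult_scaleC_right scaleC_scaleC mult.commute)

lemmas scaleC_simps = mult_scaleC_left mult_scaleC_right scaleC_scaleC scaleC_one
  scaleC_add_left scaleC_add_right scaleC_diff_left scaleC_diff_right
  scaleC_minus_left scaleC_minus_right

lemma bounded_bilinear_scaleC:
  "bounded_bilinear (\<lambda>c (x::'a::complex_banach_algebra_1). c *\<^sub>C x)"
proof
  fix c d :: complex and r :: real and x y :: 'a
  show "(c + d) *\<^sub>C x = c *\<^sub>C x + d *\<^sub>C x" "c *\<^sub>C (x + y) = c *\<^sub>C x + c *\<^sub>C y"
    by (simp_all add: scaleC_simps)
  show "(r *\<^sub>R c) *\<^sub>C x = r *\<^sub>R (c *\<^sub>C x)" "c *\<^sub>C (r *\<^sub>R x) = r *\<^sub>R (c *\<^sub>C x)"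
    by (simp_all add: scaleR_scaleC scaleC_scaleC scaleR_conv_of_real mult.commute)
  show "\<exists>K. \<forall>c (x::'a). norm (c *\<^sub>C x) \<le> norm c * norm x * K"
    by (intro exI[of _ 1]) (simp add: norm_scaleC)
qed

lemmas continuous_on_scaleC [continuous_intros] =
  bounded_bilinear.continuous_on[OF bounded_bilinear_scaleC]

text \<open>
  With \<open>c = \<plusminus>i\<close> this separates \<open>x\<^sup>2 - y\<^sup>2\<close> from \<open>x y\<close>; the two choices of sign together isolate \<open>x y\<close>.
\<close>

lemma square_add_scaleC:
  assumes "x * y = y * (x::'a::complex_banach_algebra_1)" "c * c = - 1"
  shows "(x + c *\<^sub>C y) * (x + c *\<^sub>C y) = x * x - y * y + (2 * c) *\<^sub>C (x * y)"
proof -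
  have "(x + c *\<^sub>C y) * (x + c *\<^sub>C y) = x * x + (c * c) *\<^sub>C (y * y) + (c *\<^sub>C (x * y) + c *\<^sub>C (x * y))"
    by (simp add: distrib_left distrib_right mult_scaleC_left mult_scaleC_right scaleC_scaleC assms(1)
        scaleC_add_right)
  also have "c *\<^sub>C (x * y) + c *\<^sub>C (x * y) = (2 * c) *\<^sub>C (x * y)"
    by (simp only: scaleC_add_left[symmetric] mult_2)
  finally show ?thesis by (simp add: assms(2) scaleC_minus_left scaleC_one)
qed

lemma squares_commute:
  assumes "x * y = y * (x::'a::monoid_mult)"
  shows "x * x * (y * y) = y * y * (x * x)"
  using power_commuting_commutes[of y "x\<^sup>2" 2] power_commuting_commutes[of x y 2] assms
  by (simp add: power2_eq_square)

definition ainv :: "'a::ring_1 \<Rightarrow> 'a" where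
  "ainv u = (SOME v. u * v = 1 \<and> v * u = 1)"

lemma ainv:
  assumes "u \<in> invertibles"
  shows "u * ainv u = 1" "ainv u * u = 1"
  using someI_ex[of "\<lambda>v. u * v = 1 \<and> v * u = 1"] assms
  unfolding ainv_def invertibles_def by auto

lemma ainv_cancel:
  assumes "u \<in> invertibles"
  shows "u * (ainv u * x) = x" "ainv u * (u * x) = x"
  by (simp_all add: ainv[OF assms] mult.assoc[symmetric])

lemma invertiblesI: "u * v = 1 \<Longrightarrow> v * u = 1 \<Longrightarrow> u \<in> invertibles"
  unfolding invertibles_def by blast

lemma ainv_unique:
  assumes "u * v = 1" "v * (u::'a::ring_1) = 1"
  shows "ainv u = v"
proof -
  have "u \<in> invertibles" using assms by (rule invertiblesI)
  then have "ainv u * (u * v) = v" by (simp add: ainv mult.assoc[symmetric])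
  then show ?thesis using assms by simp
qed

lemma ainv_in_invertibles: "u \<in> invertibles \<Longrightarrow> ainv u \<in> invertibles"
  by (rule invertiblesI[of _ u]) (simp_all add: ainv)

lemma one_in_invertibles [simp]: "1 \<in> invertibles"
  by (rule invertiblesI[of _ 1]) auto

lemma invertibles_mult:
  assumes "u \<in> invertibles" "v \<in> invertibles"
  shows "u * v \<in> invertibles"
proof (rule invertiblesI[of _ "ainv v * ainv u"])
  show "u * v * (ainv v * ainv u) = 1"
    using ainv[OF assms(1)] ainv[OF assms(2)] by (metis mult.assoc mult_1_right)
  show "ainv v * ainv u * (u * v) = 1"
    using ainv[OF assms(1)] ainv[OF assms(2)] by (metis mult.assoc mult_1_left)
qed

text \<open>
  For commuting factors an inverse of the product provides a left and a right inverse of each factor.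
\<close>

lemma invertible_factor_commute:
  assumes "u * v = v * u" "u * v \<in> invertibles"
  shows "u \<in> invertibles"
proof -
  let ?w = "ainv (u * v)"
  have 1: "u * (v * ?w) = 1" using ainv(1)[OF assms(2)] by (simp add: mult.assoc)
  have 2: "(?w * v) * u = 1" using ainv(2)[OF assms(2)] assms(1) by (simp add: mult.assoc)
  have "?w * v = ?w * v * (u * (v * ?w))" using 1 by simp
  also have "\<dots> = v * ?w" using 2 by (simp add: mult.assoc[symmetric])
  finally show ?thesis using 1 2 by (intro invertiblesI[of _ "v * ?w"]) auto
qed

lemma invertibles_cancel_right:
  assumes "v \<in> invertibles" "u * v \<in> invertibles"
  shows "u \<in> invertibles"
proof -
  have "u * v * ainv v \<in> invertibles"
    by (intro invertibles_mult ainv_in_invertibles assms)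
  then show ?thesis by (simp only: mult.assoc ainv[OF assms(1)] mult_1_right)
qed

lemma ainv_commute:
  assumes "u \<in> invertibles" "u * x = x * u"
  shows "ainv u * x = x * ainv u"
proof -
  have "ainv u * x = ainv u * (x * u) * ainv u" by (simp add: mult.assoc ainv assms)
  also have "\<dots> = ainv u * (u * x) * ainv u" by (simp only: assms(2))
  also have "\<dots> = x * ainv u" by (simp add: ainv_cancel mult.assoc assms(1))
  finally show ?thesis .
qed

text \<open>
  Hua's identity \<open>(k\<^sup>-\<^sup>1 + (1 - k)\<^sup>-\<^sup>1)\<^sup>-\<^sup>1 = k - k\<^sup>2\<close> expresses the square through sums and inverses.
  Consequently an additive map that respects inverses also respects squares.
\<close>

lemma hua_identity:
  assumes "k \<in> invertibles" "1 - k \<in> invertibles"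
  shows "(ainv k + ainv (1 - k)) * (k - k * k) = (1::'c::ring_1)"
    "(k - k * k) * (ainv k + ainv (1 - k)) = 1"
proof -
  have "k - k * k = k * (1 - k)" "k - k * k = (1 - k) * k" by (simp_all add: algebra_simps)
  then have "ainv k * (k - k * k) = 1 - k" "ainv (1 - k) * (k - k * k) = k"
    "(k - k * k) * ainv k = 1 - k" "(k - k * k) * ainv (1 - k) = k"
    using assms by (metis ainv_cancel mult.assoc ainv mult_1_right)+
  then show "(ainv k + ainv (1 - k)) * (k - k * k) = 1" "(k - k * k) * (ainv k + ainv (1 - k)) = 1"
    by (simp_all only: distrib_left distrib_right) simp_all
qed

lemma scaleC_invertibles:
  assumes "c \<noteq> 0"
  shows "c *\<^sub>C x \<in> invertibles \<longleftrightarrow> (x::'a::complex_banach_algebra_1) \<in> invertibles"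
proof -
  have *: "d *\<^sub>C y \<in> invertibles" if "d \<noteq> 0" "y \<in> invertibles" for d and y :: 'a
    by (rule invertiblesI[of _ "(1/d) *\<^sub>C ainv y"]) (use that in \<open>simp_all add: scaleC_simps ainv\<close>)
  show ?thesis
    using *[of c x] *[of "1/c" "c *\<^sub>C x"] assms by (auto simp: scaleC_simps)
qed

lemma minus_in_invertibles_iff: "- x \<in> invertibles \<longleftrightarrow> (x::'a::ring_1) \<in> invertibles"
proof -
  have "- y \<in> invertibles" if "y \<in> invertibles" for y :: 'a
    by (rule invertiblesI[of _ "- ainv y"]) (use that in \<open>simp_all add: ainv\<close>)
  from this[of x] this[of "- x"] show ?thesis by auto
qed

section \<open>The resolvent and Gelfand's estimate\<close>

lemma neumann_power_bound:
  fixes x :: "'a::unital_banach"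
  assumes bd: "\<And>n. norm (x ^ n) \<le> C * \<rho> ^ n" and \<rho>: "0 \<le> \<rho>" "\<rho> < 1"
  shows "1 - x \<in> invertibles"
proof (rule invertiblesI)
  let ?s = "\<Sum>n. x ^ n"
  have sm: "summable (\<lambda>n. x ^ n)"
    by (rule summable_comparison_test'[of "\<lambda>n. C * \<rho> ^ n" 0])
       (use bd \<rho> in \<open>auto intro!: summable_mult summable_geometric\<close>)
  have "?s = 1 + (\<Sum>n. x ^ Suc n)" using suminf_split_head[OF sm] by simp
  moreover have "(\<Sum>n. x ^ Suc n) = x * ?s" by (simp add: suminf_mult[OF sm])
  moreover have "(\<Sum>n. x ^ Suc n) = ?s * x"
    by (simp add: suminf_mult2[OF sm] power_Suc2 del: power_Suc)
  ultimately show "(1 - x) * ?s = 1" "?s * (1 - x) = 1"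
    by (simp_all add: algebra_simps) 
qed

lemma one_minus_invertible:
  fixes x :: "'a::unital_banach"
  assumes "norm x < 1"
  shows "1 - x \<in> invertibles"
  by (rule neumann_power_bound[of x 1 "norm x"]) (use assms in \<open>auto intro: norm_power_ineq\<close>)

text \<open>
  From \<open>u v = 1\<close> one gets \<open>u = 1 - u (v - 1)\<close>, which bounds \<open>u\<close> by itself with a factor \<open>q < 1\<close>.
\<close>

lemma norm_le_if_right_inverse_near_one:
  fixes u v :: "'a::unital_banach"
  assumes "u * v = 1" "norm (v - 1) \<le> q" "q < 1"
  shows "norm u \<le> 1 / (1 - q)"
proof -
  have "u = 1 - u * (v - 1)" using assms(1) by (simp add: algebra_simps)
  then have "norm u \<le> 1 + norm (u * (v - 1))"
    by (metis norm_one norm_triangle_ineq4)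
  also have "\<dots> \<le> 1 + norm u * q"
    using norm_mult_ineq[of u "v - 1"] mult_left_mono[OF assms(2), of "norm u"] by simp
  finally show ?thesis using assms(3) by (simp add: field_simps)
qed

text \<open>
  The factorization \<open>v = u (1 - u\<^sup>-\<^sup>1 (u - v))\<close> gives invertibility, and the resolvent identity
  \<open>v\<^sup>-\<^sup>1 - u\<^sup>-\<^sup>1 = v\<^sup>-\<^sup>1 (u - v) u\<^sup>-\<^sup>1\<close> the estimate.
\<close>

lemma
  fixes u v :: "'a::unital_banach"
  assumes u: "u \<in> invertibles" and near: "norm (u - v) * norm (ainv u) \<le> 1/2"
  shows invertible_near: "v \<in> invertibles"
    and norm_ainv_diff: "norm (ainv v - ainv u) \<le> 2 * (norm (ainv u))\<^sup>2 * norm (u - v)"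
proof -
  let ?a = "ainv u"
  have "norm (?a * (u - v)) \<le> 1/2"
    using norm_mult_ineq[of ?a "u - v"] near by (simp add: mult.commute)
  then have "1 - ?a * (u - v) \<in> invertibles" by (intro one_minus_invertible) auto
  with u have "u * (1 - ?a * (u - v)) \<in> invertibles" by (rule invertibles_mult)
  moreover have "u * (1 - ?a * (u - v)) = u - (u * ?a) * (u - v)" by (simp add: algebra_simps)
  ultimately show v: "v \<in> invertibles" by (simp add: ainv[OF u])
  let ?b = "ainv v"
  have "?b * (u - v) * ?a = ?b * (u * ?a) - (?b * v) * ?a" by (simp add: algebra_simps)
  then have eq: "?b - ?a = ?b * (u - v) * ?a" by (simp add: ainv u v)
  have le: "norm (?b - ?a) \<le> norm ?b * (norm (u - v) * norm ?a)"
    unfolding eq mult.assoc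
    by (intro order_trans[OF norm_mult_ineq] mult_left_mono norm_ge_zero norm_mult_ineq)
  also have "\<dots> \<le> norm ?b * (1/2)" using near by (intro mult_left_mono) auto
  finally have "norm ?b \<le> 2 * norm ?a" using norm_triangle_ineq2[of ?b ?a] by simp
  then have "norm ?b * (norm (u - v) * norm ?a) \<le> 2 * norm ?a * (norm (u - v) * norm ?a)"
    by (intro mult_right_mono) auto
  with le show "norm (?b - ?a) \<le> 2 * (norm ?a)\<^sup>2 * norm (u - v)"
    by (simp add: power2_eq_square mult_ac)
qed

lemma isCont_ainv:
  fixes u :: "'a::unital_banach"
  assumes u: "u \<in> invertibles"
  shows "isCont ainv u"
proof -
  have "((\<lambda>v. norm (u - v) * norm (ainv u)) \<longlongrightarrow> 0) (at u)"
    by (auto intro!: tendsto_eq_intros)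
  then have "\<forall>\<^sub>F v in at u. norm (u - v) * norm (ainv u) < 1/2"
    by (rule order_tendstoD) simp
  then have ev: "\<forall>\<^sub>F v in at u. norm (ainv v - ainv u) \<le> 2 * (norm (ainv u))\<^sup>2 * norm (u - v)"
    by eventually_elim (rule norm_ainv_diff[OF u], simp)
  have "((\<lambda>v. 2 * (norm (ainv u))\<^sup>2 * norm (u - v)) \<longlongrightarrow> 0) (at u)"
    by (auto intro!: tendsto_eq_intros)
  then have "((\<lambda>v. ainv v - ainv u) \<longlongrightarrow> 0) (at u)"
    using ev by (rule Lim_null_comparison[rotated])
  then show ?thesis unfolding isCont_def by (rule LIM_zero_cancel)
qed

lemma continuous_on_ainv:
  fixes f :: "'b::topological_space \<Rightarrow> 'a::unital_banach"
  assumes "continuous_on S f" "\<And>x. x \<in> S \<Longrightarrow> f x \<in> invertibles"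
  shows "continuous_on S (\<lambda>x. ainv (f x))"
proof -
  have "continuous_on invertibles (ainv :: 'a \<Rightarrow> 'a)"
    by (intro continuous_at_imp_continuous_on ballI isCont_ainv)
  from continuous_on_compose2[OF this assms(1)] show ?thesis using assms(2) by blast
qed

lemma primitive_root_of_unity:
  fixes n :: nat
  assumes "n > 0"
  obtains \<omega> :: complex
  where "\<omega> ^ n = 1" "\<And>k. 0 < k \<Longrightarrow> k < n \<Longrightarrow> \<omega> ^ k \<noteq> 1" "cmod \<omega> = 1"
proof
  let ?\<omega> = "cis (2 * pi / n)"
  have pw: "?\<omega> ^ k = cis (2 * pi * real k / real n)" for k
    by (simp only: Complex.DeMoivre) (simp add: field_simps)
  show "?\<omega> ^ n = 1" using assms by (simp add: pw)
  show "cmod ?\<omega> = 1" by simp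
  fix k assume k: "0 < k" "k < n"
  have inj: "inj_on (\<lambda>k. cis (2 * pi * real k / real n)) {..<n}"
    using Complex.bij_betw_roots_unity[OF assms] by (simp add: bij_betw_def)
  then have "cis (2 * pi * real k / real n) \<noteq> cis (2 * pi * real 0 / real n)"
    using k inj_onD[OF inj, of k 0] by auto
  then show "?\<omega> ^ k \<noteq> 1" by (simp only: pw) simp
qed

lemma sum_powers_root_of_unity:
  fixes \<omega> :: complex
  assumes "\<omega> ^ n = 1" "\<omega> ^ k \<noteq> 1"
  shows "(\<Sum>j<n. (\<omega> ^ k) ^ j) = 0"
proof -
  have "(\<omega> ^ k) ^ n = 1" by (metis assms(1) mult.commute power_mult power_one)
  then show ?thesis using geometric_sum[OF assms(2), of n] by simp
qed

lemma geometric_sum_mult: "(\<Sum>k<n. z ^ k) * (1 - z) = 1 - (z::'a::ring_1) ^ n"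
proof (induction n)
  case (Suc n)
  have "(\<Sum>k<Suc n. z ^ k) * (1 - z) = (\<Sum>k<n. z ^ k) * (1 - z) + (z ^ n - z ^ n * z)"
    by (simp add: algebra_simps)
  also have "\<dots> = 1 - z ^ Suc n" by (simp only: Suc power_Suc2) simp
  finally show ?case .
qed simp

text \<open>
  Multiplying \<open>(1 - \<omega>\<^sup>j y)\<^sup>-\<^sup>1\<close> by \<open>1 - y\<^sup>n = 1 - (\<omega>\<^sup>j y)\<^sup>n\<close> leaves a geometric sum, and summation over \<open>j\<close>
  removes all its terms except the constant one. This partial fraction decomposition of \<open>(1 - y\<^sup>n)\<^sup>-\<^sup>1\<close>
  plays the role of Cauchy's integral formula.
\<close>

lemma resolvent_average:
  fixes y :: "'a::unital_banach"
  assumes n: "n > 0" and \<omega>: "\<omega> ^ n = 1" "\<And>k. 0 < k \<Longrightarrow> k < n \<Longrightarrow> \<omega> ^ k \<noteq> 1"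
    and inv: "\<And>j. j < n \<Longrightarrow> 1 - \<omega> ^ j *\<^sub>C y \<in> invertibles"
  shows "(1 - y ^ n) * ((1 / real n) *\<^sub>R (\<Sum>j<n. ainv (1 - \<omega> ^ j *\<^sub>C y))) = 1"
proof -
  have *: "(1 - y ^ n) * ainv (1 - \<omega> ^ j *\<^sub>C y) = (\<Sum>k<n. (\<omega> ^ k) ^ j *\<^sub>C y ^ k)" if "j < n" for j
  proof -
    let ?z = "\<omega> ^ j *\<^sub>C y"
    have "?z ^ n = y ^ n"
      using \<omega>(1) by (metis mult.commute power_mult power_one power_scaleC scaleC_one)
    then have "1 - y ^ n = (\<Sum>k<n. ?z ^ k) * (1 - ?z)" by (simp add: geometric_sum_mult)
    then have "(1 - y ^ n) * ainv (1 - ?z) = (\<Sum>k<n. ?z ^ k)"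
      by (simp add: mult.assoc ainv[OF inv[OF that]])
    moreover have "(\<omega> ^ j) ^ k = (\<omega> ^ k) ^ j" for k by (metis mult.commute power_mult)
    ultimately show ?thesis by (simp add: power_scaleC)
  qed
  have "(1 - y ^ n) * (\<Sum>j<n. ainv (1 - \<omega> ^ j *\<^sub>C y)) = (\<Sum>j<n. \<Sum>k<n. (\<omega> ^ k) ^ j *\<^sub>C y ^ k)"
    by (simp add: sum_distrib_left *)
  also have "\<dots> = (\<Sum>k<n. \<Sum>j<n. (\<omega> ^ k) ^ j *\<^sub>C y ^ k)" by (rule sum.swap)
  also have "\<dots> = (\<Sum>k<n. (\<Sum>j<n. (\<omega> ^ k) ^ j) *\<^sub>C y ^ k)" by (simp add: scaleC_sum_left)
  also have "\<dots> = (\<Sum>k<n. if k = 0 then of_nat n *\<^sub>C 1 else 0)"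
    by (intro sum.cong refl) (use \<omega> sum_powers_root_of_unity in auto)
  also have "\<dots> = of_nat n *\<^sub>C 1" using n by (simp add: sum.delta)
  finally show ?thesis using n by (simp add: scaleR_scaleC scaleC_simps)
qed

text \<open>
  Rickart's argument. By \<open>resolvent_average\<close>, \<open>(1 - (u x)\<^sup>n)\<^sup>-\<^sup>1\<close> is an average of values of the
  function \<open>u \<mapsto> (1 - u x)\<^sup>-\<^sup>1\<close>, which is uniformly continuous on the disc of radius \<open>1/\<rho>\<close>; so these inverses
  are equicontinuous in \<open>u\<close>, uniformly in \<open>n\<close>. Hence if \<open>s\<^sup>n x\<^sup>n \<rightarrow> 0\<close>, then \<open>t\<^sup>n x\<^sup>n\<close> stays bounded for all \<open>t\<close>
  within a fixed distance \<open>\<delta>\<close> of \<open>s\<close>, and finitely many such steps lead from \<open>0\<close> to \<open>1/\<rho>\<close>.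
\<close>

lemma power_bound_if_resolvent_defined:
  fixes x :: "'a::unital_banach"
  assumes inv: "\<And>c. cmod c \<ge> \<rho> \<Longrightarrow> c *\<^sub>C 1 - x \<in> invertibles" and \<rho>: "\<rho> > 0"
  shows "\<exists>C. \<forall>n. norm (x ^ n) \<le> C * \<rho> ^ n"
proof -
  let ?B = "cball (0::complex) (1 / \<rho>)"
  have invu: "1 - u *\<^sub>C x \<in> invertibles" if "u \<in> ?B" for u
  proof (cases "u = 0")
    case False
    have "cmod (1/u) \<ge> \<rho>" using that \<rho> False by (simp add: norm_divide field_simps)
    from inv[OF this] have "u *\<^sub>C ((1/u) *\<^sub>C 1 - x) \<in> invertibles"
      using False by (simp add: scaleC_invertibles)
    then show ?thesis using False by (simp add: scaleC_simps)
  qed auto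
  have "continuous_on ?B (\<lambda>u. ainv (1 - u *\<^sub>C x))"
    using invu by (intro continuous_on_ainv continuous_intros) auto
  then have "uniformly_continuous_on ?B (\<lambda>u. ainv (1 - u *\<^sub>C x))"
    by (intro compact_uniformly_continuous) auto
  then obtain \<delta> where \<delta>: "\<delta> > 0" and ucont:
    "\<And>u v. u \<in> ?B \<Longrightarrow> v \<in> ?B \<Longrightarrow> dist u v < \<delta> \<Longrightarrow>
       dist (ainv (1 - u *\<^sub>C x)) (ainv (1 - v *\<^sub>C x)) < 1/2"
    unfolding uniformly_continuous_on_def
    by (metis half_gt_zero_iff zero_less_one dist_commute)
  define bd where "bd = (\<lambda>s::real. \<exists>C. \<forall>n. norm (x ^ n) * s ^ n \<le> C)"
  \<comment> \<open>one step of length less than \<open>\<delta>\<close>: if \<open>norm (s\<^sup>n x\<^sup>n) \<le> 1/4\<close>, the average at \<open>s\<close> is within \<open>1/3\<close> of \<open>1\<close>,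
    so the one at \<open>t\<close> is within \<open>1/3 + 1/2 = 5/6\<close>, which bounds \<open>norm (1 - t\<^sup>n x\<^sup>n)\<close> by \<open>6\<close>\<close>
  have step: "bd t"
    if s: "0 \<le> s" "s \<le> 1 / \<rho>" and t: "0 \<le> t" "t \<le> 1 / \<rho>" and st: "\<bar>s - t\<bar> < \<delta>"
      and small: "\<And>n. n \<ge> m \<Longrightarrow> norm (x ^ n) * s ^ n \<le> 1/4" for s t m
  proof -
    have seven: "norm (x ^ n) * t ^ n \<le> 7" if n: "n \<ge> Suc m" for n
    proof -
      obtain \<omega> :: complex where \<omega>: "\<omega> ^ n = 1" "\<And>k. 0 < k \<Longrightarrow> k < n \<Longrightarrow> \<omega> ^ k \<noteq> 1" "cmod \<omega> = 1"
        using primitive_root_of_unity[of n] n by auto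
      define F where "F = (\<lambda>u. (1 / real n) *\<^sub>R (\<Sum>j<n. ainv (1 - (\<omega> ^ j * u) *\<^sub>C x)))"
      have inB: "\<omega> ^ j * of_real r \<in> ?B" if "0 \<le> r" "r \<le> 1 / \<rho>" for r j
        using that by (simp add: norm_mult norm_power \<omega>)
      have F: "(1 - (of_real r *\<^sub>C x) ^ n) * F (of_real r) = 1" if "0 \<le> r" "r \<le> 1 / \<rho>" for r
      proof -
        have "1 - \<omega> ^ j *\<^sub>C (complex_of_real r *\<^sub>C x) \<in> invertibles" for j
          using invu[OF inB[OF that]] by (simp add: scaleC_simps)
        from resolvent_average[of n \<omega> "complex_of_real r *\<^sub>C x", OF _ \<omega>(1,2) this] n
        show ?thesis by (simp add: F_def scaleC_simps)
      qed
      have nY: "norm ((complex_of_real r *\<^sub>C x) ^ n) = norm (x ^ n) * r ^ n" if "0 \<le> r" for r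
        using that by (simp add: power_scaleC norm_scaleC norm_power mult.commute)
      let ?Y = "(complex_of_real s *\<^sub>C x) ^ n"
      have Y: "norm ?Y \<le> 1/4" using small[of n] n s by (simp add: nY)
      have eq: "F (of_real s) = 1 + ?Y * F (of_real s)" using F[OF s] by (simp add: algebra_simps)
      then have "norm (F (of_real s)) \<le> 1 + norm (?Y * F (of_real s))"
        by (metis norm_one norm_triangle_ineq)
      also have "norm (?Y * F (of_real s)) \<le> 1/4 * norm (F (of_real s))"
        by (rule order_trans[OF norm_mult_ineq]) (intro mult_right_mono Y norm_ge_zero)
      finally have "norm (F (of_real s)) \<le> 4/3" by simp
      moreover have "norm (F (of_real s) - 1) \<le> norm ?Y * norm (F (of_real s))"
        using eq norm_mult_ineq[of ?Y "F (of_real s)"] by (metis add_diff_cancel_left')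
      moreover have "norm ?Y * norm (F (of_real s)) \<le> 1/4 * norm (F (of_real s))"
        by (intro mult_right_mono Y norm_ge_zero)
      ultimately have Fs: "norm (F (of_real s) - 1) \<le> 1/3" by linarith
      have "norm (F (of_real t) - F (of_real s)) \<le>
          1 / real n * (\<Sum>j<n. norm (ainv (1 - (\<omega> ^ j * of_real t) *\<^sub>C x) - ainv (1 - (\<omega> ^ j * of_real s) *\<^sub>C x)))"
        unfolding F_def scaleR_diff_right[symmetric] sum_subtractf[symmetric] norm_scaleR
        using n by (auto intro!: divide_right_mono norm_sum)
      also have "\<dots> \<le> 1 / real n * (\<Sum>j<n. 1/2)"
      proof (intro mult_left_mono sum_mono)
        fix j
        have "dist (\<omega> ^ j * of_real t) (\<omega> ^ j * of_real s) = \<bar>t - s\<bar>"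
          by (simp add: dist_norm right_diff_distrib[symmetric] norm_mult norm_power \<omega>
              of_real_diff[symmetric] del: of_real_diff)
        then show "norm (ainv (1 - (\<omega> ^ j * of_real t) *\<^sub>C x) - ainv (1 - (\<omega> ^ j * of_real s) *\<^sub>C x)) \<le> 1/2"
          using ucont[OF inB[OF t] inB[OF s]] st by (simp add: dist_norm abs_minus_commute less_imp_le)
      qed auto
      also have "\<dots> = 1/2" using n by simp
      finally have "norm (F (of_real t) - 1) \<le> 5/6"
        using Fs norm_triangle_ineq[of "F (of_real t) - F (of_real s)" "F (of_real s) - 1"] by simp
      from norm_le_if_right_inverse_near_one[OF F[OF t] this]
      have "norm (1 - (complex_of_real t *\<^sub>C x) ^ n) \<le> 6" by simp
      then have "norm ((complex_of_real t *\<^sub>C x) ^ n) \<le> 7"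
        using norm_triangle_ineq4[of 1 "1 - (complex_of_real t *\<^sub>C x) ^ n"] by simp
      then show ?thesis using t by (simp add: nY)
    qed
    have "norm (x ^ n) * t ^ n \<le> 7 + (\<Sum>k\<le>m. norm (x ^ k) * t ^ k)" for n
    proof (cases "n \<ge> Suc m")
      case True
      then show ?thesis using seven[OF True] t by (simp add: sum_nonneg add_increasing2)
    next
      case False
      then have "norm (x ^ n) * t ^ n \<le> (\<Sum>k\<le>m. norm (x ^ k) * t ^ k)"
        using t by (intro member_le_sum) auto
      then show ?thesis by simp
    qed
    then show ?thesis unfolding bd_def by blast
  qed
  have "bd (min (real k * \<delta> / 2) (1 / \<rho>))" for k
  proof (induction k)
    case 0
    have "norm (x ^ n) * 0 ^ n \<le> 1" for n by (cases n) auto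
    then show ?case using \<rho> by (auto simp: bd_def)
  next
    case (Suc k)
    define s where "s = min (real k * \<delta> / 2) (1 / \<rho>)"
    define t where "t = min (real (Suc k) * \<delta> / 2) (1 / \<rho>)"
    \<comment> \<open>boundedness at \<open>s\<close> gives convergence to \<open>0\<close> only strictly below \<open>s\<close>, hence the retreat to \<open>s - \<delta>/4\<close>\<close>
    define s' where "s' = max 0 (s - \<delta> / 4)"
    have s: "0 \<le> s" "s \<le> 1 / \<rho>" using \<delta> \<rho> by (auto simp: s_def)
    have t: "0 \<le> t" "t \<le> 1 / \<rho>" "s \<le> t" "t \<le> s + \<delta> / 2"
      using \<delta> \<rho> by (auto simp: s_def t_def min_def algebra_simps add_divide_distrib)
    have s': "0 \<le> s'" "s' \<le> 1 / \<rho>" "\<bar>s' - t\<bar> < \<delta>"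
      using s t \<delta> \<rho> by (auto simp: s'_def abs_if max_def)
    obtain C where C: "\<And>n. norm (x ^ n) * s ^ n \<le> C" using Suc by (auto simp: bd_def s_def)
    have "\<exists>m. \<forall>n\<ge>m. norm (x ^ n) * s' ^ n \<le> 1/4"
    proof (cases "s' = 0")
      case True
      then have "norm (x ^ n) * s' ^ n \<le> 1/4" if "n \<ge> 1" for n using that by (simp add: power_0_left)
      then show ?thesis by blast
    next
      case False
      then have pos: "0 < s'" "s' < s" using \<delta> s' by (auto simp: s'_def max_def split: if_splits)
      have "(\<lambda>n. C * (s' / s) ^ n) \<longlonglongrightarrow> C * 0"
        using pos by (intro tendsto_mult tendsto_const LIMSEQ_power_zero) auto
      then have "\<forall>\<^sub>F n in sequentially. C * (s' / s) ^ n < 1/4" by (intro order_tendstoD) auto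
      then obtain m where m: "\<And>n. n \<ge> m \<Longrightarrow> C * (s' / s) ^ n < 1/4"
        by (auto simp: eventually_sequentially)
      have "norm (x ^ n) * s' ^ n \<le> C * (s' / s) ^ n" for n
      proof -
        have "norm (x ^ n) * s' ^ n = (norm (x ^ n) * s ^ n) * (s' / s) ^ n"
          using pos by (simp add: power_divide)
        also have "\<dots> \<le> C * (s' / s) ^ n" using C pos by (intro mult_right_mono) auto
        finally show ?thesis .
      qed
      with m show ?thesis by (meson less_imp_le order_trans)
    qed
    then obtain m where "\<And>n. n \<ge> m \<Longrightarrow> norm (x ^ n) * s' ^ n \<le> 1/4" by blast
    from step[OF s'(1,2) t(1,2) s'(3) this] show ?case by (simp add: t_def)
  qed
  moreover obtain k :: nat where "1 / \<rho> < real k * (\<delta> / 2)"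
    using reals_Archimedean3[of "\<delta> / 2"] \<delta> by (meson half_gt_zero)
  ultimately have "bd (1 / \<rho>)" by (metis less_imp_le min.absorb2 times_divide_eq_right)
  then obtain C where "\<And>n. norm (x ^ n) * (1 / \<rho>) ^ n \<le> C" by (auto simp: bd_def)
  then have "norm (x ^ n) \<le> C * \<rho> ^ n" for n using \<rho> by (simp add: field_simps)
  then show ?thesis by blast
qed

section \<open>The spectrum and the spectral radius\<close>

lemma not_in_spectrum_iff: "c \<notin> spectrum x \<longleftrightarrow> c *\<^sub>C 1 - x \<in> invertibles"
  by (simp add: spectrum_def)

lemma norm_spectrum_le_if_power_bound:
  fixes x :: "'a::unital_banach"
  assumes bd: "\<And>n. norm (x ^ n) \<le> C * \<rho> ^ n" and \<rho>: "0 \<le> \<rho>" and c: "c \<in> spectrum x"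
  shows "cmod c \<le> \<rho>"
proof (rule ccontr)
  assume "\<not> cmod c \<le> \<rho>"
  then have gt: "\<rho> < cmod c" "c \<noteq> 0" using \<rho> by auto
  have "norm (((1/c) *\<^sub>C x) ^ n) \<le> C * (\<rho> / cmod c) ^ n" for n
    using bd[of n] gt
    by (simp add: power_scaleC norm_scaleC norm_power norm_divide power_divide field_simps)
  then have "1 - (1/c) *\<^sub>C x \<in> invertibles"
    using gt \<rho> by (intro neumann_power_bound[of _ C "\<rho> / cmod c"]) auto
  then have "c *\<^sub>C (1 - (1/c) *\<^sub>C x) \<in> invertibles" using gt by (simp add: scaleC_invertibles)
  then have "c *\<^sub>C 1 - x \<in> invertibles" using gt by (simp add: scaleC_simps)
  then show False using c by (simp add: spectrum_def)
qed

lemma norm_spectrum_le: "c \<in> spectrum (x::'a::unital_banach) \<Longrightarrow> cmod c \<le> norm x"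
  by (rule norm_spectrum_le_if_power_bound[of x 1]) (auto intro: norm_power_ineq)

text \<open>
  With empty spectrum the powers of \<open>x\<close> would decay faster than any geometric sequence, in contradiction to
  \<open>x\<^sup>n (x\<^sup>-\<^sup>1)\<^sup>n = 1\<close>.
\<close>

lemma spectrum_nonempty: "spectrum (x::'a::unital_banach) \<noteq> {}"
proof
  assume empty: "spectrum x = {}"
  then have inv: "c *\<^sub>C 1 - x \<in> invertibles" for c by (simp add: spectrum_def)
  from inv[of 0] have x: "x \<in> invertibles" by (simp add: minus_in_invertibles_iff)
  have "ainv x \<noteq> 0" using ainv[OF x] by auto
  then have pos: "0 < norm (ainv x)" by simp
  define \<rho> where "\<rho> = 1 / (2 * norm (ainv x))"
  have \<rho>: "\<rho> > 0" using pos by (simp add: \<rho>_def)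
  obtain C where C: "\<And>n. norm (x ^ n) \<le> C * \<rho> ^ n"
    using power_bound_if_resolvent_defined[OF inv \<rho>] by blast
  have "x ^ n * ainv x ^ n = 1" for n
  proof (induction n)
    case (Suc n)
    have "x ^ Suc n * ainv x ^ Suc n = x ^ n * (x * ainv x) * ainv x ^ n"
      by (simp only: power_Suc2[of x] power_Suc[of "ainv x"] mult.assoc)
    then show ?case using Suc by (simp add: ainv x)
  qed simp
  then have "1 \<le> norm (x ^ n) * norm (ainv x ^ n)" for n
    by (metis norm_mult_ineq norm_one)
  then have "1 \<le> norm (x ^ n) * norm (ainv x) ^ n" for n
    using mult_left_mono[OF norm_power_ineq norm_ge_zero] by (rule order_trans)
  moreover have "norm (x ^ n) * norm (ainv x) ^ n \<le> C * (1/2) ^ n" for n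
  proof -
    have "norm (x ^ n) * norm (ainv x) ^ n \<le> C * \<rho> ^ n * norm (ainv x) ^ n"
      by (intro mult_right_mono C) auto
    also have "\<dots> = C * (\<rho> * norm (ainv x)) ^ n" by (simp add: power_mult_distrib)
    also have "\<rho> * norm (ainv x) = 1/2" using pos by (simp add: \<rho>_def)
    finally show ?thesis .
  qed
  ultimately have ge: "1 \<le> C * (1/2) ^ n" for n by (meson order_trans)
  have "(\<lambda>n. C * (1/2) ^ n) \<longlonglongrightarrow> C * 0"
    by (intro tendsto_mult tendsto_const LIMSEQ_power_zero) auto
  from LIMSEQ_le_const[OF this, of 1] ge show False by auto
qed

lemma closed_spectrum: "closed (spectrum (x::'a::unital_banach))"
proof -
  have "open (- spectrum x)"
  proof (rule Topological_Spaces.openI)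
    fix c assume "c \<in> - spectrum x"
    then have inv: "c *\<^sub>C 1 - x \<in> invertibles" by (simp add: spectrum_def)
    let ?N = "norm (ainv (c *\<^sub>C 1 - x))"
    have "ainv (c *\<^sub>C 1 - x) \<noteq> 0" using ainv[OF inv] by auto
    then have pos: "0 < ?N" by simp
    have "d \<in> - spectrum x" if d: "d \<in> ball c (1 / (2 * ?N))" for d
    proof -
      have "norm ((c *\<^sub>C 1 - x) - (d *\<^sub>C 1 - x)) = cmod (c - d)"
        by (simp add: scaleC_diff_left[symmetric] norm_scaleC)
      then have "norm ((c *\<^sub>C 1 - x) - (d *\<^sub>C 1 - x)) * ?N \<le> 1/2"
        using d pos by (simp add: dist_norm field_simps)
      from invertible_near[OF inv this] show ?thesis by (simp add: spectrum_def)
    qed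
    then have "ball c (1 / (2 * ?N)) \<subseteq> - spectrum x" by blast
    then show "\<exists>T. open T \<and> c \<in> T \<and> T \<subseteq> - spectrum x"
      using pos by (intro exI[of _ "ball c (1 / (2 * ?N))"]) simp
  qed
  then show ?thesis by (simp add: closed_def)
qed

lemma compact_spectrum: "compact (spectrum (x::'a::unital_banach))"
proof -
  have "spectrum x \<subseteq> cball 0 (norm x)" using norm_spectrum_le by auto
  then show ?thesis using closed_spectrum bounded_subset[OF bounded_cball] compact_eq_bounded_closed by blast
qed

definition specrad :: "'a::complex_banach_algebra_1 \<Rightarrow> real" where
  "specrad x = Sup (cmod ` spectrum x)"

lemma norm_spectrum_le_specrad:
  assumes "c \<in> spectrum (x::'a::unital_banach)"
  shows "cmod c \<le> specrad x"
  unfolding specrad_def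
  using assms norm_spectrum_le by (intro cSup_upper) (auto intro!: bdd_aboveI[of _ "norm x"])

lemma specrad_le_iff: "specrad (x::'a::unital_banach) \<le> \<rho> \<longleftrightarrow> (\<forall>c\<in>spectrum x. cmod c \<le> \<rho>)"
  unfolding specrad_def
  using spectrum_nonempty[of x] norm_spectrum_le
  by (subst cSup_le_iff) (auto intro!: bdd_aboveI[of _ "norm x"])

lemma specrad_nonneg: "0 \<le> specrad (x::'a::unital_banach)"
proof -
  obtain c where "c \<in> spectrum x" using spectrum_nonempty by blast
  from norm_spectrum_le_specrad[OF this] show ?thesis using norm_ge_zero[of c] by linarith
qed

lemma specrad_le_norm: "specrad (x::'a::unital_banach) \<le> norm x"
  by (simp add: specrad_le_iff norm_spectrum_le)

lemma power_bound_if_specrad_less: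
  fixes x :: "'a::unital_banach"
  assumes "specrad x < \<rho>"
  obtains C where "\<And>n. norm (x ^ n) \<le> C * \<rho> ^ n"
proof -
  have "\<rho> > 0" using assms specrad_nonneg[of x] by linarith
  moreover have "c *\<^sub>C 1 - x \<in> invertibles" if "cmod c \<ge> \<rho>" for c
    using that assms norm_spectrum_le_specrad[of c x] not_in_spectrum_iff[of c x] by fastforce
  ultimately show ?thesis using power_bound_if_resolvent_defined[of \<rho> x] that by blast
qed

lemma specrad_le_if_power_bound:
  fixes x :: "'a::unital_banach"
  assumes "\<And>n. norm (x ^ n) \<le> C * \<rho> ^ n" "0 \<le> \<rho>"
  shows "specrad x \<le> \<rho>"
  unfolding specrad_le_iff using norm_spectrum_le_if_power_bound[OF assms] by blast

lemma specrad_less_one_invertible: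
  assumes "specrad (x::'a::unital_banach) < 1"
  shows "1 - x \<in> invertibles"
  using norm_spectrum_le_specrad[of 1 x] assms not_in_spectrum_iff[of 1 x] by (auto simp: scaleC_one)

lemma power_mult_commuting:
  assumes "x * y = y * (x::'a::monoid_mult)"
  shows "(x * y) ^ n = x ^ n * y ^ n"
proof (induction n)
  case (Suc n)
  have "(x * y) ^ Suc n = x ^ n * (y ^ n * x) * y" by (simp only: power_Suc2 Suc mult.assoc)
  also have "y ^ n * x = x * y ^ n" by (rule power_commuting_commutes) (simp add: assms)
  also have "x ^ n * (x * y ^ n) * y = x ^ Suc n * y ^ Suc n" by (simp only: power_Suc2 mult.assoc)
  finally show ?case .
qed simp

text \<open>
  For commuting elements \<open>(x y)\<^sup>n = x\<^sup>n y\<^sup>n\<close>, so the power bounds of the factors multiply.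
\<close>

lemma specrad_mult_commuting:
  fixes x y :: "'a::unital_banach"
  assumes comm: "x * y = y * x"
  shows "specrad (x * y) \<le> specrad x * specrad y"
proof -
  have "specrad (x * y) \<le> (specrad x + e) * (specrad y + e)" if "e > 0" for e
  proof -
    obtain C where C: "\<And>n. norm (x ^ n) \<le> C * (specrad x + e) ^ n"
      using power_bound_if_specrad_less[of x "specrad x + e"] \<open>e > 0\<close> by auto
    obtain D where D: "\<And>n. norm (y ^ n) \<le> D * (specrad y + e) ^ n"
      using power_bound_if_specrad_less[of y "specrad y + e"] \<open>e > 0\<close> by auto
    have C0: "C \<ge> 0" using C[of 0] by (simp add: order_trans[OF zero_le_one])
    have pow: "(x * y) ^ n = x ^ n * y ^ n" for n
      by (rule power_mult_commuting) (rule comm)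
    have "norm ((x * y) ^ n) \<le> C * D * ((specrad x + e) * (specrad y + e)) ^ n" for n
    proof -
      have "norm ((x * y) ^ n) \<le> norm (x ^ n) * norm (y ^ n)"
        unfolding pow by (rule norm_mult_ineq)
      also have "\<dots> \<le> (C * (specrad x + e) ^ n) * (D * (specrad y + e) ^ n)"
        using C0 \<open>e > 0\<close> specrad_nonneg[of x] by (intro mult_mono C D) auto
      also have "\<dots> = C * D * ((specrad x + e) * (specrad y + e)) ^ n"
        by (simp add: power_mult_distrib)
      finally show ?thesis .
    qed
    then show ?thesis
      using \<open>e > 0\<close> specrad_nonneg[of x] specrad_nonneg[of y] by (intro specrad_le_if_power_bound) auto
  qed
  then have ev: "\<forall>\<^sub>F e in at_right 0. specrad (x * y) \<le> (specrad x + e) * (specrad y + e)"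
    by (simp add: eventually_at_filter)
  have "((\<lambda>e. (specrad x + e) * (specrad y + e)) \<longlongrightarrow> (specrad x + 0) * (specrad y + 0)) (at_right 0)"
    by (intro tendsto_intros)
  from tendsto_lowerbound[OF this ev] show ?thesis by simp
qed

lemma spectrum_scaleC_iff:
  assumes "c \<noteq> 0"
  shows "d \<in> spectrum (c *\<^sub>C (x::'a::unital_banach)) \<longleftrightarrow> d / c \<in> spectrum x"
proof -
  have "d *\<^sub>C 1 - c *\<^sub>C x = c *\<^sub>C ((d / c) *\<^sub>C 1 - x)" using assms by (simp add: scaleC_simps)
  then show ?thesis using assms by (simp add: spectrum_def scaleC_invertibles)
qed

lemma spectrum_scaleC:
  assumes "d \<in> spectrum (c *\<^sub>C (x::'a::unital_banach))"
  shows "\<exists>e\<in>spectrum x. d = c * e"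
proof (cases "c = 0")
  case True
  then have "cmod d \<le> 0" using assms norm_spectrum_le[of d "0::'a"] by simp
  then show ?thesis using True spectrum_nonempty[of x] by auto
next
  case False
  then show ?thesis using assms by (intro bexI[of _ "d / c"]) (simp_all add: spectrum_scaleC_iff)
qed

lemma spectrum_scaleC_mem: "c \<noteq> 0 \<Longrightarrow> d \<in> spectrum (x::'a::unital_banach) \<Longrightarrow> c * d \<in> spectrum (c *\<^sub>C x)"
  by (simp add: spectrum_scaleC_iff)

lemma specrad_scaleC_le: "specrad (c *\<^sub>C (x::'a::unital_banach)) \<le> cmod c * specrad x"
  unfolding specrad_le_iff
  by (auto dest!: spectrum_scaleC simp: norm_mult intro!: mult_left_mono norm_spectrum_le_specrad)

lemma spectrum_shift: "d \<in> spectrum (x + c *\<^sub>C 1) \<longleftrightarrow> d - c \<in> spectrum (x::'a::unital_banach)"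
proof -
  have "d *\<^sub>C 1 - (x + c *\<^sub>C 1) = (d - c) *\<^sub>C 1 - x" by (simp add: scaleC_simps)
  then show ?thesis by (simp only: spectrum_def mem_Collect_eq)
qed

lemma spectrum_one: "spectrum (1::'a::unital_banach) = {1}"
proof -
  have "c *\<^sub>C 1 - 1 = (c - 1) *\<^sub>C (1::'a)" for c by (simp add: scaleC_simps)
  moreover have "(0::'a) \<notin> invertibles" by (auto simp: invertibles_def)
  ultimately have "c \<in> spectrum (1::'a) \<longleftrightarrow> c = 1" for c
    by (cases "c = 1") (simp_all add: spectrum_def scaleC_invertibles)
  then show ?thesis by blast
qed

lemma power_in_spectrum_power:
  assumes "c \<in> spectrum (x::'a::unital_banach)"
  shows "c ^ n \<in> spectrum (x ^ n)"
proof (rule ccontr)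
  assume no: "c ^ n \<notin> spectrum (x ^ n)"
  define S where "S = (\<Sum>k<n. c ^ (n - Suc k) *\<^sub>C x ^ k)"
  have S1: "(c *\<^sub>C 1 - x) * S = c ^ n *\<^sub>C 1 - x ^ n"
    unfolding S_def
  proof (induction n)
    case (Suc n)
    have "(\<Sum>k<Suc n. c ^ (Suc n - Suc k) *\<^sub>C x ^ k) = c *\<^sub>C (\<Sum>k<n. c ^ (n - Suc k) *\<^sub>C x ^ k) + x ^ n"
    proof -
      have "c ^ (n - k) *\<^sub>C x ^ k = c *\<^sub>C (c ^ (n - Suc k) *\<^sub>C x ^ k)" if "k < n" for k
        using that by (simp add: scaleC_simps power_Suc[symmetric] Suc_diff_Suc del: power_Suc)
      then show ?thesis by (simp add: scaleC_sum_right scaleC_one)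
    qed
    also have "(c *\<^sub>C 1 - x) * \<dots> = c *\<^sub>C ((c *\<^sub>C 1 - x) * (\<Sum>k<n. c ^ (n - Suc k) *\<^sub>C x ^ k)) + (c *\<^sub>C 1 - x) * x ^ n"
      by (simp add: distrib_left mult_scaleC_right)
    also have "\<dots> = c ^ Suc n *\<^sub>C 1 - x ^ Suc n"
      unfolding Suc by (simp add: scaleC_simps left_diff_distrib)
    finally show ?case .
  qed (simp add: scaleC_one)
  have "x * S = S * x"
    by (simp add: S_def sum_distrib_left sum_distrib_right mult_scaleC_left mult_scaleC_right power_commutes)
  then have "(c *\<^sub>C 1 - x) * S = S * (c *\<^sub>C 1 - x)" by (simp add: algebra_simps scaleC_simps)
  then have "c *\<^sub>C 1 - x \<in> invertibles"
    by (rule invertible_factor_commute) (use no in \<open>simp add: S1 spectrum_def\<close>)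
  then show False using assms by (simp add: spectrum_def)
qed

lemma spectrum_power2:
  assumes "d \<in> spectrum (x * (x::'a::unital_banach))"
  shows "\<exists>e\<in>spectrum x. d = e * e"
proof (rule ccontr)
  assume no: "\<not> ?thesis"
  obtain e where e: "d = e * e" by (metis power2_csqrt power2_eq_square)
  with no have "e \<notin> spectrum x" "- e \<notin> spectrum x" by auto
  then have "e *\<^sub>C 1 - x \<in> invertibles" "(- e) *\<^sub>C 1 - x \<in> invertibles" by (simp_all add: spectrum_def)
  then have "(e *\<^sub>C 1 - x) * ((- e) *\<^sub>C 1 - x) \<in> invertibles" by (rule invertibles_mult)
  moreover have "(e *\<^sub>C 1 - x) * ((- e) *\<^sub>C 1 - x) = - (d *\<^sub>C 1 - x * x)"
    by (simp add: e scaleC_simps algebra_simps)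
  ultimately have "d *\<^sub>C 1 - x * x \<in> invertibles" by (simp only: minus_in_invertibles_iff)
  then show False using assms by (simp add: spectrum_def)
qed

lemma spectrum_ainv:
  assumes x: "x \<in> invertibles" and d: "d \<in> spectrum (ainv (x::'a::unital_banach))"
  shows "d \<noteq> 0" "1 / d \<in> spectrum x"
proof -
  show "d \<noteq> 0" 
    using d ainv_in_invertibles[OF x] minus_in_invertibles_iff[of "ainv x"] by (auto simp: spectrum_def)
  then have "d *\<^sub>C 1 - ainv x = - (d *\<^sub>C (ainv x * ((1/d) *\<^sub>C 1 - x)))"
    by (simp add: scaleC_simps right_diff_distrib ainv x)
  then have "ainv x * ((1/d) *\<^sub>C 1 - x) \<notin> invertibles"
    using d \<open>d \<noteq> 0\<close>
    by (simp only: spectrum_def mem_Collect_eq minus_in_invertibles_iff scaleC_invertibles[OF \<open>d \<noteq> 0\<close>]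
        simp_thms)
  then show "1 / d \<in> spectrum x"
    using invertibles_mult[OF ainv_in_invertibles[OF x]] by (auto simp: spectrum_def)
qed

text \<open>
  If \<open>c\<close> is farther than \<open>r(y)\<close> from \<open>\<sigma>(x)\<close>, then \<open>r((c - x)\<^sup>-\<^sup>1) r(y) < 1\<close> and
  \<open>c - x - y = (c - x) (1 - (c - x)\<^sup>-\<^sup>1 y)\<close> is invertible.
\<close>

lemma spectrum_perturb_commuting:
  fixes x y :: "'a::unital_banach"
  assumes comm: "x * y = y * x" and c: "c \<in> spectrum (x + y)"
  shows "\<exists>d\<in>spectrum x. cmod (c - d) \<le> specrad y"
proof (rule ccontr)
  assume no: "\<not> ?thesis"
  then have far: "specrad y < cmod (c - d)" if "d \<in> spectrum x" for d using that by auto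
  have "continuous_on (spectrum x) (\<lambda>d. cmod (c - d))"
    by (intro continuous_on_norm continuous_on_diff continuous_on_const continuous_on_id)
  then obtain d0 where d0: "d0 \<in> spectrum x" "\<And>d. d \<in> spectrum x \<Longrightarrow> cmod (c - d0) \<le> cmod (c - d)"
    using continuous_attains_inf[OF compact_spectrum spectrum_nonempty, of x] by blast
  let ?m = "cmod (c - d0)"
  have m: "specrad y < ?m" "0 < ?m" using far[OF d0(1)] specrad_nonneg[of y] by linarith+
  have "c \<notin> spectrum x" using far[of c] specrad_nonneg[of y] by auto
  then have inv: "c *\<^sub>C 1 - x \<in> invertibles" by (simp add: spectrum_def)
  let ?z = "ainv (c *\<^sub>C 1 - x)"
  have "cmod d \<le> 1 / ?m" if d: "d \<in> spectrum ?z" for d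
  proof -
    have "1 / d \<in> spectrum (c *\<^sub>C 1 - x)" and d_nz: "d \<noteq> 0" using spectrum_ainv[OF inv d] by auto
    then have "(1/d) *\<^sub>C 1 - (c *\<^sub>C 1 - x) \<notin> invertibles" by (simp add: spectrum_def)
    moreover have "(1/d) *\<^sub>C 1 - (c *\<^sub>C 1 - x) = - ((c - 1/d) *\<^sub>C 1 - x)" by (simp add: scaleC_simps)
    ultimately have "c - 1/d \<in> spectrum x"
      by (simp only: spectrum_def mem_Collect_eq minus_in_invertibles_iff simp_thms)
    from d0(2)[OF this] have "?m \<le> 1 / cmod d" by (simp add: norm_divide)
    then show ?thesis using m d_nz by (simp add: field_simps)
  qed
  then have rz: "specrad ?z \<le> 1 / ?m" by (simp add: specrad_le_iff)
  have zy: "?z * y = y * ?z"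
    by (rule ainv_commute[OF inv]) (simp add: algebra_simps comm scaleC_simps)
  have "specrad (?z * y) \<le> specrad ?z * specrad y" by (rule specrad_mult_commuting[OF zy])
  also have "\<dots> \<le> 1 / ?m * specrad y" by (intro mult_right_mono rz specrad_nonneg)
  also have "\<dots> < 1" using m by (simp add: field_simps)
  finally have "1 - ?z * y \<in> invertibles" by (rule specrad_less_one_invertible)
  then have "(c *\<^sub>C 1 - x) * (1 - ?z * y) \<in> invertibles" by (rule invertibles_mult[OF inv])
  moreover have "(c *\<^sub>C 1 - x) * (1 - ?z * y) = c *\<^sub>C 1 - (x + y)"
    by (simp add: right_diff_distrib ainv_cancel inv)
  ultimately show False using c by (simp add: spectrum_def)
qed

lemma specrad_eq_0_iff: "specrad (x::'a::unital_banach) = 0 \<longleftrightarrow> spectrum x = {0}"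
proof
  assume "specrad x = 0"
  then have "spectrum x \<subseteq> {0}" using norm_spectrum_le_specrad[of _ x] by auto
  then show "spectrum x = {0}" using spectrum_nonempty[of x] by auto
qed (simp add: specrad_def)

lemma specrad_mult_quasinilpotent:
  assumes "x * y = y * x" "specrad (x::'a::unital_banach) = 0"
  shows "specrad (x * y) = 0"
  using specrad_mult_commuting[OF assms(1)] assms(2) specrad_nonneg[of "x * y"] by simp

lemma spectrum_add_quasinilpotent:
  assumes comm: "x * y = y * x" and y: "specrad (y::'a::unital_banach) = 0"
  shows "spectrum (x + y) = spectrum x"
proof -
  have sub: "spectrum (u + v) \<subseteq> spectrum u" if "u * v = v * u" "specrad v = 0" for u v :: 'a
  proof
    fix c assume "c \<in> spectrum (u + v)"
    from spectrum_perturb_commuting[OF that(1) this] that(2) show "c \<in> spectrum u" by auto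
  qed
  have "specrad (- y) = 0"
    using specrad_mult_quasinilpotent[OF _ y, of "- 1"] by simp
  then have "spectrum x \<subseteq> spectrum (x + y)"
    using sub[of "x + y" "- y"] comm by (simp add: algebra_simps)
  with sub[OF comm y] show ?thesis by blast
qed

text \<open>
  Shift \<open>y\<close> by \<open>i m\<close>: its spectral radius becomes at most \<open>sqrt (r(y)\<^sup>2 + m\<^sup>2)\<close>, which exceeds \<open>\<bar>m\<bar>\<close> only by
  \<open>O(1/\<bar>m\<bar>)\<close>. By \<open>spectrum_perturb_commuting\<close> the imaginary part of a point of \<open>\<sigma>(x + y + i m)\<close> is bounded by
  this radius; letting \<open>m \<rightarrow> \<plusminus>\<infinity>\<close> leaves only imaginary part \<open>0\<close> for points of \<open>\<sigma>(x + y)\<close>.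
\<close>

lemma real_spectrum_add_commuting:
  fixes x y :: "'a::unital_banach"
  assumes comm: "x * y = y * x" and x: "spectrum x \<subseteq> \<real>" and y: "spectrum y \<subseteq> \<real>"
  shows "spectrum (x + y) \<subseteq> \<real>"
proof
  fix c assume c: "c \<in> spectrum (x + y)"
  let ?R = "specrad y"
  have key: "2 * m * Im c \<le> ?R\<^sup>2" for m :: real
  proof -
    let ?y = "y + (\<i> * of_real m) *\<^sub>C 1"
    have "cmod d \<le> sqrt (?R\<^sup>2 + m\<^sup>2)" if "d \<in> spectrum ?y" for d
    proof -
      have e: "d - \<i> * of_real m \<in> spectrum y" using that by (simp add: spectrum_shift)
      then have "d - \<i> * of_real m \<in> \<real>" using y by blast
      then have im: "Im d = m" by (simp add: complex_is_Real_iff)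
      then have "d - \<i> * of_real m = of_real (Re d)" by (simp add: complex_eq_iff)
      then have "\<bar>Re d\<bar> \<le> ?R" using norm_spectrum_le_specrad[OF e] by simp
      then have "(Re d)\<^sup>2 \<le> ?R\<^sup>2" by (metis abs_ge_zero power2_abs power_mono)
      then show ?thesis by (simp add: cmod_def im)
    qed
    then have r: "specrad ?y \<le> sqrt (?R\<^sup>2 + m\<^sup>2)" by (simp add: specrad_le_iff)
    have "c + \<i> * of_real m \<in> spectrum (x + y + (\<i> * of_real m) *\<^sub>C 1)"
      using c by (simp add: spectrum_shift)
    moreover have "x * ?y = ?y * x" using comm by (simp add: algebra_simps scaleC_simps)
    ultimately obtain d where d: "d \<in> spectrum x" "cmod (c + \<i> * of_real m - d) \<le> specrad ?y"
      using spectrum_perturb_commuting[of x ?y] by (auto simp: add.assoc)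
    have "Im d = 0" using d(1) x by (auto simp: complex_is_Real_iff)
    then have "\<bar>Im c + m\<bar> \<le> cmod (c + \<i> * of_real m - d)"
      using abs_Im_le_cmod[of "c + \<i> * of_real m - d"] by simp
    with d(2) r have "\<bar>Im c + m\<bar> \<le> sqrt (?R\<^sup>2 + m\<^sup>2)" by linarith
    then have "\<bar>Im c + m\<bar>\<^sup>2 \<le> (sqrt (?R\<^sup>2 + m\<^sup>2))\<^sup>2" by (intro power_mono) auto
    then have "(Im c + m)\<^sup>2 \<le> ?R\<^sup>2 + m\<^sup>2" by simp
    then have "(Im c)\<^sup>2 + 2 * m * Im c \<le> ?R\<^sup>2" by (simp add: power2_eq_square algebra_simps)
    then show ?thesis using zero_le_power2[of "Im c"] by linarith
  qed
  have "Im c = 0"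
  proof (rule ccontr)
    assume nz: "Im c \<noteq> 0"
    then have "2 * ((?R\<^sup>2 + 1) / (2 * Im c)) * Im c = ?R\<^sup>2 + 1" by (simp add: field_simps)
    then show False using key[of "(?R\<^sup>2 + 1) / (2 * Im c)"] by simp
  qed
  then show "c \<in> \<real>" by (simp add: complex_is_Real_iff)
qed

section \<open>C*-algebras\<close>

lemma star_one [simp]: "star (1::'a::cstar_algebra) = 1"
  using star_mult[of "star 1" "1::'a"] by (simp add: star_star)

instance cstar_algebra \<subseteq> unital_banach
proof
  have "norm (1::'a) = (norm (1::'a))\<^sup>2" using cstar_identity[of "1::'a"] by simp
  then show "norm (1::'a) = 1" by (simp add: power2_eq_square)
qed

lemma star_zero [simp]: "star (0::'a::cstar_algebra) = 0"
  using star_add[of 0 "0::'a"] by simp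

lemma star_minus: "star (- (x::'a::cstar_algebra)) = - star x"
  using star_add[of x "- x"] by (simp add: eq_neg_iff_add_eq_0 add.commute)

lemma star_diff: "star ((x::'a::cstar_algebra) - y) = star x - star y"
  using star_add[of x "- y"] by (simp add: star_minus)

lemma star_mult_self_eq_0_iff: "star x * x = 0 \<longleftrightarrow> (x::'a::cstar_algebra) = 0"
  using cstar_identity[of x] by auto

lemma star_in_invertibles: "x \<in> invertibles \<Longrightarrow> star (x::'a::cstar_algebra) \<in> invertibles"
  by (rule invertiblesI[of _ "star (ainv x)"]) (simp_all add: star_mult[symmetric] ainv)

lemma star_ainv: "x \<in> invertibles \<Longrightarrow> star (ainv (x::'a::cstar_algebra)) = ainv (star x)"
  by (rule ainv_unique[symmetric]) (simp_all add: star_mult[symmetric] ainv)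

lemma specrad_star: "specrad (star x) = specrad (x::'a::cstar_algebra)"
proof -
  have le: "specrad (star y) \<le> specrad y" for y :: 'a
    unfolding specrad_le_iff
  proof
    fix c assume c: "c \<in> spectrum (star y)"
    have "star (cnj c *\<^sub>C 1 - y) = c *\<^sub>C 1 - star y" by (simp add: star_diff star_scaleC)
    then have "cnj c \<in> spectrum y"
      using c star_in_invertibles[of "cnj c *\<^sub>C 1 - y"] by (auto simp: spectrum_def)
    then show "cmod c \<le> specrad y" using norm_spectrum_le_specrad by fastforce
  qed
  from le[of x] le[of "star x"] show ?thesis by (simp add: star_star)
qed

text \<open>
  The C*-identity gives \<open>norm (h + i m)\<^sup>2 \<le> norm h\<^sup>2 + m\<^sup>2\<close> for all real \<open>m\<close>, which is too small for a
  point \<open>c + i m\<close> of the spectrum unless \<open>Im c = 0\<close>.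
\<close>

lemma selfadjoint_spectrum_real:
  fixes h :: "'a::cstar_algebra"
  assumes h: "star h = h"
  shows "spectrum h \<subseteq> \<real>"
proof
  fix c assume c: "c \<in> spectrum h"
  have key: "2 * m * Im c \<le> (norm h)\<^sup>2" for m :: real
  proof -
    let ?k = "h + (\<i> * of_real m) *\<^sub>C 1"
    have "(norm ?k)\<^sup>2 = norm (star ?k * ?k)" by (simp add: cstar_identity)
    also have "star ?k * ?k = h * h + (of_real (m\<^sup>2)) *\<^sub>C 1"
      by (simp add: star_add star_scaleC h scaleC_simps algebra_simps power2_eq_square)
    also have "norm \<dots> \<le> norm (h * h) + m\<^sup>2"
      by (rule order_trans[OF norm_triangle_ineq]) (simp add: norm_scaleC norm_power)
    also have "norm (h * h) = (norm h)\<^sup>2" using cstar_identity[of h] by (simp add: h)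
    finally have k: "(norm ?k)\<^sup>2 \<le> (norm h)\<^sup>2 + m\<^sup>2" .
    have "c + \<i> * of_real m \<in> spectrum ?k" using c by (simp add: spectrum_shift)
    then have "cmod (c + \<i> * of_real m) \<le> norm ?k" by (rule norm_spectrum_le)
    moreover have "\<bar>Im c + m\<bar> \<le> cmod (c + \<i> * of_real m)"
      using abs_Im_le_cmod[of "c + \<i> * of_real m"] by simp
    ultimately have "\<bar>Im c + m\<bar>\<^sup>2 \<le> (norm ?k)\<^sup>2" by (intro power_mono) auto
    with k have "(Im c + m)\<^sup>2 \<le> (norm h)\<^sup>2 + m\<^sup>2" by simp
    then have "(Im c)\<^sup>2 + 2 * m * Im c \<le> (norm h)\<^sup>2" by (simp add: power2_eq_square algebra_simps)
    then show ?thesis using zero_le_power2[of "Im c"] by linarith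
  qed
  have "Im c = 0"
  proof (rule ccontr)
    assume nz: "Im c \<noteq> 0"
    then have "2 * (((norm h)\<^sup>2 + 1) / (2 * Im c)) * Im c = (norm h)\<^sup>2 + 1" by (simp add: field_simps)
    then show False using key[of "((norm h)\<^sup>2 + 1) / (2 * Im c)"] by simp
  qed
  then show "c \<in> \<real>" by (simp add: complex_is_Real_iff)
qed

text \<open>
  For self-adjoint \<open>h\<close> the C*-identity gives \<open>norm (h\<^sup>N) = norm h\<^sup>N\<close> for the powers \<open>N\<close> of \<open>2\<close>, to be compared
  with Gelfand's estimate.
\<close>

lemma specrad_selfadjoint:
  fixes h :: "'a::cstar_algebra"
  assumes h: "star h = h"
  shows "specrad h = norm h"
proof (rule ccontr)
  assume "specrad h \<noteq> norm h"
  then have "specrad h < norm h" using specrad_le_norm[of h] by linarith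
  then obtain \<rho> where \<rho>: "specrad h < \<rho>" "\<rho> < norm h" using dense by blast
  then have \<rho>0: "\<rho> > 0" using specrad_nonneg[of h] by linarith
  obtain C where C: "\<And>n. norm (h ^ n) \<le> C * \<rho> ^ n" 
    using power_bound_if_specrad_less[OF \<rho>(1)] by blast
  have "star (h ^ n) = h ^ n" for n
    by (induction n) (simp_all add: star_mult h power_commutes)
  then have sq: "norm (h ^ n * h ^ n) = norm (h ^ n) * norm (h ^ n)" for n
    using cstar_identity[of "h ^ n"] by (simp add: power2_eq_square)
  have pow: "norm (h ^ (2 ^ k)) = norm h ^ (2 ^ k)" for k :: nat
  proof (induction k)
    case (Suc k)
    have "h ^ (2 ^ Suc k) = h ^ (2 ^ k) * h ^ (2 ^ k)" by (simp add: power_add[symmetric] mult_2)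
    then show ?case by (simp only: sq Suc) (simp add: power_add[symmetric] mult_2)
  qed simp
  obtain n where n: "C < (norm h / \<rho>) ^ n" using real_arch_pow[of "norm h / \<rho>" C] \<rho> \<rho>0 by auto
  have "(norm h / \<rho>) ^ n \<le> (norm h / \<rho>) ^ (2 ^ n)"
    using \<rho> \<rho>0 by (intro power_increasing) (auto intro: less_imp_le less_exp)
  also have "\<dots> \<le> C" using C[of "2 ^ n"] \<rho>0 by (simp add: pow power_divide field_simps)
  finally show False using n by simp
qed

lemma normal_quasinilpotent_eq_0:
  fixes x :: "'a::cstar_algebra"
  assumes "star x * x = x * star x" "specrad x = 0"
  shows "x = 0"
proof -
  have "specrad (star x * x) \<le> specrad (star x) * specrad x" by (rule specrad_mult_commuting[OF assms(1)])
  then have "specrad (star x * x) = 0" using assms(2) specrad_nonneg[of "star x * x"] by simp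
  moreover have "star (star x * x) = star x * x" by (simp add: star_mult star_star)
  ultimately have "star x * x = 0" using specrad_selfadjoint[of "star x * x"] by simp
  then show ?thesis by (simp add: star_mult_self_eq_0_iff)
qed

lemma selfadjoint_decomposition:
  obtains h k where "star h = h" "star k = k" "a = h + \<i> *\<^sub>C (k::'a::cstar_algebra)"
proof
  show "star ((1/2) *\<^sub>C (a + star a)) = (1/2) *\<^sub>C (a + star a)"
    "star ((- \<i> / 2) *\<^sub>C (a - star a)) = (- \<i> / 2) *\<^sub>C (a - star a)"
    by (simp_all add: star_scaleC star_add star_diff star_star add.commute
        scaleC_diff_right scaleC_minus_left)
  have "(1/2) *\<^sub>C (a + star a) + \<i> *\<^sub>C (- \<i> / 2) *\<^sub>C (a - star a) = (1/2 + 1/2) *\<^sub>C a"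
    unfolding scaleC_add_left by (simp add: scaleC_simps)
  then show "a = (1/2) *\<^sub>C (a + star a) + \<i> *\<^sub>C (- \<i> / 2) *\<^sub>C (a - star a)" by (simp add: scaleC_one)
qed

section \<open>Elements are determined by the spectra of their multiples\<close>

text \<open>
  The hypothesis says that \<open>1 - a y\<close> is invertible exactly when \<open>1 - b y\<close> is. For \<open>1 + b w\<close> invertible and
  \<open>y = w (1 + b w)\<^sup>-\<^sup>1\<close> one has \<open>1 - b y = (1 + b w)\<^sup>-\<^sup>1\<close> and \<open>1 - a y = (1 - (a - b) w) (1 + b w)\<^sup>-\<^sup>1\<close>, so that
  \<open>1 - (a - b) w\<close> is invertible as well. Exchanging \<open>a\<close> and \<open>b\<close> provides the second sign.
\<close>

lemma spectrum_multiples_diff: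
  fixes a b :: "'a::unital_banach"
  assumes eq: "\<And>x. spectrum (a * x) = spectrum (b * x)"
    and c: "c \<in> spectrum ((a - b) * w)" "c \<noteq> 0"
  shows "c \<in> spectrum (b * w)" "- c \<in> spectrum (b * w)"
proof -
  have neg: "- e \<in> spectrum (b' * w)"
    if eq': "\<And>x. spectrum (a' * x) = spectrum (b' * x)"
      and e: "e \<in> spectrum ((a' - b') * w)" "e \<noteq> 0" for a' b' :: 'a and e
  proof (rule ccontr)
    assume "- e \<notin> spectrum (b' * w)"
    then have "- (e *\<^sub>C 1 + b' * w) \<in> invertibles" by (simp add: spectrum_def scaleC_simps)
    then have "e *\<^sub>C 1 + b' * w \<in> invertibles" by (simp only: minus_in_invertibles_iff)
    then have "(1/e) *\<^sub>C (e *\<^sub>C 1 + b' * w) \<in> invertibles" using e(2) by (simp add: scaleC_invertibles)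
    moreover define w' where "w' = (1/e) *\<^sub>C w"
    ultimately have inv: "1 + b' * w' \<in> invertibles" using e(2) by (simp add: scaleC_simps)
    let ?v = "ainv (1 + b' * w')"
    have v: "?v \<in> invertibles" using inv by (rule ainv_in_invertibles)
    have "1 - b' * (w' * ?v) = (1 + b' * w') * ?v - b' * w' * ?v" by (simp add: ainv[OF inv] mult.assoc)
    also have "\<dots> = ?v" by (simp add: algebra_simps)
    finally have "1 \<notin> spectrum (b' * (w' * ?v))" using v by (simp add: spectrum_def scaleC_one)
    then have "1 \<notin> spectrum (a' * (w' * ?v))" by (simp only: eq' not_False_eq_True)
    then have "1 - a' * (w' * ?v) \<in> invertibles" by (simp add: spectrum_def scaleC_one)
    moreover have "1 - a' * (w' * ?v) = (1 + b' * w') * ?v - a' * w' * ?v" by (simp add: ainv[OF inv] mult.assoc)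
    moreover have "(1 + b' * w') * ?v - a' * w' * ?v = (1 - (a' - b') * w') * ?v" by (simp add: algebra_simps)
    ultimately have "1 - (a' - b') * w' \<in> invertibles" using invertibles_cancel_right[OF v] by simp
    then have "e *\<^sub>C (1 - (a' - b') * w') \<in> invertibles" using e(2) by (simp add: scaleC_invertibles)
    moreover have "e *\<^sub>C (1 - (a' - b') * w') = e *\<^sub>C 1 - (a' - b') * w"
      using e(2) by (simp add: w'_def scaleC_simps)
    ultimately show False using e(1) by (simp add: spectrum_def)
  qed
  show "- c \<in> spectrum (b * w)" using neg[OF eq c] .
  have "(- c) *\<^sub>C 1 - (b - a) * w = - (c *\<^sub>C 1 - (a - b) * w)" by (simp add: scaleC_simps algebra_simps)
  then have "- c \<in> spectrum ((b - a) * w)"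
    using c(1) by (simp only: spectrum_def mem_Collect_eq minus_in_invertibles_iff simp_thms)
  then have "- (- c) \<in> spectrum (a * w)" 
    using c(2) by (intro neg[of b a]) (auto simp: eq)
  then show "c \<in> spectrum (b * w)" by (simp add: eq)
qed

lemma specrad_eq_0_if_multiples:
  fixes a b :: "'a::unital_banach"
  assumes eq: "\<And>x. spectrum (a * x) = spectrum (b * x)"
    and sym: "\<And>c. c \<in> spectrum (b * w) \<Longrightarrow> - c \<in> spectrum (b * w) \<Longrightarrow> c = 0"
  shows "specrad ((a - b) * w) = 0"
proof -
  have "specrad ((a - b) * w) \<le> 0"
    unfolding specrad_le_iff using spectrum_multiples_diff[OF eq] sym by (metis norm_zero order_refl)
  then show ?thesis using specrad_nonneg[of "(a - b) * w"] by simp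
qed

text \<open>
  By \<open>spectrum_multiples_diff\<close>, \<open>(a - b) w\<close> is quasinilpotent as soon as \<open>\<sigma>(b w)\<close> meets its negative at
  most in \<open>0\<close>. With \<open>d = a - b\<close>, first take \<open>w = b\<^sup>* b b\<^sup>*\<close>: then \<open>b w\<close> is the square of a self-adjoint
  element, and so \<open>d b\<^sup>* b b\<^sup>*\<close> is quasinilpotent. Its adjoint is \<open>b w\<close> for \<open>w = b\<^sup>* b d\<^sup>*\<close>, hence also
  \<open>d w = (d b\<^sup>*) (d b\<^sup>*)\<^sup>*\<close> is quasinilpotent; being self-adjoint, it vanishes.
\<close>

lemma spectra_of_multiples_annihilate:
  fixes a b :: "'a::cstar_algebra"
  assumes eq: "\<And>x. spectrum (a * x) = spectrum (b * x)"
  shows "(a - b) * star b = 0"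
proof -
  let ?d = "a - b" and ?p = "b * star b"
  have p: "star ?p = ?p" by (simp add: star_mult star_star)
  have "specrad (?d * (star b * ?p)) = 0"
  proof (rule specrad_eq_0_if_multiples[OF eq])
    fix c assume "c \<in> spectrum (b * (star b * ?p))" "- c \<in> spectrum (b * (star b * ?p))"
    then have "c \<in> spectrum (?p * ?p)" "- c \<in> spectrum (?p * ?p)" by (simp_all add: mult.assoc)
    then obtain e f where ef: "e \<in> spectrum ?p" "f \<in> spectrum ?p" "c = e * e" "- c = f * f"
      using spectrum_power2 by meson
    then obtain r s where "e = of_real r" "f = of_real s"
      using selfadjoint_spectrum_real[OF p] by (meson Reals_cases subsetD)
    with ef have "complex_of_real (r * r) + complex_of_real (s * s) = c + - c"
      by (simp only: of_real_mult)
    then have "complex_of_real (r * r + s * s) = 0" by (simp only: of_real_add add.right_inverse)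
    then have "r * r + s * s = 0" by (simp only: of_real_eq_0_iff)
    then have "r = 0" by (simp add: sum_squares_eq_zero_iff)
    then show "c = 0" using ef \<open>e = of_real r\<close> by simp
  qed
  then have "specrad (star (?d * (star b * ?p))) = 0" by (simp add: specrad_star)
  moreover have "star (?d * (star b * ?p)) = b * (star b * b * star ?d)"
    by (simp add: star_mult star_star mult.assoc)
  ultimately have "specrad (b * (star b * b * star ?d)) = 0" by simp
  then have "specrad (?d * (star b * b * star ?d)) = 0"
    by (intro specrad_eq_0_if_multiples[OF eq]) (auto simp: specrad_eq_0_iff)
  moreover have "?d * (star b * b * star ?d) = star (b * star ?d) * (b * star ?d)"
    by (simp add: star_mult star_star mult.assoc)
  moreover have "star (star (b * star ?d) * (b * star ?d)) = star (b * star ?d) * (b * star ?d)"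
    by (simp add: star_mult star_star mult.assoc)
  ultimately have "star (b * star ?d) * (b * star ?d) = 0"
    using specrad_selfadjoint[of "star (b * star ?d) * (b * star ?d)"] by simp
  then have "b * star ?d = 0" by (simp only: star_mult_self_eq_0_iff)
  then have "star (b * star ?d) = 0" by simp
  then show ?thesis by (simp add: star_mult star_star)
qed

text \<open>
  With \<open>d = a - b\<close>, both \<open>d b\<^sup>*\<close> and, by symmetry, \<open>d a\<^sup>*\<close> vanish, and therefore so does \<open>d d\<^sup>*\<close>.
\<close>

theorem determined_by_spectra_of_multiples:
  fixes a b :: "'a::cstar_algebra"
  assumes eq: "\<And>x. spectrum (a * x) = spectrum (b * x)"
  shows "a = b"
proof -
  have "(a - b) * star b = 0" "(b - a) * star a = 0"
    by (rule spectra_of_multiples_annihilate, simp add: eq)+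
  then have "star (star (a - b)) * star (a - b) = 0"
    by (simp add: star_star star_diff algebra_simps)
  then have "star (a - b) = 0" by (simp only: star_mult_self_eq_0_iff)
  then have "star (star (a - b)) = 0" by simp
  then show ?thesis by (simp add: star_star)
qed

section \<open>Exponentials, one-parameter groups and logarithms\<close>

lemma norm_exp_minus_linear:
  fixes x :: "'a::unital_banach"
  assumes "norm x \<le> 1"
  shows "norm (exp x - 1 - x) \<le> (norm x)\<^sup>2"
proof -
  have sums: "(\<lambda>n. y ^ (n + 2) /\<^sub>R fact (n + 2)) sums (exp y - 1 - y)"
    for y :: "'b::{real_normed_algebra_1,banach}"
    using sums_split_initial_segment[OF exp_converges[of y], of 2]
    by (simp add: numeral_2_eq_2 lessThan_Suc diff_diff_eq add.commute)
  note sx = sums[of x] and sr = sums[of "norm x"]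
  have le: "norm (x ^ (n + 2) /\<^sub>R fact (n + 2)) \<le> norm x ^ (n + 2) /\<^sub>R fact (n + 2)" for n
    by (auto intro!: mult_left_mono norm_power_ineq simp del: power_Suc power_add)
  have sm: "summable (\<lambda>n. norm (x ^ (n + 2) /\<^sub>R fact (n + 2)))"
    by (rule summable_comparison_test'[OF sums_summable[OF sr], of 0]) (use le in simp)
  have "norm (exp x - 1 - x) \<le> (\<Sum>n. norm (x ^ (n + 2) /\<^sub>R fact (n + 2)))"
    using summable_norm[OF sm] sums_unique[OF sx] by simp
  also have "\<dots> \<le> exp (norm x) - 1 - norm x"
    using suminf_le[OF le sm sums_summable[OF sr]] sums_unique[OF sr] by simp
  also have "\<dots> \<le> (norm x)\<^sup>2" using exp_bound[of "norm x"] assms by simp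
  finally show ?thesis .
qed

lemma exp_has_derivative_at_0: "(exp has_derivative (\<lambda>h. h)) (at (0::'a::unital_banach))"
  unfolding has_derivative_at
proof
  have "\<forall>\<^sub>F h in at (0::'a). norm h < 1"
    by (intro order_tendstoD(2)[of norm 0]) (auto intro!: tendsto_eq_intros)
  moreover have "\<forall>\<^sub>F h in at (0::'a). h \<noteq> 0" by (simp add: eventually_at_filter)
  ultimately have "\<forall>\<^sub>F h in at (0::'a). norm (norm (exp (0 + h) - exp 0 - h) / norm h) \<le> norm h"
  proof eventually_elim
    case (elim h)
    then have "norm (exp h - 1 - h) \<le> norm h * norm h"
      using norm_exp_minus_linear[of h] by (simp add: power2_eq_square)
    with elim show ?case by (simp add: divide_le_eq)
  qed
  moreover have "(norm \<longlongrightarrow> 0) (at (0::'a))" by (auto intro!: tendsto_eq_intros)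
  ultimately show "((\<lambda>h::'a. norm (exp (0 + h) - exp 0 - h) / norm h) \<longlongrightarrow> 0) (at 0)"
    by (rule Lim_null_comparison)
qed (rule bounded_linear_ident)

text \<open>
  \<open>exp (L s) = exp (L t) exp (L s - L t)\<close> reduces the chain rule to the derivative of \<open>exp\<close> at \<open>0\<close>.
\<close>

lemma exp_has_vector_derivative_commuting:
  fixes L :: "real \<Rightarrow> 'a::unital_banach"
  assumes L: "(L has_vector_derivative l) (at t within S)"
    and comm: "\<And>s. s \<in> S \<Longrightarrow> L s * L t = L t * L s" and t: "t \<in> S"
  shows "((\<lambda>s. exp (L s)) has_vector_derivative exp (L t) * l) (at t within S)"
proof -
  have "((\<lambda>s. L s - L t) has_derivative (\<lambda>h. h *\<^sub>R l)) (at t within S)"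
    using L unfolding has_vector_derivative_def by (auto intro!: derivative_eq_intros)
  then have "((\<lambda>s. exp (L s - L t)) has_derivative (\<lambda>h. h *\<^sub>R l)) (at t within S)"
    by (rule has_derivative_compose) (simp add: exp_has_derivative_at_0)
  then have "((\<lambda>s. exp (L t) * exp (L s - L t)) has_derivative (\<lambda>h. exp (L t) * h *\<^sub>R l)) (at t within S)"
    by (rule bounded_linear.has_derivative[OF bounded_linear_mult_right])
  then have "((\<lambda>s. exp (L s)) has_derivative (\<lambda>h. exp (L t) * h *\<^sub>R l)) (at t within S)"
  proof (rule has_derivative_transform[OF t, rotated])
    show "exp (L s) = exp (L t) * exp (L s - L t)" if "s \<in> S" for s
      using exp_add_commuting[of "L t" "L s - L t"] comm[OF that] by (simp add: algebra_simps)
  qed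
  then show ?thesis by (simp add: has_vector_derivative_def)
qed

lemma exp_invertible: "exp (x::'c::unital_banach) \<in> invertibles"
  using exp_minus_inverse[of x] exp_minus_inverse[of "- x"] by (intro invertiblesI[of _ "exp (- x)"]) auto

lemma exp_commute:
  fixes x c :: "'a::unital_banach"
  assumes "x * c = c * x"
  shows "exp x * c = c * exp x"
proof -
  have "x ^ n * c = c * x ^ n" for n by (rule power_commuting_commutes) (rule assms)
  then have "(\<lambda>n. c * (x ^ n /\<^sub>R fact n)) = (\<lambda>n. (x ^ n /\<^sub>R fact n) * c)" by simp
  then have "(\<lambda>n. c * (x ^ n /\<^sub>R fact n)) sums (exp x * c)"
    using sums_mult2[OF exp_converges[of x], of c] by simp
  then show ?thesis using sums_mult[OF exp_converges[of x], of c] by (simp add: sums_unique2)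
qed

lemma has_vector_derivative_exp_0:
  "((\<lambda>t. exp (t *\<^sub>R a)) has_vector_derivative (a::'a::unital_banach)) (at 0)"
  using exp_scaleR_has_vector_derivative_right[of a 0 UNIV] by simp

lemma exp_group_commutes_imp:
  fixes a c :: "'a::unital_banach"
  assumes "\<And>t::real. exp (t *\<^sub>R a) * c = c * exp (t *\<^sub>R a)"
  shows "a * c = c * a"
proof -
  have "((\<lambda>t. exp (t *\<^sub>R a) * c) has_vector_derivative a * c) (at 0)"
    by (rule bounded_linear.has_vector_derivative[OF bounded_linear_mult_left has_vector_derivative_exp_0])
  moreover have "((\<lambda>t. c * exp (t *\<^sub>R a)) has_vector_derivative c * a) (at 0)"
    by (rule bounded_linear.has_vector_derivative[OF bounded_linear_mult_right has_vector_derivative_exp_0])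
  ultimately show ?thesis unfolding assms by (rule vector_derivative_unique_at)
qed

lemma exp_group_generator_unique:
  fixes a b :: "'a::unital_banach"
  assumes "\<And>t::real. exp (t *\<^sub>R a) = exp (t *\<^sub>R b)"
  shows "a = b"
  using has_vector_derivative_exp_0[of a] has_vector_derivative_exp_0[of b]
  unfolding assms by (rule vector_derivative_unique_at)

text \<open>
  \<open>exp n - 1 = n v\<close> with a \<open>v\<close> that commutes with \<open>n\<close>.
\<close>

lemma specrad_exp_minus_one_quasinilpotent:
  fixes n :: "'a::unital_banach"
  assumes n: "specrad n = 0"
  shows "specrad (exp n - 1) = 0"
proof -
  define v where "v = (\<Sum>k. n ^ k /\<^sub>R fact (Suc k))"
  have "summable (\<lambda>k. norm (n ^ k /\<^sub>R fact (Suc k)))"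
  proof (rule summable_comparison_test'[OF summable_norm_exp[of n], of 0])
    fix k
    have "inverse (fact (Suc k)) \<le> (inverse (fact k) :: real)"
      by (intro le_imp_inverse_le fact_mono) auto
    then show "norm (norm (n ^ k /\<^sub>R fact (Suc k))) \<le> norm (n ^ k /\<^sub>R fact k)"
      by (simp add: mult_right_mono del: fact_Suc)
  qed
  then have sm: "summable (\<lambda>k. n ^ k /\<^sub>R fact (Suc k))" by (rule summable_norm_cancel)
  have "(\<lambda>k. n * (n ^ k /\<^sub>R fact (Suc k))) = (\<lambda>k. n ^ Suc k /\<^sub>R fact (Suc k))"
    "(\<lambda>k. (n ^ k /\<^sub>R fact (Suc k)) * n) = (\<lambda>k. n ^ Suc k /\<^sub>R fact (Suc k))"
    by (auto simp: power_commutes)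
  then have sums: "(\<lambda>k. n ^ Suc k /\<^sub>R fact (Suc k)) sums (n * v)" "(\<lambda>k. n ^ Suc k /\<^sub>R fact (Suc k)) sums (v * n)"
    using sums_mult[OF summable_sums[OF sm], of n] sums_mult2[OF summable_sums[OF sm], of n]
    unfolding v_def by simp_all
  have comm: "n * v = v * n" using sums by (rule sums_unique2)
  have "(\<lambda>k. n ^ Suc k /\<^sub>R fact (Suc k)) sums (exp n - 1)"
    using exp_converges[of n] by (subst sums_Suc_iff) simp
  then have "exp n - 1 = n * v" using sums(1) by (rule sums_unique2)
  then show ?thesis using specrad_mult_quasinilpotent[OF comm n] by simp
qed

text \<open>
  The difference quotients \<open>(exp (t x) - 1) / t\<close> and \<open>(exp (t y) - 1) / t\<close> have the same spectrum, and they are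
  commuting perturbations of \<open>x\<close> and \<open>y\<close> of size \<open>O(t)\<close>; the claim follows as \<open>t \<rightarrow> 0\<close> because the spectrum is
  closed.
\<close>

lemma spectrum_subset_if_exp_groups_isospectral:
  fixes x :: "'a::unital_banach" and y :: "'b::unital_banach"
  assumes eq: "\<And>t::real. spectrum (exp (t *\<^sub>R x)) = spectrum (exp (t *\<^sub>R y))"
  shows "spectrum x \<subseteq> spectrum y"
proof
  fix c assume c: "c \<in> spectrum x"
  have near: "\<exists>e\<in>spectrum y. dist e c < \<epsilon>" if \<epsilon>: "\<epsilon> > 0" for \<epsilon>
  proof -
    define N where "N = norm x + norm y + 1"
    have N: "N \<ge> 1" by (simp add: N_def)
    define t where "t = min (1 / N) (\<epsilon> / (4 * N\<^sup>2))"
    have t: "t > 0" "t * N \<le> 1" "t * N\<^sup>2 \<le> \<epsilon> / 4"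
      using N \<epsilon> by (auto simp: t_def min_def field_simps)
    let ?E = "\<lambda>z. (1/t) *\<^sub>R (exp (t *\<^sub>R z) - 1)"
    have quot: "norm (?E z - z) \<le> \<epsilon> / 4" if z: "norm z \<le> N" for z :: "'c::unital_banach"
    proof -
      have "norm (t *\<^sub>R z) \<le> t * N" using z t by (simp add: mult_left_mono)
      with t(2) have "norm (t *\<^sub>R z) \<le> 1" by linarith
      from norm_exp_minus_linear[OF this]
      have "norm (exp (t *\<^sub>R z) - 1 - t *\<^sub>R z) \<le> t\<^sup>2 * (norm z)\<^sup>2" using t by (simp add: power_mult_distrib)
      also have "\<dots> \<le> t\<^sup>2 * N\<^sup>2" using z by (intro mult_left_mono power_mono) auto
      finally have "norm (exp (t *\<^sub>R z) - 1 - t *\<^sub>R z) / t \<le> t * N\<^sup>2"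
        using t(1) by (simp add: power2_eq_square field_simps)
      moreover have "?E z - z = (1/t) *\<^sub>R (exp (t *\<^sub>R z) - 1 - t *\<^sub>R z)"
        using t(1) by (simp add: algebra_simps)
      then have "norm (?E z - z) = norm (exp (t *\<^sub>R z) - 1 - t *\<^sub>R z) / t" using t(1) by simp
      ultimately show ?thesis using t(3) by linarith
    qed
    have E_scaleC: "?E z = complex_of_real (1/t) *\<^sub>C (exp (t *\<^sub>R z) + (- 1) *\<^sub>C 1)"
      for z :: "'c::unital_banach"
      by (simp only: scaleR_scaleC scaleC_minus_left scaleC_one diff_conv_add_uminus)
    have comm: "?E z * z = z * ?E z" for z :: "'c::unital_banach"
      using exp_commute[of "t *\<^sub>R z" z] by (simp add: left_diff_distrib right_diff_distrib)
    have comm': "?E x * (x - ?E x) = (x - ?E x) * ?E x" "y * (?E y - y) = (?E y - y) * y"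
      by (simp_all only: left_diff_distrib right_diff_distrib comm)
    have "c \<in> spectrum (?E x + (x - ?E x))" using c by simp
    then obtain d where d: "d \<in> spectrum (?E x)" "cmod (c - d) \<le> specrad (x - ?E x)"
      using spectrum_perturb_commuting[OF comm'(1)] by blast
    have "d \<in> spectrum (?E y)"
      using d(1) t(1) unfolding E_scaleC by (simp add: spectrum_scaleC_iff spectrum_shift eq)
    then have "d \<in> spectrum (y + (?E y - y))" by simp
    then obtain e where e: "e \<in> spectrum y" "cmod (d - e) \<le> specrad (?E y - y)"
      using spectrum_perturb_commuting[OF comm'(2)] by blast
    have "norm x \<le> N" "norm y \<le> N" by (simp_all add: N_def)
    from quot[OF this(1)] quot[OF this(2)] d(2) e(2)
      specrad_le_norm[of "x - ?E x"] specrad_le_norm[of "?E y - y"]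
    have "cmod (c - d) \<le> \<epsilon> / 4" "cmod (d - e) \<le> \<epsilon> / 4" by (simp_all add: norm_minus_commute)
    then have "dist e c < \<epsilon>"
      using \<epsilon> norm_triangle_ineq[of "c - d" "d - e"] by (simp add: dist_norm norm_minus_commute)
    with e(1) show ?thesis by blast
  qed
  have "c \<in> closure (spectrum y)" unfolding closure_approachable using near by blast
  then show "c \<in> spectrum y" by (simp add: closure_closed closed_spectrum)
qed

lemma exp_scaleR_of_nat: "exp (real n *\<^sub>R a) = exp (a::'a::unital_banach) ^ n"
proof (induction n)
  case (Suc n)
  have "exp (real (Suc n) *\<^sub>R a) = exp (a + real n *\<^sub>R a)" by (simp add: algebra_simps)
  also have "\<dots> = exp a * exp (real n *\<^sub>R a)" by (rule exp_add_commuting) simp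
  finally show ?case by (simp add: Suc)
qed simp

lemma norm_power_diff_le:
  fixes x y :: "'a::unital_banach"
  assumes "norm x \<le> M" "norm y \<le> M" "1 \<le> M"
  shows "norm (x ^ n - y ^ n) \<le> real n * M ^ n * norm (x - y)"
proof (induction n)
  case (Suc n)
  have yn: "norm (y ^ n) \<le> M ^ n"
    by (rule order_trans[OF norm_power_ineq]) (intro power_mono assms norm_ge_zero)
  have "x ^ Suc n - y ^ Suc n = x * (x ^ n - y ^ n) + (x - y) * y ^ n" by (simp add: algebra_simps)
  then have "norm (x ^ Suc n - y ^ Suc n) \<le> norm (x * (x ^ n - y ^ n)) + norm ((x - y) * y ^ n)"
    using norm_triangle_ineq[of "x * (x ^ n - y ^ n)"] by simp
  also have "norm (x * (x ^ n - y ^ n)) \<le> norm x * norm (x ^ n - y ^ n)" by (rule norm_mult_ineq)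
  also have "norm x * norm (x ^ n - y ^ n) \<le> M * (real n * M ^ n * norm (x - y))"
    using assms by (intro mult_mono Suc) auto
  also have "norm ((x - y) * y ^ n) \<le> norm (x - y) * norm (y ^ n)" by (rule norm_mult_ineq)
  also have "norm (x - y) * norm (y ^ n) \<le> norm (x - y) * M ^ Suc n"
    using order_trans[OF yn power_increasing[of n "Suc n" M]] assms(3) by (intro mult_left_mono) auto
  finally show ?case by (simp add: algebra_simps)
qed simp

text \<open>
  \<open>exp (t a) exp (t b)\<close> and \<open>exp (t (a + b))\<close> have the same derivative at \<open>0\<close>, so for \<open>t = 1/n\<close> they differ by
  \<open>o(1/n)\<close>, and their \<open>n\<close>-th powers by \<open>n o(1/n)\<close> up to the factor \<open>exp (norm a + norm b)\<close>.
\<close>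

lemma trotter_product_formula:
  fixes a b :: "'a::unital_banach"
  shows "(\<lambda>n. (exp ((1 / real n) *\<^sub>R a) * exp ((1 / real n) *\<^sub>R b)) ^ n) \<longlonglongrightarrow> exp (a + b)"
proof -
  define X where "X = (\<lambda>t::real. exp (t *\<^sub>R a) * exp (t *\<^sub>R b))"
  define Y where "Y = (\<lambda>t::real. exp (t *\<^sub>R (a + b)))"
  have "(X has_vector_derivative (exp (0 *\<^sub>R a) * b + a * exp (0 *\<^sub>R b))) (at 0)"
    unfolding X_def
    by (rule bounded_bilinear.has_vector_derivative[OF bounded_bilinear_mult
        has_vector_derivative_exp_0 has_vector_derivative_exp_0])
  moreover have "(Y has_vector_derivative (a + b)) (at 0)"
    unfolding Y_def by (rule has_vector_derivative_exp_0)
  ultimately have "((\<lambda>t. X t - Y t) has_vector_derivative 0) (at 0)"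
    using has_vector_derivative_diff by fastforce
  then have "((\<lambda>t. norm (X t - Y t) / \<bar>t\<bar>) \<longlongrightarrow> 0) (at 0)"
    unfolding has_vector_derivative_def has_derivative_at by (simp add: X_def Y_def)
  moreover have "filterlim (\<lambda>n. 1 / real n) (at 0) sequentially"
    unfolding filterlim_at
    by (auto simp: eventually_sequentially intro!: lim_1_over_n exI[of _ 1])
  ultimately have "(\<lambda>n. norm (X (1 / real n) - Y (1 / real n)) / \<bar>1 / real n\<bar>) \<longlonglongrightarrow> 0"
    by (rule filterlim_compose)
  then have lim: "(\<lambda>n. exp (norm a + norm b) * (norm (X (1 / real n) - Y (1 / real n)) / \<bar>1 / real n\<bar>)) \<longlonglongrightarrow> 0"
    by (rule tendsto_mult_right_zero)
  have "\<forall>\<^sub>F n in sequentially. norm (X (1 / real n) ^ n - exp (a + b)) \<le>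
          exp (norm a + norm b) * (norm (X (1 / real n) - Y (1 / real n)) / \<bar>1 / real n\<bar>)"
    using eventually_gt_at_top[of 0]
  proof eventually_elim
    case (elim n)
    let ?t = "1 / real n" and ?M = "exp ((norm a + norm b) / real n)"
    have "norm (X ?t) \<le> norm (exp (?t *\<^sub>R a)) * norm (exp (?t *\<^sub>R b))"
      unfolding X_def by (rule norm_mult_ineq)
    also have "\<dots> \<le> exp (norm (?t *\<^sub>R a)) * exp (norm (?t *\<^sub>R b))"
      by (intro mult_mono norm_exp) auto
    also have "\<dots> = ?M" by (simp add: exp_add[symmetric] add_divide_distrib)
    finally have 1: "norm (X ?t) \<le> ?M" .
    have "norm (Y ?t) \<le> exp (norm (?t *\<^sub>R (a + b)))" unfolding Y_def by (rule norm_exp)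
    also have "\<dots> \<le> ?M" using norm_triangle_ineq[of a b] by (simp add: divide_right_mono)
    finally have 2: "norm (Y ?t) \<le> ?M" .
    have M: "?M ^ n = exp (norm a + norm b)" using elim by (simp add: exp_of_nat_mult[symmetric])
    have "Y ?t ^ n = exp (a + b)" using elim by (simp add: Y_def exp_scaleR_of_nat[symmetric])
    then show ?case using norm_power_diff_le[OF 1 2, of n] M by (simp add: mult_ac)
  qed
  from Lim_null_comparison[OF this lim] show ?thesis unfolding X_def by (rule LIM_zero_cancel)
qed

text \<open>
  Let \<open>V\<close> be the integral of \<open>g\<close> over \<open>[0, 1]\<close>. It lies within \<open>1/2\<close> of \<open>1\<close>, so it is invertible with inverse
  of norm at most \<open>2\<close>; and \<open>g(s) V\<close>, the integral over \<open>[s, s + 1]\<close>, is differentiable in \<open>s\<close> with derivative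
  \<open>g(s) (g(1) - 1)\<close>. Hence \<open>g\<close> solves \<open>g' = g b\<close> with \<open>b = (g(1) - 1) V\<^sup>-\<^sup>1\<close>. The bound on \<open>b\<close> is
  what later makes the differential a bounded map.
\<close>

lemma one_parameter_group_generator:
  fixes g :: "real \<Rightarrow> 'a::unital_banach"
  assumes add: "\<And>s t. g (s + t) = g s * g t" and cont0: "isCont g 0"
    and near: "\<And>t. 0 \<le> t \<Longrightarrow> t \<le> 1 \<Longrightarrow> norm (g t - 1) \<le> 1/2"
  shows "\<exists>b. norm b \<le> 1 \<and> (\<forall>t. g t = exp (t *\<^sub>R b))"
proof -
  have g0: "g 0 = 1"
  proof -
    have "norm (1 - g 0) < 1" using near[of 0] by (simp add: norm_minus_commute)
    then have "1 - (1 - g 0) \<in> invertibles" by (rule one_minus_invertible)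
    then have inv: "g 0 \<in> invertibles" by simp
    have "ainv (g 0) * (g 0 * g 0) = ainv (g 0) * g 0" using add[of 0 0] by simp
    then show ?thesis by (simp add: ainv inv ainv_cancel)
  qed
  have cont: "isCont g s" for s
  proof -
    have "(\<lambda>h. g s * g h) \<midarrow>0\<rightarrow> g s * g 0" by (intro tendsto_mult tendsto_const cont0[unfolded isCont_def])
    then show ?thesis by (simp add: isCont_iff add g0)
  qed
  then have con: "continuous_on S g" for S by (simp add: continuous_at_imp_continuous_on)
  let ?V = "integral {0..1} g"
  have "?V - 1 = integral {0..1} (\<lambda>t. g t - 1)"
    by (subst integral_diff) (auto intro: integrable_continuous_interval con)
  also have "norm \<dots> \<le> 1/2 * (1 - 0)"
    by (rule integral_bound) (use near in \<open>auto intro!: continuous_intros con\<close>)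
  finally have V1: "norm (?V - 1) \<le> 1/2" by simp
  then have "1 - (1 - ?V) \<in> invertibles" by (intro one_minus_invertible) (simp add: norm_minus_commute)
  then have V: "?V \<in> invertibles" by simp
  let ?W = "ainv ?V"
  have W: "norm ?W \<le> 2"
    using norm_le_if_right_inverse_near_one[OF ainv(2)[OF V] V1] by simp
  define b where "b = (g 1 - 1) * ?W"
  have gV: "g s * ?V = integral {s..s+1} g" for s
  proof -
    have "g s * ?V = integral {0..1} (\<lambda>t. g s * g t)"
      using integral_linear[OF integrable_continuous_interval[OF con] bounded_linear_mult_right, of 0 1 "g s"]
      by (simp add: o_def)
    also have "\<dots> = integral {s..s+1} g"
    proof (rule integral_unique)
      have "(g has_integral integral {s..s+1} g) (cbox s (s + 1))"
        using integrable_integral[OF integrable_continuous_interval[OF con]] by simp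
      from has_integral_affinity[OF this, of 1 s]
      have "((\<lambda>t. g (t + s)) has_integral integral {s..s+1} g) ((\<lambda>x. x - s) ` {s..s+1})" by simp
      moreover have "(\<lambda>x. x - s) ` {s..s+1} = {0..1}"
        using image_add_atLeastAtMost'[of "- s" s "s + 1"] by simp
      ultimately show "((\<lambda>t. g s * g t) has_integral integral {s..s+1} g) {0..1}"
        by (simp add: add[symmetric] add.commute)
    qed
    finally show ?thesis .
  qed
  have der: "(g has_vector_derivative g s * b) (at s)" for s
  proof -
    \<comment> \<open>a base point \<open>-N\<close> to the left of \<open>s\<close>, so that both \<open>s\<close> and \<open>s + 1\<close> are interior to \<open>[-N, N]\<close>\<close>
    define N where "N = \<bar>s\<bar> + 2"
    define G where "G = (\<lambda>u. integral {-N..u} g)"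
    have G: "(G has_vector_derivative g u) (at u)" if "u \<in> {-N<..<N}" for u
    proof -
      have "(G has_vector_derivative g u) (at u within {-N..N})"
        unfolding G_def by (rule integral_has_vector_derivative[OF con]) (use that in auto)
      moreover have "at u within {-N..N} = at u" by (rule at_within_Icc_at) (use that in auto)
      ultimately show ?thesis by simp
    qed
    have sN: "s \<in> {-N<..<N}" "s + 1 \<in> {-N<..<N}" by (auto simp: N_def)
    have "((\<lambda>u. u + 1) has_vector_derivative (1 + 0)) (at s)"
      by (intro has_vector_derivative_add has_vector_derivative_id has_vector_derivative_const)
    then have "((\<lambda>u. u + 1) has_vector_derivative 1) (at s)" by simp
    then have "((G \<circ> (\<lambda>u. u + 1)) has_vector_derivative (1 *\<^sub>R g (s + 1))) (at s)"
      by (rule vector_diff_chain_at) (rule G[OF sN(2)])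
    then have "((\<lambda>u. G (u + 1) - G u) has_vector_derivative (g (s + 1) - g s)) (at s)"
      using G[OF sN(1)] by (auto simp: o_def intro!: derivative_eq_intros)
    then have "((\<lambda>u. g u * ?V) has_vector_derivative (g (s + 1) - g s)) (at s)"
    proof (rule has_vector_derivative_transform_within_open[of _ _ _ "{-N<..<N}"])
      fix u assume u: "u \<in> {-N<..<N}"
      have "integral {-N..u} g + integral {u..u+1} g = integral {-N..u+1} g"
        using u by (intro Henstock_Kurzweil_Integration.integral_combine integrable_continuous_interval con) auto
      then show "G (u + 1) - G u = g u * ?V" by (simp add: gV G_def algebra_simps)
    qed (auto simp: N_def)
    then have "((\<lambda>u. g u * ?V * ?W) has_vector_derivative (g (s + 1) - g s) * ?W) (at s)"
      by (rule bounded_linear.has_vector_derivative[OF bounded_linear_mult_left])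
    moreover have "g u * ?V * ?W = g u" for u by (simp add: mult.assoc ainv V)
    moreover have "(g (s + 1) - g s) * ?W = g s * b" 
      by (simp only: b_def add[of s 1]) (simp add: algebra_simps)
    ultimately show ?thesis by simp
  qed
  have "g t = exp (t *\<^sub>R b)" for t
  proof -
    define f where "f = (\<lambda>t. g t * exp (t *\<^sub>R (- b)))"
    have "(f has_vector_derivative 0) (at s within UNIV)" for s
    proof -
      have "(f has_vector_derivative (g s * (exp (s *\<^sub>R (- b)) * (- b)) + g s * b * exp (s *\<^sub>R (- b)))) (at s)"
        unfolding f_def
        by (rule bounded_bilinear.has_vector_derivative[OF bounded_bilinear_mult der
              exp_scaleR_has_vector_derivative_right])
      moreover have "exp (s *\<^sub>R (- b)) * b = b * exp (s *\<^sub>R (- b))" by (rule exp_commute) simp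
      ultimately show ?thesis by (simp add: mult.assoc)
    qed
    then obtain c where "\<And>s. f s = c"
      using has_vector_derivative_zero_constant[of UNIV f] by auto
    then have "f t = f 0" by simp
    then have "g t * exp (- (t *\<^sub>R b)) = 1" by (simp add: f_def g0)
    then have "g t * (exp (- (t *\<^sub>R b)) * exp (t *\<^sub>R b)) = exp (t *\<^sub>R b)"
      by (simp add: mult.assoc[symmetric])
    then show ?thesis using exp_minus_inverse[of "- (t *\<^sub>R b)"] by simp
  qed
  moreover have "norm b \<le> 1"
  proof -
    have "norm b \<le> norm (g 1 - 1) * norm ?W" unfolding b_def by (rule norm_mult_ineq)
    also have "\<dots> \<le> 1/2 * 2" by (intro mult_mono near W) auto
    finally show ?thesis by simp
  qed
  ultimately show ?thesis by blast
qed

text \<open>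
  The logarithm is the integral of \<open>w (1 + s w)\<^sup>-\<^sup>1\<close> over \<open>[0, 1]\<close>. With \<open>L(t)\<close> the integral over \<open>[0, t]\<close>,
  everything in sight commutes and \<open>exp (- L(t)) (1 + t w)\<close> has derivative \<open>0\<close>.
\<close>

lemma exists_logarithm:
  fixes w :: "'a::unital_banach"
  assumes inv: "\<And>s. 0 \<le> s \<Longrightarrow> s \<le> 1 \<Longrightarrow> 1 + s *\<^sub>R w \<in> invertibles"
  shows "\<exists>q. exp q = 1 + w"
proof -
  define l where "l = (\<lambda>s. w * ainv (1 + s *\<^sub>R w))"
  define L where "L = (\<lambda>t. integral {0..t} l)"
  have inv': "1 + s *\<^sub>R w \<in> invertibles" if "s \<in> {0..1}" for s using that inv by auto
  have con: "continuous_on {0..1} l"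
    unfolding l_def using inv' by (intro continuous_on_mult continuous_on_const continuous_on_ainv continuous_intros) auto
  have int: "l integrable_on {0..t}" if "t \<in> {0..1}" for t
    using that by (intro integrable_continuous_interval continuous_on_subset[OF con]) auto
  have L_comm: "L t * c = c * L t" if c: "\<And>s. s \<in> {0..1} \<Longrightarrow> l s * c = c * l s" and t: "t \<in> {0..1}" for t c
  proof -
    have "L t * c = integral {0..t} (\<lambda>s. l s * c)"
      using integral_linear[OF int[OF t] bounded_linear_mult_left[of c]] by (simp add: o_def L_def)
    also have "\<dots> = integral {0..t} (\<lambda>s. c * l s)"
      using c t by (intro Henstock_Kurzweil_Integration.integral_cong) auto
    also have "\<dots> = c * L t"
      using integral_linear[OF int[OF t] bounded_linear_mult_right[of c]] by (simp add: o_def L_def)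
    finally show ?thesis .
  qed
  have l_comm: "l s * c = c * l s" if "w * c = c * w" "s \<in> {0..1}" for s c
  proof -
    have "ainv (1 + s *\<^sub>R w) * c = c * ainv (1 + s *\<^sub>R w)"
      by (rule ainv_commute[OF inv'[OF that(2)]]) (simp add: algebra_simps that(1))
    then show ?thesis by (simp add: l_def mult.assoc) (simp add: mult.assoc[symmetric] that(1))
  qed
  have L_w: "L t * w = w * L t" if "t \<in> {0..1}" for t
    using that by (intro L_comm l_comm) auto
  have LL: "L s * L t = L t * L s" if "s \<in> {0..1}" "t \<in> {0..1}" for s t
    using that by (intro L_comm l_comm) (auto simp: L_w)
  have derL: "(L has_vector_derivative l t) (at t within {0..1})" if "t \<in> {0..1}" for t
    unfolding L_def by (rule integral_has_vector_derivative[OF con that])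
  define K where "K = (\<lambda>t. exp (- L t) * (1 + t *\<^sub>R w))"
  have "(K has_vector_derivative 0) (at t within {0..1})" if t: "t \<in> {0..1}" for t
  proof -
    have "((\<lambda>s. exp (- L s)) has_vector_derivative exp (- L t) * (- l t)) (at t within {0..1})"
      using t LL by (intro exp_has_vector_derivative_commuting has_vector_derivative_minus derL) auto
    moreover have "((\<lambda>s. 1 + s *\<^sub>R w) has_vector_derivative w) (at t within {0..1})"
      by (auto intro!: derivative_eq_intros)
    ultimately have "(K has_vector_derivative
        (exp (- L t) * w + exp (- L t) * (- l t) * (1 + t *\<^sub>R w))) (at t within {0..1})"
      unfolding K_def by (rule bounded_bilinear.has_vector_derivative[OF bounded_bilinear_mult])
    moreover have "l t * (1 + t *\<^sub>R w) = w" by (simp only: l_def mult.assoc ainv[OF inv'[OF t]] mult_1_right)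
    then have "exp (- L t) * (- l t) * (1 + t *\<^sub>R w) = - (exp (- L t) * w)"
      by (simp add: mult.assoc)
    ultimately show ?thesis by simp
  qed
  then obtain c where c: "\<And>t. t \<in> {0..1} \<Longrightarrow> K t = c"
    using has_vector_derivative_zero_constant[of "{0..1}" K] by auto
  have "K 1 = K 0" using c[of 0] c[of 1] by simp
  then have "exp (- L 1) * (1 + w) = 1" by (simp add: K_def L_def)
  then have "exp (L 1) * exp (- L 1) * (1 + w) = exp (L 1)" by (simp add: mult.assoc)
  then have "exp (L 1) = 1 + w" by (simp add: exp_minus_inverse)
  then show ?thesis by blast
qed

section \<open>Reduction to a multiplicative spectrum-preserving map\<close>

text \<open>
  Surjectivity carries \<open>determined_by_spectra_of_multiples\<close> over to the target algebra: if
  \<open>b = \<phi>(w)\<close> and \<open>b' = \<phi>(w')\<close> have isospectral multiples, then so have \<open>w\<close> and \<open>w'\<close>. In this way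
  identities between products of values of \<open>\<phi>\<close> can be read off from their spectra.
\<close>

lemma normalize_triple_spectral_map:
  fixes \<phi> :: "'a::cstar_algebra \<Rightarrow> 'b::unital_banach"
  assumes surj: "surj \<phi>"
    and spec: "\<And>x y z. spectrum (\<phi> x * \<phi> y * \<phi> z) = spectrum (x * y * z)"
    and cont: "isCont \<phi> 1"
  shows "\<exists>\<psi> :: 'a \<Rightarrow> 'b. surj \<psi> \<and> (\<forall>x y. \<psi> (x * y) = \<psi> x * \<psi> y) \<and>
           (\<forall>x. spectrum (\<psi> x) = spectrum x) \<and> isCont \<psi> 1"
proof -
  have det: "b = b'" if bb': "\<And>c. spectrum (b * c) = spectrum (b' * c)" for b b' :: 'b
  proof -
    obtain w w' where w: "b = \<phi> w" "b' = \<phi> w'" using surj by (meson surjD)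
    have "spectrum (w * y) = spectrum (w' * y)" for y
      using spec[of w y 1] spec[of w' y 1] bb'[of "\<phi> y * \<phi> 1"] by (simp add: w mult.assoc)
    then show ?thesis using determined_by_spectra_of_multiples[of w w'] w by blast
  qed
  define u where "u = \<phi> 1"
  have prod: "\<phi> x * \<phi> y = u * \<phi> (x * y)" for x y
  proof (rule det)
    fix c
    obtain s where "c = \<phi> s" using surj by (meson surjD)
    then show "spectrum (\<phi> x * \<phi> y * c) = spectrum (u * \<phi> (x * y) * c)"
      using spec[of x y s] spec[of 1 "x * y" s] by (simp add: u_def)
  qed
  have central: "u * c = c * u" for c
    using prod[of _ 1] surj by (metis mult_1_right surjD u_def)
  let ?v = "u * u"
  have u3: "u * ?v = 1"
  proof (rule det)
    fix c
    let ?n = "u * ?v - 1"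
    \<comment> \<open>\<open>u\<^sup>3 - 1\<close> is quasinilpotent and central, so multiplication by \<open>u\<^sup>3\<close> does not change spectra\<close>
    have sp: "spectrum (u * ?v) = {1}" using spec[of 1 1 1] by (simp add: u_def spectrum_one mult.assoc)
    have "spectrum (u * ?v + (- 1) *\<^sub>C 1) = {0}"
      by (auto simp: spectrum_shift sp add_eq_0_iff)
    then have n: "specrad ?n = 0" by (simp add: specrad_eq_0_iff scaleC_simps)
    have "c * (u * ?v) = (u * ?v) * c" by (metis central mult.assoc)
    then have nc: "?n * c = c * ?n" by (simp only: left_diff_distrib right_diff_distrib) simp
    have "specrad (?n * c) = 0" by (rule specrad_mult_quasinilpotent[OF nc n])
    moreover have "c * (?n * c) = (?n * c) * c" by (metis nc mult.assoc)
    ultimately have "spectrum (c + ?n * c) = spectrum c" by (intro spectrum_add_quasinilpotent)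
    moreover have "c + ?n * c = u * ?v * c" by (simp add: left_diff_distrib)
    ultimately show "spectrum (u * ?v * c) = spectrum (1 * c)" by simp
  qed
  define \<psi> where "\<psi> = (\<lambda>x. ?v * \<phi> x)"
  have vu: "?v * u = 1" using u3 by (simp add: mult.assoc)
  have "surj \<psi>"
  proof (rule surjI)
    fix c
    have "\<phi> (inv \<phi> (u * c)) = u * c" by (rule surj_f_inv_f[OF surj])
    then show "\<psi> (inv \<phi> (u * c)) = c" by (simp add: \<psi>_def) (simp add: mult.assoc[symmetric] vu)
  qed
  moreover have "\<psi> (x * y) = \<psi> x * \<psi> y" for x y
  proof -
    have "\<psi> x * \<psi> y = ?v * (\<phi> x * ?v) * \<phi> y" by (simp add: \<psi>_def mult.assoc)
    also have "\<phi> x * ?v = ?v * \<phi> x" by (metis central mult.assoc)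
    also have "?v * (?v * \<phi> x) * \<phi> y = ?v * (?v * u) * \<phi> (x * y)" by (simp only: mult.assoc prod)
    also have "\<dots> = \<psi> (x * y)" by (simp only: vu mult_1_right \<psi>_def)
    finally show ?thesis by simp
  qed
  moreover have "spectrum (\<psi> x) = spectrum x" for x
    using spec[of 1 1 x] by (simp add: \<psi>_def u_def)
  moreover have "isCont \<psi> 1" unfolding \<psi>_def by (intro continuous_intros cont)
  ultimately show ?thesis by blast
qed

section \<open>The differential of a multiplicative spectrum-preserving map\<close>

locale multiplicative_isospectral =
  fixes \<psi> :: "'a::cstar_algebra \<Rightarrow> 'b::unital_banach"
  assumes surj: "surj \<psi>" and mult: "\<psi> (x * y) = \<psi> x * \<psi> y"
    and spec: "spectrum (\<psi> x) = spectrum x" and cont: "isCont \<psi> 1"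
begin

lemma inj: "\<psi> x = \<psi> y \<Longrightarrow> x = y"
  by (metis determined_by_spectra_of_multiples mult spec)

lemma one: "\<psi> 1 = 1"
  by (metis mult mult_1_left mult_1_right surj surjD)

text \<open>
  \<open>\<psi>(y) = \<psi>(x) \<psi>(x\<^sup>-\<^sup>1 y)\<close> moves continuity from \<open>1\<close> to \<open>x\<close>.
\<close>

lemma isCont_invertible:
  assumes "x \<in> invertibles"
  shows "isCont \<psi> x"
proof -
  have eq: "\<psi> y = \<psi> x * \<psi> (ainv x * y)" for y by (simp add: mult[symmetric] ainv_cancel assms)
  have "isCont \<psi> (ainv x * x)" using cont by (simp add: ainv assms)
  then have "isCont (\<lambda>y. \<psi> (ainv x * y)) x"
    by (intro isCont_o2[of x "\<lambda>y. ainv x * y" \<psi>] continuous_intros)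
  then have "isCont (\<lambda>y. \<psi> x * \<psi> (ainv x * y)) x" by (intro continuous_intros)
  then show ?thesis by (simp only: eq[symmetric])
qed

lemma generator_near_0: "\<exists>\<delta>>0. \<forall>a. norm a \<le> \<delta> \<longrightarrow> (\<exists>b. norm b \<le> 1 \<and> (\<forall>t. \<psi> (exp (t *\<^sub>R a)) = exp (t *\<^sub>R b)))"
proof -
  have "isCont exp (0::'a)" by (rule has_derivative_continuous[OF exp_has_derivative_at_0])
  then have "isCont (\<lambda>a. \<psi> (exp a)) 0" by (intro isCont_o2[of 0 exp \<psi>]) (simp_all add: cont)
  then obtain \<delta> where \<delta>: "\<delta> > 0" "\<And>a. dist a 0 < \<delta> \<Longrightarrow> dist (\<psi> (exp a)) (\<psi> (exp 0)) < 1/2"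
    unfolding continuous_at_eps_delta by (metis half_gt_zero_iff zero_less_one)
  have "\<exists>b. norm b \<le> 1 \<and> (\<forall>t. \<psi> (exp (t *\<^sub>R a)) = exp (t *\<^sub>R b))" if a: "norm a \<le> \<delta> / 2" for a
  proof (rule one_parameter_group_generator)
    fix s t :: real
    have "exp ((s + t) *\<^sub>R a) = exp (s *\<^sub>R a) * exp (t *\<^sub>R a)"
      unfolding scaleR_add_left by (rule exp_add_commuting) simp
    then show "\<psi> (exp ((s + t) *\<^sub>R a)) = \<psi> (exp (s *\<^sub>R a)) * \<psi> (exp (t *\<^sub>R a))" by (simp add: mult)
  next
    show "isCont (\<lambda>t. \<psi> (exp (t *\<^sub>R a))) 0"
      using has_vector_derivative_continuous[OF has_vector_derivative_exp_0[of a]]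
      by (intro isCont_o2[of 0 "\<lambda>t. exp (t *\<^sub>R a)" \<psi>]) (simp_all add: cont)
  next
    fix t :: real assume t: "0 \<le> t" "t \<le> 1"
    have "norm (t *\<^sub>R a) \<le> 1 * (\<delta> / 2)" using t a by (simp only: norm_scaleR) (intro mult_mono, auto)
    then have "dist (t *\<^sub>R a) 0 < \<delta>" using \<delta>(1) by simp
    from \<delta>(2)[OF this] show "norm (\<psi> (exp (t *\<^sub>R a)) - 1) \<le> 1/2" by (simp add: one dist_norm)
  qed
  then show ?thesis using \<delta>(1) by (intro exI[of _ "\<delta> / 2"]) auto
qed

text \<open>
  The differential of \<open>\<psi>\<close> at \<open>1\<close>, defined through one-parameter groups.
\<close>

definition D :: "'a \<Rightarrow> 'b" where
  "D a = (SOME b. \<forall>t. \<psi> (exp (t *\<^sub>R a)) = exp (t *\<^sub>R b))"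

lemma D_unique:
  assumes "\<And>t. \<psi> (exp (t *\<^sub>R a)) = exp (t *\<^sub>R b)"
  shows "D a = b"
  unfolding D_def
proof (rule some_equality)
  fix b' assume b': "\<forall>t. \<psi> (exp (t *\<^sub>R a)) = exp (t *\<^sub>R b')"
  show "b' = b" by (rule exp_group_generator_unique) (metis assms b')
qed (use assms in blast)

lemma psi_exp_scaleR: "\<psi> (exp (t *\<^sub>R a)) = exp (t *\<^sub>R D a)"
proof -
  obtain \<delta> where \<delta>: "\<delta> > 0"
    "\<And>a. norm a \<le> \<delta> \<Longrightarrow> \<exists>b. norm b \<le> 1 \<and> (\<forall>t. \<psi> (exp (t *\<^sub>R a)) = exp (t *\<^sub>R b))"
    using generator_near_0 by blast
  define r where "r = \<delta> / (norm a + 1)"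
  have r: "r > 0" using \<delta>(1) by (simp add: r_def add_nonneg_pos)
  have "norm (r *\<^sub>R a) \<le> \<delta>" 
    using \<delta>(1) by (simp add: r_def pos_divide_le_eq add_nonneg_pos)
  then obtain b where b: "\<And>t. \<psi> (exp (t *\<^sub>R r *\<^sub>R a)) = exp (t *\<^sub>R b)" using \<delta>(2) by blast
  have "\<psi> (exp (s *\<^sub>R a)) = exp (s *\<^sub>R ((1/r) *\<^sub>R b))" for s
    using b[of "s / r"] r by simp
  then have "D a = (1/r) *\<^sub>R b" and "\<And>s. \<psi> (exp (s *\<^sub>R a)) = exp (s *\<^sub>R ((1/r) *\<^sub>R b))"
    by (auto intro: D_unique)
  then show ?thesis by simp
qed

lemma psi_exp: "\<psi> (exp a) = exp (D a)"
  using psi_exp_scaleR[of 1 a] by simp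

lemma D_scaleR: "D (r *\<^sub>R a) = r *\<^sub>R D a"
  by (rule D_unique) (metis psi_exp_scaleR scaleR_scaleR)

lemma D_bounded: "\<exists>K. \<forall>a. norm (D a) \<le> norm a * K"
proof -
  obtain \<delta> where \<delta>: "\<delta> > 0"
    "\<And>a. norm a \<le> \<delta> \<Longrightarrow> \<exists>b. norm b \<le> 1 \<and> (\<forall>t. \<psi> (exp (t *\<^sub>R a)) = exp (t *\<^sub>R b))"
    using generator_near_0 by blast
  have small: "norm (D a) \<le> 1" if "norm a \<le> \<delta>" for a
    using \<delta>(2)[OF that] D_unique by blast
  have "norm (D a) \<le> norm a * (1 / \<delta>)" for a
  proof (cases "a = 0")
    case True
    then show ?thesis using D_scaleR[of 0 0] by simp
  next
    case False
    then have "norm (D ((\<delta> / norm a) *\<^sub>R a)) \<le> 1" using \<delta>(1) by (intro small) simp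
    then show ?thesis using False \<delta>(1) by (simp add: D_scaleR field_simps)
  qed
  then show ?thesis by blast
qed

lemma D_add: "D (a + b) = D a + D b"
proof (rule D_unique)
  have *: "\<psi> (exp (a + b)) = exp (D a + D b)" for a b
  proof -
    let ?X = "\<lambda>n. (exp ((1 / real n) *\<^sub>R a) * exp ((1 / real n) *\<^sub>R b)) ^ n"
    have pow: "\<psi> (x ^ n) = \<psi> x ^ n" for x n by (induction n) (simp_all add: one mult)
    have "(\<lambda>n. \<psi> (?X n)) \<longlonglongrightarrow> \<psi> (exp (a + b))"
      by (rule isCont_tendsto_compose[OF isCont_invertible[OF exp_invertible] trotter_product_formula])
    moreover have "(\<lambda>n. \<psi> (?X n)) \<longlonglongrightarrow> exp (D a + D b)"
      using trotter_product_formula[of "D a" "D b"] by (simp add: pow mult psi_exp_scaleR)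
    ultimately show ?thesis by (rule LIMSEQ_unique)
  qed
  show "\<psi> (exp (t *\<^sub>R (a + b))) = exp (t *\<^sub>R (D a + D b))" for t
    using *[of "t *\<^sub>R a" "t *\<^sub>R b"] by (simp add: scaleR_add_right D_scaleR)
qed

lemma D_minus: "D (- a) = - D a"
  using D_scaleR[of "- 1" a] by simp

lemma D_diff: "D (a - b) = D a - D b"
  using D_add[of a "- b"] by (simp add: D_minus)

lemma bounded_linear_D: "bounded_linear D"
proof -
  obtain K where "\<And>a. norm (D a) \<le> norm a * K" using D_bounded by blast
  then show ?thesis by (rule bounded_linear_intro[OF D_add D_scaleR])
qed

lemma D_commute_psi:
  assumes "a * z = z * a"
  shows "D a * \<psi> z = \<psi> z * D a"
proof (rule exp_group_commutes_imp)
  fix t :: real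
  have "exp (t *\<^sub>R a) * z = z * exp (t *\<^sub>R a)" by (rule exp_commute) (simp add: assms)
  then show "exp (t *\<^sub>R D a) * \<psi> z = \<psi> z * exp (t *\<^sub>R D a)"
    by (simp add: psi_exp_scaleR[symmetric] mult[symmetric])
qed

lemma D_commute:
  assumes "a * b = b * a"
  shows "D a * D b = D b * D a"
proof -
  have "exp (t *\<^sub>R D b) * D a = D a * exp (t *\<^sub>R D b)" for t :: real
  proof -
    have "exp (t *\<^sub>R b) * a = a * exp (t *\<^sub>R b)" by (rule exp_commute) (simp add: assms)
    then show ?thesis using D_commute_psi[of a "exp (t *\<^sub>R b)"] by (simp add: psi_exp_scaleR)
  qed
  then show ?thesis using exp_group_commutes_imp by metis
qed

lemma spectrum_D: "spectrum (D a) = spectrum a"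
proof -
  have eq: "spectrum (exp (t *\<^sub>R a)) = spectrum (exp (t *\<^sub>R D a))" for t :: real
    by (metis psi_exp_scaleR spec)
  show ?thesis
    using spectrum_subset_if_exp_groups_isospectral[OF eq]
      spectrum_subset_if_exp_groups_isospectral[OF eq[symmetric]] by blast
qed

text \<open>
  The element \<open>x\<close> with \<open>\<psi>(x) = exp n\<close> commutes with everything that commutes with \<open>h\<close>: with \<open>h\<close> itself, therefore
  with \<open>x\<^sup>*\<close> because \<open>h\<close> is self-adjoint. So \<open>x\<close> is normal with spectrum \<open>{1}\<close>, that is \<open>x = 1\<close>. The same
  applies to all real multiples of \<open>n\<close>, and the group \<open>exp (t n)\<close> is trivial.
\<close>

lemma quasinilpotent_in_commutant_eq_0:
  assumes h: "star h = h" and n: "specrad n = 0"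
    and comm: "\<And>z. z * h = h * z \<Longrightarrow> n * \<psi> z = \<psi> z * n"
  shows "n = 0"
proof -
  have exp1: "exp m = 1"
    if m: "specrad m = 0" and mcomm: "\<And>z. z * h = h * z \<Longrightarrow> m * \<psi> z = \<psi> z * m" for m
  proof -
    obtain x where x: "exp m = \<psi> x" using surj by (meson surjD)
    have xz: "x * z = z * x" if "z * h = h * z" for z
      using exp_commute[OF mcomm[OF that]] by (intro inj) (simp add: mult x)
    have xh: "x * h = h * x" by (rule xz) simp
    then have "star (x * h) = star (h * x)" by simp
    then have "star x * h = h * star x" by (simp add: star_mult h)
    then have nx: "x * star x = star x * x" by (rule xz)
    have "spectrum (x + (- 1) *\<^sub>C 1) = spectrum (exp m + (- 1) *\<^sub>C 1)"
      by (auto simp: spectrum_shift x spec)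
    then have "specrad (x - 1) = 0"
      using specrad_exp_minus_one_quasinilpotent[OF m] by (simp add: specrad_def scaleC_simps)
    moreover have "star (x - 1) * (x - 1) = (x - 1) * star (x - 1)"
      by (simp add: star_diff algebra_simps nx)
    ultimately have "x - 1 = 0" by (intro normal_quasinilpotent_eq_0)
    then show ?thesis using x one by simp
  qed
  have "exp (t *\<^sub>R n) = exp (t *\<^sub>R 0)" for t :: real
    unfolding scaleR_zero_right exp_zero
  proof (rule exp1)
    show "specrad (t *\<^sub>R n) = 0"
      using specrad_scaleC_le[of "complex_of_real t" n] n specrad_nonneg[of "t *\<^sub>R n"]
      by (simp add: scaleR_scaleC)
  qed (simp add: comm)
  then show ?thesis by (rule exp_group_generator_unique)
qed

text \<open>
  \<open>D(1) - 1\<close> is quasinilpotent and commutes with the whole range of \<open>\<psi>\<close>.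
\<close>

lemma D_one: "D 1 = 1"
proof -
  have "spectrum (D 1 + (- 1) *\<^sub>C 1) = {0}"
    by (auto simp: spectrum_shift spectrum_D spectrum_one add_eq_0_iff)
  then have "specrad (D 1 - 1) = 0" by (simp add: specrad_eq_0_iff scaleC_simps)
  then have "D 1 - 1 = 0"
    by (rule quasinilpotent_in_commutant_eq_0[of 0, rotated])
       (simp_all add: algebra_simps D_commute_psi)
  then show ?thesis by simp
qed

text \<open>
  Let \<open>n = i D(h) - D(i h)\<close>. As \<open>\<sigma>(D(c h)) = c \<sigma>(h)\<close>, the commuting summands of \<open>- i n = D(h) + i D(i h)\<close> have
  real spectra, and so have those of \<open>n / (1 + i) = D(h) - D((1 + i) h) / (1 + i)\<close>. Hence \<open>\<sigma>(n)\<close> lies on the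
  real lines spanned by \<open>i\<close> and by \<open>1 + i\<close>, which meet in \<open>0\<close>.
\<close>

lemma D_imaginary_selfadjoint:
  assumes h: "star h = h"
  shows "D (\<i> *\<^sub>C h) = \<i> *\<^sub>C D h"
proof -
  let ?n = "\<i> *\<^sub>C D h - D (\<i> *\<^sub>C h)"
  let ?c = "1 / (1 + \<i>)"
  have nz: "1 + \<i> \<noteq> 0" by (simp add: complex_eq_iff)
  have real: "spectrum (D h) \<subseteq> \<real>" by (simp add: spectrum_D selfadjoint_spectrum_real h)
  have real': "spectrum (c *\<^sub>C D (d *\<^sub>C h)) \<subseteq> \<real>" if "c * d \<in> \<real>" for c d
  proof
    fix e assume "e \<in> spectrum (c *\<^sub>C D (d *\<^sub>C h))"
    then obtain f where f: "e = c * f" "f \<in> spectrum (d *\<^sub>C h)"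
      using spectrum_scaleC[of e c "D (d *\<^sub>C h)"] by (auto simp: spectrum_D)
    then obtain g where g: "f = d * g" "g \<in> spectrum h" using spectrum_scaleC[of f d h] by auto
    have "e = (c * d) * g" using f g by simp
    then show "e \<in> \<real>" using g(2) that selfadjoint_spectrum_real[OF h] by (metis Reals_mult subsetD)
  qed
  have comm: "D h * (c *\<^sub>C D (d *\<^sub>C h)) = (c *\<^sub>C D (d *\<^sub>C h)) * D h" for c d
    using D_commute[of h "d *\<^sub>C h"] by (simp add: scaleC_simps)
  have "spectrum (D h + \<i> *\<^sub>C D (\<i> *\<^sub>C h)) \<subseteq> \<real>"
    by (intro real_spectrum_add_commuting comm real real') simp
  moreover have "D h + \<i> *\<^sub>C D (\<i> *\<^sub>C h) = (- \<i>) *\<^sub>C ?n" by (simp add: scaleC_simps)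
  ultimately have 1: "spectrum ((- \<i>) *\<^sub>C ?n) \<subseteq> \<real>" by simp
  have "spectrum (D h + (- ?c) *\<^sub>C D ((1 + \<i>) *\<^sub>C h)) \<subseteq> \<real>"
    by (intro real_spectrum_add_commuting comm real real') (simp add: nz)
  moreover have "D h + (- ?c) *\<^sub>C D ((1 + \<i>) *\<^sub>C h) = ?c *\<^sub>C ?n"
  proof -
    have "?c *\<^sub>C ?n = ?c *\<^sub>C ((1 + \<i>) *\<^sub>C D h - D ((1 + \<i>) *\<^sub>C h))"
      by (simp add: scaleC_add_left scaleC_one D_add)
    also have "\<dots> = D h + (- ?c) *\<^sub>C D ((1 + \<i>) *\<^sub>C h)"
      unfolding scaleC_diff_right scaleC_scaleC using nz by (simp add: scaleC_one scaleC_minus_left)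
    finally show ?thesis by simp
  qed
  ultimately have 2: "spectrum (?c *\<^sub>C ?n) \<subseteq> \<real>" by simp
  have "d = 0" if d: "d \<in> spectrum ?n" for d
  proof -
    have "(- \<i>) * d \<in> spectrum ((- \<i>) *\<^sub>C ?n)" "?c * d \<in> spectrum (?c *\<^sub>C ?n)"
      using d nz by (subst spectrum_scaleC_iff; simp)+
    then have "(- \<i>) * d \<in> \<real>" "?c * d \<in> \<real>" using 1 2 by blast+
    then have "Re d = 0" "Im (d / (1 + \<i>)) = 0" by (simp_all add: complex_is_Real_iff)
    then show ?thesis by (simp add: Im_divide complex_eq_iff)
  qed
  then have "spectrum ?n = {0}" using spectrum_nonempty[of ?n] by blast
  then have n: "specrad ?n = 0" by (simp add: specrad_eq_0_iff)
  have "?n = 0"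
  proof (rule quasinilpotent_in_commutant_eq_0[OF h n])
    fix z assume z: "z * h = h * z"
    have "D h * \<psi> z = \<psi> z * D h" "D (\<i> *\<^sub>C h) * \<psi> z = \<psi> z * D (\<i> *\<^sub>C h)"
      using z by (simp_all add: D_commute_psi scaleC_simps)
    then show "?n * \<psi> z = \<psi> z * ?n"
      by (simp add: left_diff_distrib right_diff_distrib mult_scaleC_left mult_scaleC_right)
  qed
  then show ?thesis by simp
qed

section \<open>The differential is an isomorphism\<close>

lemma D_imaginary: "D (\<i> *\<^sub>C a) = \<i> *\<^sub>C D a"
proof -
  obtain h k where hk: "star h = h" "star k = k" "a = h + \<i> *\<^sub>C k" by (rule selfadjoint_decomposition)
  have "\<i> *\<^sub>C a = \<i> *\<^sub>C h - k" by (simp add: hk scaleC_simps)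
  then have "D (\<i> *\<^sub>C a) = \<i> *\<^sub>C D h - D k" by (simp add: D_diff D_imaginary_selfadjoint hk)
  moreover have "D a = D h + \<i> *\<^sub>C D k" by (simp add: hk D_add D_imaginary_selfadjoint)
  ultimately show ?thesis by (simp add: scaleC_simps)
qed

lemma D_scaleC: "D (c *\<^sub>C a) = c *\<^sub>C D a"
proof -
  have c: "c = of_real (Re c) + of_real (Im c) * \<i>" by (simp add: complex_eq_iff)
  have split: "c *\<^sub>C x = Re c *\<^sub>R x + Im c *\<^sub>R (\<i> *\<^sub>C x)" for x :: "'x::unital_banach"
    by (subst c) (simp only: scaleR_scaleC scaleC_simps)
  show ?thesis by (simp only: split D_add D_scaleR D_imaginary)
qed

text \<open>
  Put \<open>A = D(k)\<close>, \<open>B = D(k\<^sup>-\<^sup>1)\<close> and \<open>c = \<plusminus>i\<close>. Since \<open>D(k + c k\<^sup>-\<^sup>1) = A + c B\<close> and \<open>(k + c k\<^sup>-\<^sup>1)\<^sup>2 - 2 c\<close> is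
  self-adjoint, \<open>(A + c B)\<^sup>2 - 2 c\<close> has real spectrum for both signs; the difference of the two
  is \<open>4 i (A B - 1)\<close>. On the other hand \<open>4 A B = (A + B)\<^sup>2 - (A - B)\<^sup>2\<close> has real spectrum. So \<open>A B - 1\<close> is
  quasinilpotent.
\<close>

lemma D_ainv_selfadjoint:
  assumes k: "star k = k" and inv: "k \<in> invertibles"
  shows "D k * D (ainv k) = 1"
proof -
  let ?y = "ainv k"
  let ?A = "D k" and ?B = "D ?y"
  have y: "star ?y = ?y" by (simp add: star_ainv inv k)
  have comm: "?A * ?B = ?B * ?A" by (rule D_commute) (simp add: ainv inv)
  have real: "spectrum x \<subseteq> \<real>" if "star x = x" for x :: 'a using that by (rule selfadjoint_spectrum_real)
  have sqreal: "spectrum (x * x) \<subseteq> \<real>" if "spectrum x \<subseteq> \<real>" for x :: 'b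
    using that spectrum_power2[of _ x] by (fastforce intro: Reals_mult)
  have quad: "spectrum ((?A + c *\<^sub>C ?B) * (?A + c *\<^sub>C ?B) + (- 2 * c) *\<^sub>C 1) \<subseteq> \<real>" if c: "c * c = - 1" for c
  proof
    fix d assume "d \<in> spectrum ((?A + c *\<^sub>C ?B) * (?A + c *\<^sub>C ?B) + (- 2 * c) *\<^sub>C 1)"
    then have "d + 2 * c \<in> spectrum ((?A + c *\<^sub>C ?B) * (?A + c *\<^sub>C ?B))" by (simp add: spectrum_shift)
    then obtain e where e: "d + 2 * c = e * e" "e \<in> spectrum (?A + c *\<^sub>C ?B)"
      using spectrum_power2 by blast
    then have "e \<in> spectrum (k + c *\<^sub>C ?y)" by (metis D_add D_scaleC spectrum_D)
    from power_in_spectrum_power[OF this, of 2]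
    have "d + 2 * c \<in> spectrum ((k + c *\<^sub>C ?y) * (k + c *\<^sub>C ?y))" by (simp add: e power2_eq_square)
    moreover have "(k + c *\<^sub>C ?y) * (k + c *\<^sub>C ?y) = (k * k - ?y * ?y) + (2 * c) *\<^sub>C 1"
      using square_add_scaleC[of k ?y c] c by (simp add: ainv inv)
    ultimately have "d \<in> spectrum (k * k - ?y * ?y)" by (simp add: spectrum_shift)
    moreover have "star (k * k - ?y * ?y) = k * k - ?y * ?y" by (simp add: star_diff star_mult k y)
    ultimately show "d \<in> \<real>" using real by blast
  qed
  have neg: "spectrum (- x) \<subseteq> \<real>" if "spectrum x \<subseteq> \<real>" for x :: 'b
  proof
    fix d assume "d \<in> spectrum (- x)"
    then have "- d \<in> spectrum x"
      using spectrum_scaleC_iff[of "- 1" d x] by (simp add: scaleC_minus_left scaleC_one)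
    then show "d \<in> \<real>" using that by (metis Reals_minus_iff subsetD)
  qed
  let ?P = "(?A + \<i> *\<^sub>C ?B) * (?A + \<i> *\<^sub>C ?B) + (- 2 * \<i>) *\<^sub>C 1"
  let ?Q = "(?A + (- \<i>) *\<^sub>C ?B) * (?A + (- \<i>) *\<^sub>C ?B) + (- 2 * (- \<i>)) *\<^sub>C 1"
  let ?n = "?A * ?B - 1"
  define S where "S = ?A * ?A - ?B * ?B"
  define T where "T = (2 * \<i>) *\<^sub>C ?n"
  have P: "?P = S + T"
    using square_add_scaleC[OF comm, of "\<i>"] by (simp add: S_def T_def scaleC_simps)
  have Q: "?Q = S - T"
    using square_add_scaleC[OF comm, of "- \<i>"] by (simp add: S_def T_def scaleC_simps)
  have AB: "?A * (?B * ?B) = ?B * (?B * ?A)" "?B * (?A * ?A) = ?A * (?A * ?B)"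
    by (metis comm mult.assoc)+
  have "?A * S = S * ?A" "?B * S = S * ?B"
    using AB by (simp_all add: S_def left_diff_distrib right_diff_distrib mult.assoc)
  then have "S * (?A * ?B) = (?A * ?B) * S" by (metis mult.assoc)
  then have "S * T = T * S"
    by (simp add: T_def mult_scaleC_left mult_scaleC_right left_diff_distrib right_diff_distrib)
  then have "(S + T) * (- (S - T)) = (- (S - T)) * (S + T)" by (simp add: algebra_simps)
  moreover have "spectrum (S + T) \<subseteq> \<real>" using quad[of "\<i>"] unfolding P by simp
  moreover have "spectrum (- (S - T)) \<subseteq> \<real>" using neg[OF quad[of "- \<i>"]] unfolding Q by simp
  ultimately have "spectrum (?P + (- ?Q)) \<subseteq> \<real>"
    unfolding P Q by (rule real_spectrum_add_commuting)
  moreover have "?P + (- ?Q) = (4 * \<i>) *\<^sub>C ?n"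
    unfolding P Q by (simp add: T_def scaleC_add_left[symmetric])
  ultimately have imag: "spectrum ((4 * \<i>) *\<^sub>C ?n) \<subseteq> \<real>" by simp
  have "spectrum ((?A + ?B) * (?A + ?B)) \<subseteq> \<real>" "spectrum ((?A - ?B) * (?A - ?B)) \<subseteq> \<real>"
    by (intro sqreal, metis D_add D_diff spectrum_D real star_add star_diff k y)+
  moreover have "(?A + ?B) * (?A + ?B) * - ((?A - ?B) * (?A - ?B)) = - ((?A - ?B) * (?A - ?B)) * ((?A + ?B) * (?A + ?B))"
  proof -
    have "(?A + ?B) * (?A - ?B) = (?A - ?B) * (?A + ?B)" by (simp add: algebra_simps comm)
    then show ?thesis by (simp only: mult_minus_left mult_minus_right squares_commute)
  qed
  ultimately have "spectrum ((?A + ?B) * (?A + ?B) + - ((?A - ?B) * (?A - ?B))) \<subseteq> \<real>"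
    by (intro real_spectrum_add_commuting neg)
  moreover have "(?A + ?B) * (?A + ?B) + - ((?A - ?B) * (?A - ?B)) = 4 *\<^sub>C (?A * ?B)"
  proof -
    have "(?A + ?B) * (?A + ?B) + - ((?A - ?B) * (?A - ?B)) = ?A * ?B + ?A * ?B + (?A * ?B + ?A * ?B)"
      by (simp add: algebra_simps comm)
    also have "\<dots> = (1 + 1 + (1 + 1)) *\<^sub>C (?A * ?B)" by (simp only: scaleC_add_left scaleC_one)
    finally show ?thesis by simp
  qed
  ultimately have re: "spectrum (4 *\<^sub>C (?A * ?B)) \<subseteq> \<real>" by simp
  have "d = 0" if d: "d \<in> spectrum ?n" for d
  proof -
    have "4 * \<i> * d \<in> spectrum ((4 * \<i>) *\<^sub>C ?n)" using d by (intro spectrum_scaleC_mem) auto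
    then have "Re d = 0" using imag by (auto simp: complex_is_Real_iff)
    moreover have "d \<in> spectrum (?A * ?B + (- 1) *\<^sub>C 1)" using d by (simp add: scaleC_simps)
    then have "4 * (d + 1) \<in> spectrum (4 *\<^sub>C (?A * ?B))"
      by (intro spectrum_scaleC_mem) (simp_all add: spectrum_shift)
    then have "Im d = 0" using re by (auto simp: complex_is_Real_iff)
    ultimately show ?thesis by (simp add: complex_eq_iff)
  qed
  then have "spectrum ?n = {0}" using spectrum_nonempty[of ?n] by blast
  then have n: "specrad ?n = 0" by (simp add: specrad_eq_0_iff)
  have "?n = 0"
  proof (rule quasinilpotent_in_commutant_eq_0[OF k n])
    fix z assume z: "z * k = k * z"
    have "?A * \<psi> z = \<psi> z * ?A" by (rule D_commute_psi) (simp add: z)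
    moreover have "?B * \<psi> z = \<psi> z * ?B" by (intro D_commute_psi ainv_commute inv) (simp add: z)
    ultimately show "?n * \<psi> z = \<psi> z * ?n"
      by (simp add: left_diff_distrib right_diff_distrib) (metis mult.assoc)
  qed
  then show ?thesis by simp
qed

lemma D_square_if_invertible:
  assumes k: "star k = k" and inv: "k \<in> invertibles" "1 - k \<in> invertibles"
  shows "D (k * k) = D k * D k"
proof -
  have k': "star (1 - k) = 1 - k" by (simp add: star_diff k)
  define w where "w = ainv k + ainv (1 - k)"
  have w: "w \<in> invertibles" "ainv w = k - k * k"
    using hua_identity[OF inv] by (auto simp: w_def intro: invertiblesI ainv_unique)
  have sw: "star w = w" by (simp add: w_def star_add star_ainv inv k k')
  have "D w * D (k - k * k) = 1" using D_ainv_selfadjoint[OF sw w(1)] by (simp add: w)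
  moreover have "D w = D (ainv k) + D (ainv (1 - k))" by (simp add: w_def D_add)
  moreover have "(D k - D k * D k) * (D (ainv k) + D (ainv (1 - k))) = 1"
  proof -
    have "D k - D k * D k = (1 - D k) * D k" "D k - D k * D k = D k * (1 - D k)"
      by (simp_all add: algebra_simps)
    moreover have "D k * D (ainv k) = 1" "(1 - D k) * D (ainv (1 - k)) = 1"
      using D_ainv_selfadjoint[OF k inv(1)] D_ainv_selfadjoint[OF k' inv(2)] by (simp_all add: D_diff D_one)
    ultimately have "(D k - D k * D k) * D (ainv k) = 1 - D k" "(D k - D k * D k) * D (ainv (1 - k)) = D k"
      by (metis mult.assoc mult_1_right)+
    then show ?thesis by (simp only: distrib_left) simp
  qed
  ultimately have "D (k - k * k) = D k - D k * D k" by (metis mult.assoc mult_1_left mult_1_right)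
  then show ?thesis by (simp add: D_diff)
qed

text \<open>
  The claim for \<open>k = 1/2 + \<epsilon> h\<close> is equivalent to the claim for \<open>h\<close>, and for small \<open>\<epsilon>\<close> both \<open>k\<close> and \<open>1 - k\<close>
  are invertible.
\<close>

lemma D_square_selfadjoint:
  assumes h: "star h = h"
  shows "D (h * h) = D h * D h"
proof -
  define \<epsilon> where "\<epsilon> = 1 / (4 * (norm h + 1))"
  have \<epsilon>: "\<epsilon> > 0" by (simp add: \<epsilon>_def add_nonneg_pos)
  have "norm h + 1 > 0" by (simp add: add_nonneg_pos)
  then have "2 * \<epsilon> * norm h < 1" by (simp add: \<epsilon>_def pos_divide_less_eq)
  then have small: "norm ((2 * \<epsilon>) *\<^sub>R h) < 1" using \<epsilon> by simp
  define k where "k = (1/2) *\<^sub>R 1 + \<epsilon> *\<^sub>R h"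
  have half: "r \<noteq> 0 \<Longrightarrow> r *\<^sub>R x \<in> invertibles \<longleftrightarrow> x \<in> invertibles" for r and x :: 'a
    by (simp add: scaleR_scaleC scaleC_invertibles)
  have "1 - (1/2) *\<^sub>R 1 = (1/2) *\<^sub>R (1::'a)"
    using scaleR_left_diff_distrib[of 1 "1/2" "1::'a"] by simp
  then have "k = (1/2) *\<^sub>R (1 - (- ((2 * \<epsilon>) *\<^sub>R h)))" "1 - k = (1/2) *\<^sub>R (1 - (2 * \<epsilon>) *\<^sub>R h)"
    by (simp_all add: k_def scaleR_right_distrib scaleR_right_diff_distrib diff_diff_eq[symmetric])
  then have inv: "k \<in> invertibles" "1 - k \<in> invertibles"
    using one_minus_invertible[of "- ((2 * \<epsilon>) *\<^sub>R h)"] one_minus_invertible[of "(2 * \<epsilon>) *\<^sub>R h"] small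
    by (simp_all add: half)
  have sk: "star k = k" by (simp add: k_def star_add scaleR_scaleC star_scaleC h)
  have sq: "((1/2) *\<^sub>R 1 + \<epsilon> *\<^sub>R x) * ((1/2) *\<^sub>R 1 + \<epsilon> *\<^sub>R x) = (1/4) *\<^sub>R 1 + \<epsilon> *\<^sub>R x + (\<epsilon> * \<epsilon>) *\<^sub>R (x * x)"
    for x :: "'c::unital_banach"
  proof -
    have "((1/2) *\<^sub>R 1 + \<epsilon> *\<^sub>R x) * ((1/2) *\<^sub>R 1 + \<epsilon> *\<^sub>R x)
        = (1/4) *\<^sub>R 1 + ((\<epsilon>/2) *\<^sub>R x + (\<epsilon>/2) *\<^sub>R x) + (\<epsilon> * \<epsilon>) *\<^sub>R (x * x)"
      by (simp add: distrib_left distrib_right scaleR_right_distrib mult.commute)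
    also have "(\<epsilon>/2) *\<^sub>R x + (\<epsilon>/2) *\<^sub>R x = \<epsilon> *\<^sub>R x" by (simp add: scaleR_add_left[symmetric])
    finally show ?thesis .
  qed
  have "D (k * k) = (1/4) *\<^sub>R 1 + \<epsilon> *\<^sub>R D h + (\<epsilon> * \<epsilon>) *\<^sub>R D (h * h)"
    by (simp only: k_def sq D_add D_scaleR D_one)
  moreover have "D k * D k = (1/4) *\<^sub>R 1 + \<epsilon> *\<^sub>R D h + (\<epsilon> * \<epsilon>) *\<^sub>R (D h * D h)"
    by (simp only: k_def sq D_add D_scaleR D_one)
  ultimately show ?thesis using D_square_if_invertible[OF sk inv] \<epsilon> by simp
qed

lemma D_square: "D (a * a) = D a * D a"
proof -
  obtain h k where hk: "star h = h" "star k = k" "a = h + \<i> *\<^sub>C k" by (rule selfadjoint_decomposition)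
  have "D ((h + k) * (h + k)) = D (h + k) * D (h + k)" by (rule D_square_selfadjoint) (simp add: star_add hk)
  then have mixed: "D (h * k) + D (k * h) = D h * D k + D k * D h"
    by (simp add: distrib_left distrib_right D_add D_square_selfadjoint hk add.commute)
  have sq: "(x + \<i> *\<^sub>C y) * (x + \<i> *\<^sub>C y) = x * x - y * y + \<i> *\<^sub>C (x * y + y * x)" for x y :: "'c::unital_banach"
    by (simp add: distrib_left distrib_right mult_scaleC_left mult_scaleC_right scaleC_simps)
  show ?thesis
    by (simp only: hk(3) sq D_add D_diff D_scaleC D_square_selfadjoint[OF hk(1)] D_square_selfadjoint[OF hk(2)] mixed)
qed

lemma D_power: "D (a ^ n) = D a ^ n"
proof (induction n)
  case 0
  then show ?case by (simp add: D_one)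
next
  case (Suc n)
  have "D ((a + a ^ n) * (a + a ^ n)) = D (a + a ^ n) * D (a + a ^ n)" by (rule D_square)
  then have "D (a * a ^ n) + D (a ^ n * a) = D a * D (a ^ n) + D (a ^ n) * D a"
    by (simp add: distrib_left distrib_right D_add D_square add.commute)
  then have "2 *\<^sub>R D (a ^ Suc n) = 2 *\<^sub>R (D a ^ Suc n)" by (simp add: Suc power_commutes scaleR_2)
  then show ?case by simp
qed

lemma D_exp: "D (exp a) = exp (D a)"
proof -
  have "(\<lambda>n. D (a ^ n /\<^sub>R fact n)) sums D (exp a)"
    by (rule bounded_linear.sums[OF bounded_linear_D exp_converges])
  then have "(\<lambda>n. D a ^ n /\<^sub>R fact n) sums D (exp a)" by (simp only: D_scaleR D_power)
  then show ?thesis using exp_converges sums_unique2 by blast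
qed

lemma psi_eq_D_near_one:
  assumes "specrad (x - 1) < 1"
  shows "\<psi> x = D x"
proof -
  have "1 + s *\<^sub>R (x - 1) \<in> invertibles" if s: "0 \<le> s" "s \<le> 1" for s
  proof -
    have "specrad (complex_of_real (- s) *\<^sub>C (x - 1)) \<le> s * specrad (x - 1)"
      using specrad_scaleC_le[of "complex_of_real (- s)" "x - 1"] s by simp
    also have "\<dots> \<le> 1 * specrad (x - 1)" using s by (intro mult_right_mono specrad_nonneg)
    finally have "1 - complex_of_real (- s) *\<^sub>C (x - 1) \<in> invertibles"
      using assms by (intro specrad_less_one_invertible) simp
    then show ?thesis by (simp add: scaleR_scaleC scaleC_minus_left)
  qed
  then obtain q where "exp q = 1 + (x - 1)" using exists_logarithm by blast
  then show ?thesis using psi_exp D_exp by (metis add.commute diff_add_cancel)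
qed

text \<open>
  For small \<open>a\<close> and \<open>b\<close> the maps \<open>D\<close> and \<open>\<psi>\<close> agree at \<open>1 + a\<close>, \<open>1 + b\<close> and \<open>(1 + a) (1 + b)\<close>. Comparing the two
  sides of \<open>\<psi>((1 + a) (1 + b)) = \<psi>(1 + a) \<psi>(1 + b)\<close> leaves the claim, which is homogeneous in \<open>a\<close> and \<open>b\<close>.
\<close>

lemma D_mult: "D (a * b) = D a * D b"
proof -
  have small: "D (a * b) = D a * D b" if "norm a \<le> 1/4" "norm b \<le> 1/4" for a b
  proof -
    have near: "\<psi> (1 + x) = 1 + D x" if "norm x < 1" for x
      using psi_eq_D_near_one[of "1 + x"] specrad_le_norm[of x] that by (simp add: D_add D_one)
    have "norm (a * b) \<le> 1/4 * (1/4)"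
      by (rule order_trans[OF norm_mult_ineq]) (use that in \<open>intro mult_mono, auto\<close>)
    then have "norm (a + b + a * b) < 1"
      using that norm_triangle_ineq[of "a + b" "a * b"] norm_triangle_ineq[of a b] by linarith
    then have "\<psi> (1 + (a + b + a * b)) = 1 + D (a + b + a * b)" by (rule near)
    moreover have "1 + (a + b + a * b) = (1 + a) * (1 + b)" by (simp add: algebra_simps)
    moreover have "\<psi> (1 + a) = 1 + D a" "\<psi> (1 + b) = 1 + D b" using that by (auto intro: near)
    ultimately have "1 + D (a + b + a * b) = (1 + D a) * (1 + D b)" by (metis mult)
    then show ?thesis by (simp add: D_add algebra_simps)
  qed
  have scale: "\<exists>r>0. norm (r *\<^sub>R x) \<le> 1/4" for x :: 'a
    by (intro exI[of _ "1 / (4 * (norm x + 1))"]) (auto simp: add_nonneg_pos divide_le_eq)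
  obtain r s where rs: "r > 0" "norm (r *\<^sub>R a) \<le> 1/4" "s > 0" "norm (s *\<^sub>R b) \<le> 1/4" using scale by meson
  from small[OF rs(2,4)] have "(s * r) *\<^sub>R D (a * b) = (s * r) *\<^sub>R (D a * D b)"
    by (simp add: D_scaleR mult.commute)
  then show ?thesis using rs by simp
qed

text \<open>
  For small \<open>b\<close> the preimage \<open>x\<close> of \<open>1 + b\<close> under \<open>\<psi>\<close> satisfies \<open>r(x - 1) = r(b) < 1\<close>, because \<open>\<psi>\<close> preserves
  spectra. This is why \<open>psi_eq_D_near_one\<close> is stated for a ball of the spectral radius and not of the norm:
  nothing is known about the norm of \<open>x - 1\<close>.
\<close>

lemma surj_D: "surj D"
proof -
  have small: "\<exists>a. D a = b" if "norm b \<le> 1/2" for b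
  proof -
    obtain x where x: "\<psi> x = 1 + b" using surj by (metis surjD)
    have "spectrum (x + (- 1) *\<^sub>C 1) = spectrum (\<psi> x + (- 1) *\<^sub>C 1)" by (auto simp: spectrum_shift spec)
    then have "specrad (x - 1) = specrad b" by (simp add: specrad_def scaleC_simps x)
    then have "specrad (x - 1) < 1" using specrad_le_norm[of b] that by simp
    then have "1 + b = D x" using psi_eq_D_near_one x by simp
    then have "D (x - 1) = b" by (simp add: D_diff D_one algebra_simps)
    then show ?thesis by blast
  qed
  have "\<exists>a. D a = b" for b
  proof -
    define r where "r = 1 / (2 * (norm b + 1))"
    have r: "r > 0" "norm (r *\<^sub>R b) \<le> 1/2" by (auto simp: r_def add_nonneg_pos divide_le_eq)
    then obtain a where "D a = r *\<^sub>R b" using small by blast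
    then have "D ((1/r) *\<^sub>R a) = b" using r by (simp add: D_scaleR)
    then show ?thesis by blast
  qed
  then show ?thesis by (metis surjI)
qed

text \<open>
  \<open>norm (a\<^sup>* a) = r(a\<^sup>* a) = r(D(a\<^sup>*) D(a))\<close>.
\<close>

lemma D_eq_0_imp: "D a = 0 \<Longrightarrow> a = 0"
proof -
  assume "D a = 0"
  then have "spectrum (star a * a) = spectrum (0::'b)" by (metis D_mult mult_zero_right spectrum_D)
  then have "specrad (star a * a) = specrad (0::'b)" by (simp add: specrad_def)
  then have "specrad (star a * a) = 0" using specrad_le_norm[of "0::'b"] specrad_nonneg[of "0::'b"] by simp
  then have "star a * a = 0" using specrad_selfadjoint[of "star a * a"] by (simp add: star_mult star_star)
  then show "a = 0" by (simp add: star_mult_self_eq_0_iff)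
qed

lemma algebra_isomorphism_D: "algebra_isomorphism D"
proof -
  have "inj D"
  proof (rule injI)
    fix x y assume "D x = D y"
    then have "D (x - y) = 0" by (simp add: D_diff)
    then show "x = y" using D_eq_0_imp by fastforce
  qed
  then show ?thesis
    by (simp add: algebra_isomorphism_def bij_def surj_D D_add D_scaleC D_mult)
qed

end

section \<open>The closed graph theorem\<close>

text \<open>
  By Baire's theorem the closure of some set \<open>{x. norm (f x) \<le> n}\<close> contains a ball, and by translation a ball
  around \<open>0\<close> for the constant \<open>M\<close>. A point \<open>x\<close> of this ball is therefore a sum of elements \<open>z\<^sub>k\<close> with
  \<open>norm (f z\<^sub>k) \<le> M / 2\<^sup>k\<close>. The series of the \<open>f z\<^sub>k\<close> converges, and closedness of the graph identifies its sum
  with \<open>f x\<close>.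
\<close>

lemma closed_graph_theorem:
  fixes f :: "'a::banach \<Rightarrow> 'b::banach"
  assumes lin: "linear f"
    and closed: "\<And>X y. X \<longlonglongrightarrow> 0 \<Longrightarrow> (\<lambda>n. f (X n)) \<longlonglongrightarrow> y \<Longrightarrow> y = 0"
  shows "bounded_linear f"
proof -
  note f_simps = linear_add[OF lin] linear_diff[OF lin] linear_scale[OF lin] linear_0[OF lin] linear_sum[OF lin]
  define C where "C = (\<lambda>n. closure {x. norm (f x) \<le> real n})"
  have "\<exists>n. interior (C n) \<noteq> {}"
  proof (rule ccontr)
    assume no: "\<not> ?thesis"
    have "euclidean interior_of \<Union>(range C) = {}"
    proof (rule Baire_category_alt)
      show "completely_metrizable_space (euclidean::'a topology) \<or>
          locally_compact_space (euclidean::'a topology) \<and> regular_space (euclidean::'a topology)"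
        by (simp add: completely_metrizable_space_euclidean)
      show "closedin euclidean T \<and> euclidean interior_of T = {}" if "T \<in> range C" for T
        using that no by (auto simp: C_def interior_of_def interior_def)
    qed auto
    moreover have "x \<in> C (nat \<lceil>norm (f x)\<rceil>)" for x
    proof -
      have "norm (f x) \<le> real (nat \<lceil>norm (f x)\<rceil>)" by linarith
      then show ?thesis unfolding C_def by (intro subsetD[OF closure_subset]) simp
    qed
    then have "\<Union>(range C) = UNIV" by blast
    ultimately show False by (simp only: interior_of_topspace[of euclidean, unfolded topspace_euclidean] UNIV_not_empty)
  qed
  then obtain n x0 where "x0 \<in> interior (C n)" by blast
  then obtain e where e: "e > 0" "ball x0 e \<subseteq> C n" by (meson mem_interior)
  define M where "M = 2 * real n + 1"
  have M: "M > 0" by (simp add: M_def)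
  have near: "\<exists>z. norm (f z) \<le> M * r \<and> norm (x - z) < e * r / 2" if r: "r > 0" and x: "norm x < e * r" for x r
  proof -
    let ?y = "(1/r) *\<^sub>R x"
    have "norm ?y < e" using r x by (simp add: divide_less_eq)
    then have "x0 + ?y \<in> ball x0 e" "x0 \<in> ball x0 e" using e(1) by (auto simp: dist_norm)
    then have "x0 + ?y \<in> C n" "x0 \<in> C n" using e(2) by auto
    then obtain u v where uv: "norm (f u) \<le> real n" "dist u (x0 + ?y) < e / 4"
      "norm (f v) \<le> real n" "dist v x0 < e / 4"
      using e(1) unfolding C_def closure_approachable by (metis (mono_tags, lifting) mem_Collect_eq zero_less_divide_iff zero_less_numeral)
    let ?z = "r *\<^sub>R (u - v)"
    have "norm (f ?z) \<le> r * (norm (f u) + norm (f v))"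
      using r norm_triangle_ineq4[of "f u" "f v"] by (simp add: f_simps)
    also have "\<dots> \<le> M * r" using uv r by (simp add: M_def mult.commute)
    finally have 1: "norm (f ?z) \<le> M * r" .
    have "x - ?z = r *\<^sub>R ((x0 + ?y - u) + (v - x0))" using r by (simp add: algebra_simps)
    then have "norm (x - ?z) \<le> r * (norm (x0 + ?y - u) + norm (v - x0))"
      using r norm_triangle_ineq[of "x0 + ?y - u" "v - x0"] by simp
    also have "\<dots> < r * (e / 4 + e / 4)"
      using uv r by (intro mult_strict_left_mono add_strict_mono) (auto simp: dist_norm norm_minus_commute)
    finally have "norm (x - ?z) < e * r / 2" by (simp add: mult.commute)
    with 1 show ?thesis by blast
  qed
  define Z where "Z = (\<lambda>x r. SOME z. norm (f z) \<le> M * r \<and> norm (x - z) < e * r / 2)"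
  have Z: "norm (f (Z x r)) \<le> M * r \<and> norm (x - Z x r) < e * r / 2" if "r > 0" "norm x < e * r" for x r
    unfolding Z_def using near[OF that] by (rule someI_ex)
  have bd: "norm (f x) \<le> 2 * M" if x: "norm x < e" for x
  proof -
    define s where "s = rec_nat 0 (\<lambda>k s. s + Z (x - s) ((1/2) ^ k))"
    have s0: "s 0 = 0" and sS: "s (Suc k) = s k + Z (x - s k) ((1/2) ^ k)" for k by (simp_all add: s_def)
    have rem: "norm (x - s k) < e * (1/2) ^ k" for k
    proof (induction k)
      case (Suc k)
      have "x - s (Suc k) = x - s k - Z (x - s k) ((1/2) ^ k)" by (simp add: sS)
      then show ?case using Z[of "(1/2) ^ k" "x - s k"] Suc by (simp only:) simp
    qed (simp add: s0 x)
    define g where "g = (\<lambda>k. f (Z (x - s k) ((1/2) ^ k)))"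
    have g: "norm (g k) \<le> M * (1/2) ^ k" for k
      unfolding g_def using Z[of "(1/2) ^ k" "x - s k"] rem by simp
    have fs: "f (s k) = sum g {..<k}" for k
      by (induction k) (simp_all add: s0 sS f_simps g_def)
    have geo: "(\<lambda>k. M * (1/2) ^ k) sums (M * 2)"
      using sums_mult[OF geometric_sums[of "1/2::real"], of M] by simp
    have sm: "summable (\<lambda>k. norm (g k))"
      by (rule summable_comparison_test'[OF sums_summable[OF geo], of 0]) (use g in simp)
    have lim: "(\<lambda>k. f (s k)) \<longlonglongrightarrow> suminf g"
      unfolding fs using summable_LIMSEQ[OF summable_norm_cancel[OF sm]] .
    have "norm (suminf g) \<le> (\<Sum>k. norm (g k))" by (rule summable_norm[OF sm])
    also have "\<dots> \<le> M * 2"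
      using suminf_le[OF g sm sums_summable[OF geo]] sums_unique[OF geo] by simp
    finally have le: "norm (suminf g) \<le> M * 2" .
    have "(\<lambda>k. e * (1/2) ^ k) \<longlonglongrightarrow> e * 0" by (intro tendsto_mult tendsto_const LIMSEQ_power_zero) simp
    then have "(\<lambda>k. x - s k) \<longlonglongrightarrow> 0"
      using rem by (intro Lim_null_comparison[of "\<lambda>k. x - s k" "\<lambda>k. e * (1/2) ^ k"] always_eventually)
        (simp_all add: less_imp_le)
    moreover have "(\<lambda>k. f (x - s k)) \<longlonglongrightarrow> f x - suminf g"
      unfolding f_simps by (intro tendsto_intros lim)
    ultimately have "f x - suminf g = 0" by (rule closed)
    then show ?thesis using le by simp
  qed
  have "norm (f x) \<le> norm x * (4 * M / e)" for x
  proof (cases "x = 0")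
    case False
    let ?r = "e / (2 * norm x)"
    have "norm (?r *\<^sub>R x) < e" using False e(1) by simp
    from bd[OF this] have "?r * norm (f x) \<le> 2 * M" using e(1) by (simp add: f_simps)
    then show ?thesis using False e(1) by (simp add: field_simps)
  qed (simp add: f_simps)
  then show ?thesis
    by (intro bounded_linear_intro[of f "4 * M / e"]) (simp_all add: f_simps)
qed

section \<open>A three circles inequality for the spectral radius\<close>

text \<open>
  At each point some power \<open>m\<close> works, and then it works in a neighbourhood. Multiples of \<open>m\<close> work as well, so
  the product of the finitely many exponents of a subcover serves all points.
\<close>

lemma uniform_power_bound_on_compact:
  fixes p :: "'c::topological_space \<Rightarrow> 'a::unital_banach"
  assumes K: "compact K" and p: "continuous_on K p"
    and less: "\<And>z. z \<in> K \<Longrightarrow> specrad (p z) < \<alpha>" and \<alpha>: "\<alpha> > 0"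
  shows "\<exists>N\<ge>1. \<forall>z\<in>K. norm (p z ^ N) \<le> \<alpha> ^ N"
proof -
  define U where "U = (\<lambda>m::nat. K \<inter> (\<lambda>z. norm (p z ^ m)) -` {..<\<alpha> ^ m})"
  have "openin (top_of_set K) (U m)" for m
    unfolding U_def by (intro continuous_openin_preimage_gen continuous_intros p)
  moreover have "K \<subseteq> (\<Union>m\<in>{1..}. U m)"
  proof
    fix z assume z: "z \<in> K"
    obtain \<rho> where \<rho>: "specrad (p z) < \<rho>" "\<rho> < \<alpha>" using less[OF z] dense by blast
    obtain C where C: "\<And>n. norm (p z ^ n) \<le> C * \<rho> ^ n" using power_bound_if_specrad_less[OF \<rho>(1)] by blast
    have "\<rho> > 0" using \<rho> specrad_nonneg[of "p z"] by linarith
    then have "(\<lambda>n. C * (\<rho> / \<alpha>) ^ n) \<longlonglongrightarrow> C * 0"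
      using \<rho> by (intro tendsto_mult tendsto_const LIMSEQ_power_zero) auto
    then have "\<forall>\<^sub>F n in sequentially. C * (\<rho> / \<alpha>) ^ n < 1" by (intro order_tendstoD) auto
    then obtain m0 where m0: "\<And>n. n \<ge> m0 \<Longrightarrow> C * (\<rho> / \<alpha>) ^ n < 1" by (auto simp: eventually_sequentially)
    let ?m = "Suc m0"
    have "C * \<rho> ^ ?m < \<alpha> ^ ?m" using m0[of ?m] \<alpha> by (simp add: power_divide divide_less_eq)
    then have "norm (p z ^ ?m) < \<alpha> ^ ?m" using C[of ?m] by linarith
    then show "z \<in> (\<Union>m\<in>{1..}. U m)" using z by (auto simp: U_def intro!: bexI[of _ ?m])
  qed
  ultimately obtain \<D> where "\<D> \<subseteq> U ` {1..}" "finite \<D>" "K \<subseteq> \<Union>\<D>"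
    using K[unfolded compact_eq_openin_cover, rule_format, of "U ` {1..}"] by auto
  then obtain F where F: "F \<subseteq> {1..}" "finite F" "K \<subseteq> (\<Union>m\<in>F. U m)"
    by (metis finite_subset_image)
  have "norm (p z ^ (\<Prod>F)) \<le> \<alpha> ^ (\<Prod>F)" if z: "z \<in> K" for z
  proof -
    obtain m where m: "m \<in> F" "norm (p z ^ m) < \<alpha> ^ m" using F(3) z unfolding U_def by blast
    then have "m dvd \<Prod>F" using dvd_prodI[OF F(2), of m "\<lambda>m. m"] by simp
    then obtain j where j: "\<Prod>F = m * j" by (auto elim: dvdE)
    have "norm (p z ^ (\<Prod>F)) \<le> norm (p z ^ m) ^ j" unfolding j power_mult by (rule norm_power_ineq)
    also have "\<dots> \<le> (\<alpha> ^ m) ^ j" using m by (intro power_mono) auto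
    finally show ?thesis by (simp add: j power_mult)
  qed
  moreover have "\<Prod>F \<ge> 1" using F(1) by (intro prod_ge_1) auto
  ultimately show ?thesis by blast
qed

lemma power_of_affine_expansion:
  fixes x y :: "'a::complex_banach_algebra_1"
  shows "\<exists>c. \<forall>z. (z *\<^sub>C x + y) ^ M = (\<Sum>k\<le>M. z ^ k *\<^sub>C c k)"
proof (induction M)
  case 0
  show ?case by (intro exI[of _ "\<lambda>_. 1"]) (simp add: scaleC_one)
next
  case (Suc M)
  then obtain c where c: "\<And>z. (z *\<^sub>C x + y) ^ M = (\<Sum>k\<le>M. z ^ k *\<^sub>C c k)" by blast
  define d where "d = (\<lambda>k. (if k = 0 then 0 else c (k - 1) * x) + (if k \<le> M then c k * y else 0))"
  have "(z *\<^sub>C x + y) ^ Suc M = (\<Sum>k\<le>Suc M. z ^ k *\<^sub>C d k)" for z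
  proof -
    have "(\<Sum>k\<le>Suc M. z ^ k *\<^sub>C d k) = (\<Sum>k\<le>Suc M. z ^ k *\<^sub>C (if k = 0 then 0 else c (k - 1) * x))
        + (\<Sum>k\<le>Suc M. z ^ k *\<^sub>C (if k \<le> M then c k * y else 0))"
      unfolding d_def scaleC_add_right by (rule sum.distrib)
    also have "(\<Sum>k\<le>Suc M. z ^ k *\<^sub>C (if k = 0 then 0 else c (k - 1) * x)) = (\<Sum>k\<le>M. z ^ Suc k *\<^sub>C (c k * x))"
      by (simp only: sum.atMost_Suc_shift scaleC_zero_right simp_thms if_True if_False nat.distinct diff_Suc_1 add_0_left)
    also have "(\<Sum>k\<le>Suc M. z ^ k *\<^sub>C (if k \<le> M then c k * y else 0)) = (\<Sum>k\<le>M. z ^ k *\<^sub>C (c k * y))"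
      by simp
    also have "(\<Sum>k\<le>M. z ^ Suc k *\<^sub>C (c k * x)) + (\<Sum>k\<le>M. z ^ k *\<^sub>C (c k * y)) = (z *\<^sub>C x + y) ^ M * (z *\<^sub>C x + y)"
      by (simp add: c sum_distrib_right distrib_left sum.distrib mult_scaleC_left mult_scaleC_right
          scaleC_scaleC scaleC_sum_right)
    finally show ?thesis by (simp only: power_Suc2)
  qed
  then show ?case by blast
qed

text \<open>
  The coefficient \<open>c\<^sub>k\<close> is recovered by averaging over the roots of unity of order \<open>M + 1\<close>; the weight
  \<open>\<omega>\<^sup>j\<^sup>(\<^sup>n\<^sup>-\<^sup>k\<^sup>)\<close> with \<open>n = M + 1\<close> stands for \<open>\<omega>\<^sup>-\<^sup>j\<^sup>k\<close> and avoids negative exponents.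
\<close>

lemma cauchy_estimate:
  fixes c :: "nat \<Rightarrow> 'a::complex_banach_algebra_1"
  assumes bd: "\<And>z. cmod z = R \<Longrightarrow> norm (\<Sum>k\<le>M. z ^ k *\<^sub>C c k) \<le> B" and R: "R > 0" and k: "k \<le> M"
  shows "norm (c k) * R ^ k \<le> B"
proof -
  let ?n = "Suc M"
  obtain \<omega> :: complex where \<omega>: "\<omega> ^ ?n = 1" "\<And>k. 0 < k \<Longrightarrow> k < ?n \<Longrightarrow> \<omega> ^ k \<noteq> 1" "cmod \<omega> = 1"
    using primitive_root_of_unity[of ?n] by blast
  let ?z = "\<lambda>j. of_real R * \<omega> ^ j"
  let ?P = "\<lambda>z. \<Sum>k\<le>M. z ^ k *\<^sub>C c k"
  have orth: "(\<Sum>j<?n. (\<omega> ^ (?n - k + l)) ^ j) = (if l = k then of_nat ?n else 0)" if l: "l \<le> M" for l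
  proof (cases "l = k")
    case True
    then have "?n - k + l = ?n" using k by simp
    then show ?thesis using True by (simp only: \<omega>(1)) simp
  next
    case False
    have "\<omega> ^ (?n - k + l) \<noteq> 1"
    proof (cases "l < k")
      case True
      then show ?thesis using k by (intro \<omega>(2)) auto
    next
      case ge: False
      have "?n - k + l = ?n + (l - k)" using ge k by simp
      then have "\<omega> ^ (?n - k + l) = \<omega> ^ (l - k)" by (simp only: power_add \<omega>(1) mult_1_left)
      moreover have "\<omega> ^ (l - k) \<noteq> 1" using ge False l by (intro \<omega>(2)) auto
      ultimately show ?thesis by simp
    qed
    then show ?thesis using sum_powers_root_of_unity[OF \<omega>(1)] False by simp
  qed
  have "(\<Sum>j<?n. (\<omega> ^ (?n - k)) ^ j *\<^sub>C ?P (?z j))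
      = (\<Sum>j<?n. \<Sum>l\<le>M. (of_real R ^ l * (\<omega> ^ (?n - k + l)) ^ j) *\<^sub>C c l)"
  proof (intro sum.cong refl)
    fix j
    have "(\<omega> ^ (?n - k)) ^ j * ?z j ^ l = of_real R ^ l * (\<omega> ^ (?n - k + l)) ^ j" for l
      by (simp add: power_mult_distrib power_add mult_ac flip: power_mult)
    then show "(\<omega> ^ (?n - k)) ^ j *\<^sub>C ?P (?z j) = (\<Sum>l\<le>M. (of_real R ^ l * (\<omega> ^ (?n - k + l)) ^ j) *\<^sub>C c l)"
      by (simp only: scaleC_sum_right scaleC_scaleC)
  qed
  also have "\<dots> = (\<Sum>l\<le>M. \<Sum>j<?n. (of_real R ^ l * (\<omega> ^ (?n - k + l)) ^ j) *\<^sub>C c l)" by (rule sum.swap)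
  also have "\<dots> = (\<Sum>l\<le>M. (of_real R ^ l * (\<Sum>j<?n. (\<omega> ^ (?n - k + l)) ^ j)) *\<^sub>C c l)"
    by (simp only: scaleC_sum_left[symmetric] sum_distrib_left[symmetric])
  also have "\<dots> = (\<Sum>l\<le>M. if l = k then (of_real R ^ k * of_nat ?n) *\<^sub>C c k else 0)"
    by (intro sum.cong refl) (simp only: orth atMost_iff, simp)
  also have "\<dots> = (of_real R ^ k * of_nat ?n) *\<^sub>C c k" using k by (simp add: sum.delta)
  finally have eq: "(\<Sum>j<?n. (\<omega> ^ (?n - k)) ^ j *\<^sub>C ?P (?z j)) = (of_real R ^ k * of_nat ?n) *\<^sub>C c k" .
  have "real ?n * (norm (c k) * R ^ k) = norm ((of_real R ^ k * of_nat ?n) *\<^sub>C c k)"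
    using R by (simp only: norm_scaleC norm_mult norm_power norm_of_nat norm_of_real) simp
  also have "\<dots> \<le> (\<Sum>j<?n. norm ((\<omega> ^ (?n - k)) ^ j *\<^sub>C ?P (?z j)))" unfolding eq[symmetric] by (rule norm_sum)
  also have "\<dots> \<le> (\<Sum>j<?n. B)"
  proof (rule sum_mono)
    fix j
    have "cmod (?z j) = R" using R by (simp add: norm_mult norm_power \<omega>)
    from bd[OF this] show "norm ((\<omega> ^ (?n - k)) ^ j *\<^sub>C ?P (?z j)) \<le> B"
      by (simp only: norm_scaleC norm_power \<omega> power_one mult_1_left)
  qed
  also have "\<dots> = real ?n * B" by simp
  finally show ?thesis by (simp del: of_nat_Suc)
qed

text \<open>
  For suitable large \<open>M\<close> the polynomial \<open>(z x + y)\<^sup>M\<close> is bounded by \<open>\<alpha>\<^sup>M\<close> and \<open>\<beta>\<^sup>M\<close> on the two circles. Each of its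
  \<open>M + 1\<close> coefficients satisfies both Cauchy estimates; their product eliminates \<open>R\<close> and bounds the
  coefficient by \<open>(\<alpha> \<beta>)\<^sup>M\<^sup>/\<^sup>2\<close>. At \<open>z = 1\<close> this gives \<open>norm ((x + y)\<^sup>M) \<le> (M + 1) (\<alpha> \<beta>)\<^sup>M\<^sup>/\<^sup>2\<close>, and the factor
  \<open>M + 1\<close> disappears on taking roots.
\<close>

lemma three_circles_specrad:
  fixes x y :: "'a::unital_banach"
  assumes R: "R > 0" and pos: "\<alpha> > 0" "\<beta> > 0"
    and \<alpha>: "\<And>z. cmod z = R \<Longrightarrow> specrad (z *\<^sub>C x + y) < \<alpha>"
    and \<beta>: "\<And>z. cmod z = 1 / R \<Longrightarrow> specrad (z *\<^sub>C x + y) < \<beta>"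
  shows "(specrad (x + y))\<^sup>2 \<le> \<alpha> * \<beta>"
proof -
  define g where "g = sqrt (\<alpha> * \<beta>)"
  have g: "g > 0" "g * g = \<alpha> * \<beta>" using pos by (simp_all add: g_def)
  have uniform: "\<exists>N\<ge>1. \<forall>z. cmod z = r \<longrightarrow> norm ((z *\<^sub>C x + y) ^ N) \<le> \<gamma> ^ N"
    if "\<And>z. cmod z = r \<Longrightarrow> specrad (z *\<^sub>C x + y) < \<gamma>" "\<gamma> > 0" for r \<gamma>
  proof -
    have "continuous_on (sphere 0 r) (\<lambda>z. z *\<^sub>C x + y)" by (intro continuous_intros)
    from uniform_power_bound_on_compact[OF _ this _ that(2)] that(1) show ?thesis by auto
  qed
  obtain N1 where N1: "N1 \<ge> 1" "\<And>z. cmod z = R \<Longrightarrow> norm ((z *\<^sub>C x + y) ^ N1) \<le> \<alpha> ^ N1"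
    using uniform[OF \<alpha> pos(1)] by blast
  obtain N2 where N2: "N2 \<ge> 1" "\<And>z. cmod z = 1 / R \<Longrightarrow> norm ((z *\<^sub>C x + y) ^ N2) \<le> \<beta> ^ N2"
    using uniform[OF \<beta> pos(2)] by blast
  have mono: "norm (w ^ (m * j)) \<le> \<gamma> ^ (m * j)" if "norm (w ^ m) \<le> \<gamma> ^ m" for w :: 'a and m j \<gamma>
    unfolding power_mult
    by (rule order_trans[OF norm_power_ineq]) (intro power_mono that norm_ge_zero)
  have growth: "cmod d ^ M \<le> (real M + 1) * g ^ M"
    if d: "d \<in> spectrum (x + y)" and M: "M = N1 * N2 * j" for d M j
  proof -
    obtain c where c: "\<And>z. (z *\<^sub>C x + y) ^ M = (\<Sum>k\<le>M. z ^ k *\<^sub>C c k)"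
      using power_of_affine_expansion by blast
    have "norm (c k) \<le> g ^ M" if k: "k \<le> M" for k
    proof -
      have "norm (c k) * R ^ k \<le> \<alpha> ^ M"
      proof (rule cauchy_estimate[OF _ R k])
        fix z assume "cmod z = R"
        then show "norm (\<Sum>k\<le>M. z ^ k *\<^sub>C c k) \<le> \<alpha> ^ M"
          unfolding c[symmetric] using mono[OF N1(2), of z "N2 * j"] by (simp add: M mult.assoc)
      qed
      moreover have "norm (c k) * (1 / R) ^ k \<le> \<beta> ^ M"
      proof (rule cauchy_estimate[OF _ _ k])
        fix z assume "cmod z = 1 / R"
        then show "norm (\<Sum>k\<le>M. z ^ k *\<^sub>C c k) \<le> \<beta> ^ M"
          unfolding c[symmetric] using mono[OF N2(2), of z "N1 * j"] by (simp add: M mult_ac)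
      qed (use R in simp)
      ultimately have "(norm (c k) * R ^ k) * (norm (c k) * (1 / R) ^ k) \<le> \<alpha> ^ M * \<beta> ^ M"
        using R pos by (intro mult_mono) auto
      then have "(norm (c k))\<^sup>2 \<le> (g ^ M)\<^sup>2"
        using R by (simp add: power_divide power2_eq_square power_mult_distrib[symmetric] g(2))
      then show ?thesis using g(1) by (simp add: power2_le_iff_abs_le)
    qed
    then have "(\<Sum>k\<le>M. norm (c k)) \<le> (\<Sum>k\<le>M. g ^ M)" by (intro sum_mono) simp
    moreover have "(x + y) ^ M = (\<Sum>k\<le>M. c k)" using c[of 1] by (simp add: scaleC_one)
    ultimately have "norm ((x + y) ^ M) \<le> (real M + 1) * g ^ M"
      using norm_sum[of c "{..M}"] by (simp add: add.commute)
    moreover have "cmod d ^ M \<le> norm ((x + y) ^ M)"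
      using norm_spectrum_le[OF power_in_spectrum_power[OF d, of M]] by (simp add: norm_power)
    ultimately show ?thesis by linarith
  qed
  have "cmod d \<le> g" if d: "d \<in> spectrum (x + y)" for d
  proof (rule ccontr)
    assume "\<not> cmod d \<le> g"
    then have gt: "g < cmod d" by simp
    let ?q = "g / cmod d"
    have d0: "0 < cmod d" using gt g(1) by linarith
    then have q: "\<bar>?q\<bar> < 1" using gt g(1) by (simp add: pos_divide_less_eq)
    have "(\<lambda>n. real n * ?q ^ n) \<longlonglongrightarrow> 0" "(\<lambda>n. ?q ^ n) \<longlonglongrightarrow> 0"
      using powser_times_n_limit_0[of ?q] LIMSEQ_power_zero[of ?q] q by simp_all
    from tendsto_add[OF this] have lim: "(\<lambda>n. (real n + 1) * ?q ^ n) \<longlonglongrightarrow> 0" by (simp add: algebra_simps)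
    then have "\<forall>\<^sub>F n in sequentially. (real n + 1) * ?q ^ n < 1" by (rule order_tendstoD) simp
    then obtain n0 where n0: "\<And>n. n \<ge> n0 \<Longrightarrow> (real n + 1) * ?q ^ n < 1" by (auto simp: eventually_sequentially)
    let ?M = "N1 * N2 * n0"
    have "?M \<ge> n0" using N1(1) N2(1) by simp
    from n0[OF this] have "(real ?M + 1) * g ^ ?M < cmod d ^ ?M"
      using d0 by (simp add: power_divide pos_divide_less_eq)
    then show False using growth[OF d refl, of n0] by linarith
  qed
  then have "specrad (x + y) \<le> g" by (simp add: specrad_le_iff)
  then have "(specrad (x + y))\<^sup>2 \<le> g\<^sup>2" using specrad_nonneg by (intro power_mono)
  then show ?thesis using g by (simp add: power2_eq_square)
qed

section \<open>Isomorphisms from a C*-algebra onto a Banach algebra\<close>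

lemma algebra_isomorphism_one:
  assumes "algebra_isomorphism f"
  shows "f 1 = 1"
  using assms unfolding algebra_isomorphism_def bij_def by (metis mult_1_left mult_1_right surjD)

lemma algebra_isomorphism_spectrum:
  assumes f: "algebra_isomorphism f"
  shows "spectrum (f x) = spectrum x"
proof -
  have add: "f (a + b) = f a + f b" and sc: "f (c *\<^sub>C a) = c *\<^sub>C f a" and mult: "f (a * b) = f a * f b"
    and inj: "f a = f b \<Longrightarrow> a = b" and surj: "\<exists>a. f a = d" for a b c d
    using f by (auto simp: algebra_isomorphism_def bij_def dest: injD) (metis surjD)
  note one = algebra_isomorphism_one[OF f]
  have inv: "f u \<in> invertibles \<longleftrightarrow> u \<in> invertibles" for u
  proof
    assume u: "u \<in> invertibles"
    show "f u \<in> invertibles"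
      by (rule invertiblesI[of _ "f (ainv u)"]) (simp_all add: mult[symmetric] ainv u one)
  next
    assume fu: "f u \<in> invertibles"
    obtain v where v: "f v = ainv (f u)" using surj by blast
    have "f (u * v) = f 1" "f (v * u) = f 1" by (simp_all add: mult v ainv fu one)
    then show "u \<in> invertibles" by (intro invertiblesI[of _ v] inj)
  qed
  have "f (c *\<^sub>C 1 - x) = c *\<^sub>C 1 - f x" for c
  proof -
    have "c *\<^sub>C 1 - x = c *\<^sub>C 1 + (- 1) *\<^sub>C x" by (simp add: scaleC_minus_left scaleC_one)
    then have "f (c *\<^sub>C 1 - x) = c *\<^sub>C 1 + (- 1) *\<^sub>C f x" by (simp only: add sc one)
    then show ?thesis by (simp add: scaleC_minus_left scaleC_one)
  qed
  then show ?thesis using inv[of "_ *\<^sub>C 1 - x"] by (simp add: spectrum_def)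
qed

text \<open>
  Left multiplication by \<open>w\<^sup>*\<close> replaces the unknown limit \<open>w\<close> by the positive element \<open>h = w\<^sup>* w\<close>, for which
  \<open>r(h) = 0\<close> implies \<open>h = 0\<close>. In \<open>h = a\<^sub>n + (h - a\<^sub>n)\<close> the first summand is small in one norm and the second
  in the other, and the three circles inequality weighs them against each other.
\<close>

theorem algebra_isomorphism_continuous:
  fixes f :: "'a::cstar_algebra \<Rightarrow> 'b::unital_banach"
  assumes f: "algebra_isomorphism f"
  shows "bounded_linear f"
proof (rule closed_graph_theorem)
  have add: "f (a + b) = f a + f b" and sc: "f (c *\<^sub>C a) = c *\<^sub>C f a" and mult: "f (a * b) = f a * f b" for a b c
    using f by (simp_all add: algebra_isomorphism_def)
  show lin: "linear f" by (rule linearI) (simp_all add: add sc scaleR_scaleC)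
  fix X y assume X: "X \<longlonglongrightarrow> 0" and fX: "(\<lambda>n. f (X n)) \<longlonglongrightarrow> y"
  obtain w where w: "y = f w" using f unfolding algebra_isomorphism_def bij_def by (meson surjD)
  define h where "h = star w * w"
  define a where "a = (\<lambda>n. star w * X n)"
  have a: "a \<longlonglongrightarrow> 0" unfolding a_def using tendsto_mult_left[OF X, of "star w"] by simp
  have fa: "(\<lambda>n. f (a n)) \<longlonglongrightarrow> f h"
    unfolding a_def h_def mult using tendsto_mult_left[OF fX, of "f (star w)"] by (simp add: w)
  have bound: "(specrad h)\<^sup>2 \<le> (norm h + 1) * ((norm (f h) + 1) / R)" if R: "R > 0" for R
  proof -
    have "(\<lambda>n. R * norm (a n) + norm (h - a n)) \<longlonglongrightarrow> R * norm (0::'a) + norm (h - 0)"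
      by (intro tendsto_intros a)
    then have 1: "\<forall>\<^sub>F n in sequentially. R * norm (a n) + norm (h - a n) < norm h + 1"
      by (rule order_tendstoD) simp
    have "(\<lambda>n. norm (f (a n)) / R + norm (f h - f (a n))) \<longlonglongrightarrow> norm (f h) / R + norm (f h - f h)"
      using R by (intro tendsto_intros fa) auto
    then have 2: "\<forall>\<^sub>F n in sequentially. norm (f (a n)) / R + norm (f h - f (a n)) < (norm (f h) + 1) / R"
      by (rule order_tendstoD) (use R in \<open>simp add: divide_strict_right_mono\<close>)
    obtain n where n: "R * norm (a n) + norm (h - a n) < norm h + 1"
        "norm (f (a n)) / R + norm (f h - f (a n)) < (norm (f h) + 1) / R"
      using eventually_happens[OF eventually_conj[OF 1 2]] by auto
    have "(specrad (a n + (h - a n)))\<^sup>2 \<le> (norm h + 1) * ((norm (f h) + 1) / R)"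
    proof (rule three_circles_specrad[OF R])
      show "specrad (z *\<^sub>C a n + (h - a n)) < norm h + 1" if "cmod z = R" for z
        using specrad_le_norm[of "z *\<^sub>C a n + (h - a n)"] norm_triangle_ineq[of "z *\<^sub>C a n" "h - a n"] n(1) that
        by (simp add: norm_scaleC)
      show "specrad (z *\<^sub>C a n + (h - a n)) < (norm (f h) + 1) / R" if z: "cmod z = 1 / R" for z
      proof -
        have "specrad (z *\<^sub>C a n + (h - a n)) = specrad (f (z *\<^sub>C a n + (h - a n)))"
          by (simp add: specrad_def algebra_isomorphism_spectrum[OF f])
        also have "f (z *\<^sub>C a n + (h - a n)) = z *\<^sub>C f (a n) + (f h - f (a n))"
          by (simp add: add sc linear_diff[OF lin])
        also have "specrad \<dots> \<le> norm (z *\<^sub>C f (a n)) + norm (f h - f (a n))"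
          by (rule order_trans[OF specrad_le_norm norm_triangle_ineq])
        also have "\<dots> < (norm (f h) + 1) / R" using n(2) z by (simp add: norm_scaleC)
        finally show ?thesis .
      qed
      show "0 < norm h + 1" "0 < (norm (f h) + 1) / R" using R by (simp_all add: add_nonneg_pos)
    qed
    then show ?thesis by simp
  qed
  have "((\<lambda>R. (norm h + 1) * ((norm (f h) + 1) / R)) \<longlongrightarrow> (norm h + 1) * 0) at_top"
    by (intro tendsto_mult[OF tendsto_const] real_tendsto_divide_at_top[OF tendsto_const] filterlim_ident)
  moreover have "\<forall>\<^sub>F R in at_top. (specrad h)\<^sup>2 \<le> (norm h + 1) * ((norm (f h) + 1) / R)"
    using eventually_gt_at_top[of 0] by eventually_elim (rule bound)
  ultimately have "(specrad h)\<^sup>2 \<le> (norm h + 1) * 0"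
    by (rule tendsto_lowerbound) simp
  then have "specrad h = 0" by simp
  then have "h = 0" using specrad_selfadjoint[of h] by (simp add: h_def star_mult star_star)
  then have "w = 0" by (simp add: h_def star_mult_self_eq_0_iff)
  then show "y = 0" using linear_0[OF lin] w by simp
qed

section \<open>Renorming to a unit of norm one\<close>

lemma onorm_mult_le: "onorm ((*) x) \<le> norm (x::'b::complex_banach_algebra_1)"
  by (rule onorm_bound) (simp_all add: norm_mult_ineq)

lemma norm_mult_le_onorm: "norm (x * y) \<le> onorm ((*) x) * norm (y::'b::complex_banach_algebra_1)"
  by (rule onorm[OF bounded_linear_mult_right])

lemma norm_le_onorm: "norm x \<le> norm (1::'b) * onorm ((*) (x::'b::complex_banach_algebra_1))"
  using norm_mult_le_onorm[of x 1] by (simp add: mult.commute)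

lemma onorm_mult_scaleC:
  "onorm ((*) (c *\<^sub>C v)) = cmod c * onorm ((*) (v::'b::complex_banach_algebra_1))"
proof (rule antisym)
  have le: "onorm ((*) (d *\<^sub>C u)) \<le> cmod d * onorm ((*) u)" for d and u :: 'b
  proof (rule onorm_bound)
    show "norm (d *\<^sub>C u * w) \<le> cmod d * onorm ((*) u) * norm w" for w
      using norm_mult_le_onorm[of u w] by (simp add: mult_scaleC_left norm_scaleC mult.assoc mult_left_mono)
  qed (simp add: onorm_pos_le bounded_linear_mult_right)
  show "onorm ((*) (c *\<^sub>C v)) \<le> cmod c * onorm ((*) v)" by (rule le)
  show "cmod c * onorm ((*) v) \<le> onorm ((*) (c *\<^sub>C v))"
  proof (cases "c = 0")
    case False
    then have "onorm ((*) v) \<le> cmod (1/c) * onorm ((*) (c *\<^sub>C v))"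
      using le[of "1/c" "c *\<^sub>C v"] by (simp add: scaleC_simps)
    then show ?thesis using False by (simp add: norm_divide field_simps)
  qed (simp add: onorm_pos_le bounded_linear_mult_right)
qed

text \<open>
  The same algebra with the operator norm of left multiplication, which is equivalent to the given norm by
  \<open>onorm_mult_le\<close> and \<open>norm_le_onorm\<close> and takes the value \<open>1\<close> at the unit.
\<close>

typedef 'b renormed = "UNIV :: 'b set"
  morphisms of_renormed to_renormed by simp

setup_lifting type_definition_renormed

instantiation renormed :: (complex_banach_algebra_1) real_normed_algebra_1
begin

lift_definition zero_renormed :: "'a renormed" is 0 .
lift_definition one_renormed :: "'a renormed" is 1 .
lift_definition plus_renormed :: "'a renormed \<Rightarrow> 'a renormed \<Rightarrow> 'a renormed" is plus .
lift_definition minus_renormed :: "'a renormed \<Rightarrow> 'a renormed \<Rightarrow> 'a renormed" is minus .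
lift_definition uminus_renormed :: "'a renormed \<Rightarrow> 'a renormed" is uminus .
lift_definition times_renormed :: "'a renormed \<Rightarrow> 'a renormed \<Rightarrow> 'a renormed" is times .
lift_definition scaleR_renormed :: "real \<Rightarrow> 'a renormed \<Rightarrow> 'a renormed" is scaleR .
lift_definition norm_renormed :: "'a renormed \<Rightarrow> real" is "\<lambda>x. onorm ((*) x)" .

definition dist_renormed :: "'a renormed \<Rightarrow> 'a renormed \<Rightarrow> real" where
  "dist_renormed x y = norm (x - y)"
definition sgn_renormed :: "'a renormed \<Rightarrow> 'a renormed" where
  "sgn_renormed x = scaleR (inverse (norm x)) x"
definition uniformity_renormed :: "('a renormed \<times> 'a renormed) filter" where
  "uniformity_renormed = (INF e\<in>{0<..}. principal {(x, y). dist x y < e})"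
definition open_renormed :: "'a renormed set \<Rightarrow> bool" where
  "open_renormed U = (\<forall>x\<in>U. \<forall>\<^sub>F (x', y) in uniformity. x' = x \<longrightarrow> y \<in> U)"

instance
proof
  fix x y z :: "'a renormed" and r s :: real and U :: "'a renormed set"
  show "x + y + z = x + (y + z)" "x + y = y + x" "0 + x = x" "- x + x = 0" "x - y = x + - y"
    by (transfer; simp add: algebra_simps)+
  show "r *\<^sub>R (x + y) = r *\<^sub>R x + r *\<^sub>R y" "(r + s) *\<^sub>R x = r *\<^sub>R x + s *\<^sub>R x"
    "r *\<^sub>R s *\<^sub>R x = (r * s) *\<^sub>R x" "1 *\<^sub>R x = x"
    by (transfer; simp add: algebra_simps)+
  show "x * y * z = x * (y * z)" "(x + y) * z = x * z + y * z" "x * (y + z) = x * y + x * z"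
    "r *\<^sub>R x * y = r *\<^sub>R (x * y)" "x * r *\<^sub>R y = r *\<^sub>R (x * y)" "1 * x = x" "x * 1 = x" "(0::'a renormed) \<noteq> 1"
    by (transfer; simp add: algebra_simps)+
  show "dist x y = norm (x - y)" "sgn x = scaleR (inverse (norm x)) x"
    "uniformity = (INF e\<in>{0<..}. principal {(x, y::'a renormed). dist x y < e})"
    "open U = (\<forall>x\<in>U. \<forall>\<^sub>F (x', y) in uniformity. x' = x \<longrightarrow> y \<in> U)"
    by (simp_all add: dist_renormed_def sgn_renormed_def uniformity_renormed_def open_renormed_def)
  show "norm x = 0 \<longleftrightarrow> x = 0"
  proof transfer
    fix x :: 'a
    show "onorm ((*) x) = 0 \<longleftrightarrow> x = 0"
    proof
      assume "x = 0"
      then have "onorm ((*) x) \<le> 0" using onorm_mult_le[of x] by simp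
      then show "onorm ((*) x) = 0" using onorm_pos_le[OF bounded_linear_mult_right[of x]] by linarith
    qed (use norm_le_onorm[of x] in simp)
  qed
  show "norm (x + y) \<le> norm x + norm y"
  proof transfer
    fix x y :: 'a
    have "(*) (x + y) = (\<lambda>z. x * z + y * z)" by (simp add: fun_eq_iff distrib_right)
    then show "onorm ((*) (x + y)) \<le> onorm ((*) x) + onorm ((*) y)"
      using onorm_triangle[OF bounded_linear_mult_right bounded_linear_mult_right, of x y] by simp
  qed
  show "norm (x * y) \<le> norm x * norm y"
  proof transfer
    fix x y :: 'a
    have "(*) (x * y) = (*) x \<circ> (*) y" by (simp add: fun_eq_iff mult.assoc)
    then show "onorm ((*) (x * y)) \<le> onorm ((*) x) * onorm ((*) y)"
      using onorm_compose[OF bounded_linear_mult_right bounded_linear_mult_right, of x y] by simp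
  qed
  show "norm (r *\<^sub>R x) = \<bar>r\<bar> * norm x" by transfer (simp add: scaleR_scaleC onorm_mult_scaleC)
  show "norm (1::'a renormed) = 1"
  proof transfer
    have "onorm ((*) (1::'a)) \<le> 1" by (rule onorm_bound) simp_all
    moreover have "norm (1::'a) * 1 \<le> norm (1::'a) * onorm ((*) (1::'a))" using norm_le_onorm[of 1] by simp
    then have "1 \<le> onorm ((*) (1::'a))" by (subst (asm) mult_le_cancel_left_pos) auto
    ultimately show "onorm ((*) (1::'a)) = 1" by simp
  qed
qed

end

instance renormed :: (complex_banach_algebra_1) banach
proof
  fix X :: "nat \<Rightarrow> 'a renormed"
  assume X: "Cauchy X"
  have le: "norm (of_renormed x) \<le> norm (1::'a) * norm x" and ge: "norm x \<le> norm (of_renormed x)"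
    for x :: "'a renormed"
    by (transfer; simp add: norm_le_onorm onorm_mult_le)+
  have one: "norm (1::'a) > 0" by simp
  have "Cauchy (\<lambda>n. of_renormed (X n))"
  proof (rule metric_CauchyI)
    fix e :: real assume "e > 0"
    then have "e / norm (1::'a) > 0" using one by simp
    then obtain N where N: "\<And>m n. m \<ge> N \<Longrightarrow> n \<ge> N \<Longrightarrow> dist (X m) (X n) < e / norm (1::'a)"
      using metric_CauchyD[OF X] by blast
    have "dist (of_renormed (X m)) (of_renormed (X n)) < e" if "m \<ge> N" "n \<ge> N" for m n
    proof -
      have "norm (of_renormed (X m) - of_renormed (X n)) \<le> norm (1::'a) * norm (X m - X n)"
        using le[of "X m - X n"] by (simp add: minus_renormed.rep_eq)
      also have "\<dots> < norm (1::'a) * (e / norm (1::'a))"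
        using N[OF that] one by (intro mult_strict_left_mono) (auto simp: dist_renormed_def)
      finally show ?thesis using one by (simp add: dist_norm)
    qed
    then show "\<exists>M. \<forall>m\<ge>M. \<forall>n\<ge>M. dist (of_renormed (X m)) (of_renormed (X n)) < e" by blast
  qed
  then obtain l where l: "(\<lambda>n. of_renormed (X n)) \<longlonglongrightarrow> l" by (auto simp: Cauchy_convergent_iff convergent_def)
  have "X \<longlonglongrightarrow> to_renormed l"
  proof (rule metric_LIMSEQ_I)
    fix e :: real assume "e > 0"
    then obtain N where N: "\<And>n. n \<ge> N \<Longrightarrow> dist (of_renormed (X n)) l < e"
      using metric_LIMSEQ_D[OF l] by blast
    have "dist (X n) (to_renormed l) < e" if "n \<ge> N" for n
      using ge[of "X n - to_renormed l"] N[OF that]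
      by (simp add: dist_renormed_def minus_renormed.rep_eq to_renormed_inverse dist_norm)
    then show "\<exists>N. \<forall>n\<ge>N. dist (X n) (to_renormed l) < e" by blast
  qed
  then show "convergent X" by (auto simp: convergent_def)
qed

instantiation renormed :: (complex_banach_algebra_1) unital_banach
begin

lift_definition scaleC_renormed :: "complex \<Rightarrow> 'a renormed \<Rightarrow> 'a renormed" is scaleC .

instance
proof
  fix x y :: "'a renormed" and r :: real and c d :: complex
  show "r *\<^sub>R x = complex_of_real r *\<^sub>C x" "c *\<^sub>C (x + y) = c *\<^sub>C x + c *\<^sub>C y"
    "(c + d) *\<^sub>C x = c *\<^sub>C x + d *\<^sub>C x" "c *\<^sub>C d *\<^sub>C x = (c * d) *\<^sub>C x" "1 *\<^sub>C x = x"
    "(c *\<^sub>C x) * y = c *\<^sub>C (x * y)" "x * (c *\<^sub>C y) = c *\<^sub>C (x * y)"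
    by (transfer; simp add: scaleR_scaleC scaleC_simps)+
  show "norm (c *\<^sub>C x) = cmod c * norm x" by transfer (rule onorm_mult_scaleC)
qed

end

lemma algebra_isomorphism_comp:
  assumes "algebra_isomorphism f" "algebra_isomorphism g"
  shows "algebra_isomorphism (g \<circ> f)"
  using assms by (simp add: algebra_isomorphism_def bij_comp)

lemma algebra_isomorphism_of_renormed: "algebra_isomorphism of_renormed"
proof -
  have "bij (of_renormed :: 'b renormed \<Rightarrow> 'b)"
    by (rule bij_betw_byWitness[of _ to_renormed]) (auto simp: of_renormed_inverse to_renormed_inverse)
  then show ?thesis
    by (simp add: algebra_isomorphism_def plus_renormed.rep_eq scaleC_renormed.rep_eq times_renormed.rep_eq)
qed

lemma algebra_isomorphism_to_renormed: "algebra_isomorphism to_renormed"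
proof -
  have "bij (to_renormed :: 'b \<Rightarrow> 'b renormed)"
    by (rule bij_betw_byWitness[of _ of_renormed]) (auto simp: of_renormed_inverse to_renormed_inverse)
  then show ?thesis
    by (simp add: algebra_isomorphism_def plus_renormed.abs_eq scaleC_renormed.abs_eq times_renormed.abs_eq)
qed

lemma bounded_linear_of_renormed: "bounded_linear of_renormed"
proof (rule bounded_linear_intro)
  fix x :: "'b::complex_banach_algebra_1 renormed"
  show "norm (of_renormed x) \<le> norm x * norm (1::'b)"
    by transfer (simp add: norm_le_onorm mult.commute)
qed (simp_all add: plus_renormed.rep_eq scaleR_renormed.rep_eq)

lemma bounded_linear_to_renormed: "bounded_linear to_renormed"
proof (rule bounded_linear_intro)
  fix x :: "'b::complex_banach_algebra_1"
  show "norm (to_renormed x) \<le> norm x * 1"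
    by (simp add: norm_renormed.abs_eq onorm_mult_le)
qed (simp_all add: plus_renormed.abs_eq scaleR_renormed.abs_eq)

section \<open>The characterization of isomorphisms\<close>

theorem theorem2p2:
  "(\<exists>f :: 'a::cstar_algebra \<Rightarrow> 'b::complex_banach_algebra_1. algebra_isomorphism f) \<longleftrightarrow>
   (\<exists>\<phi> :: 'a \<Rightarrow> 'b. surj \<phi> \<and>
      (\<forall>x y z. spectrum (\<phi> x * \<phi> y * \<phi> z) = spectrum (x * y * z)) \<and>
      isCont \<phi> 1)"
proof
  assume "\<exists>f :: 'a \<Rightarrow> 'b. algebra_isomorphism f"
  then obtain f :: "'a \<Rightarrow> 'b" where f: "algebra_isomorphism f" by blast
  have "bounded_linear (to_renormed \<circ> f)"
    by (intro algebra_isomorphism_continuous algebra_isomorphism_comp f algebra_isomorphism_to_renormed)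
  then have "isCont (\<lambda>x. of_renormed ((to_renormed \<circ> f) x)) 1"
    by (intro bounded_linear.isCont[OF bounded_linear_of_renormed] linear_continuous_at)
  then have "isCont f 1" by (simp add: to_renormed_inverse)
  moreover have "surj f" and mult: "f x * f y = f (x * y)" for x y
    using f by (auto simp: algebra_isomorphism_def bij_def)
  ultimately show "\<exists>\<phi> :: 'a \<Rightarrow> 'b. surj \<phi> \<and>
      (\<forall>x y z. spectrum (\<phi> x * \<phi> y * \<phi> z) = spectrum (x * y * z)) \<and> isCont \<phi> 1"
    by (intro exI[of _ f]) (simp add: algebra_isomorphism_spectrum[OF f])
next
  assume "\<exists>\<phi> :: 'a \<Rightarrow> 'b. surj \<phi> \<and>
      (\<forall>x y z. spectrum (\<phi> x * \<phi> y * \<phi> z) = spectrum (x * y * z)) \<and> isCont \<phi> 1"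
  then obtain \<phi> :: "'a \<Rightarrow> 'b" where \<phi>: "surj \<phi>" "isCont \<phi> 1"
    and spec: "\<And>x y z. spectrum (\<phi> x * \<phi> y * \<phi> z) = spectrum (x * y * z)" by blast
  let ?\<phi> = "\<lambda>x. to_renormed (\<phi> x)"
  have "algebra_isomorphism (to_renormed :: 'b \<Rightarrow> 'b renormed)" by (rule algebra_isomorphism_to_renormed)
  then have "surj (to_renormed :: 'b \<Rightarrow> 'b renormed)" by (simp add: algebra_isomorphism_def bij_def)
  then have 1: "surj ?\<phi>" using comp_surj[OF \<phi>(1)] by (simp add: comp_def)
  have 2: "spectrum (?\<phi> x * ?\<phi> y * ?\<phi> z) = spectrum (x * y * z)" for x y z
    by (simp add: times_renormed.abs_eq spec algebra_isomorphism_spectrum[OF algebra_isomorphism_to_renormed])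
  have 3: "isCont ?\<phi> 1" by (intro bounded_linear.isCont[OF bounded_linear_to_renormed] \<phi>(2))
  obtain \<psi> :: "'a \<Rightarrow> 'b renormed" where \<psi>: "surj \<psi>" "\<And>x y. \<psi> (x * y) = \<psi> x * \<psi> y"
      "\<And>x. spectrum (\<psi> x) = spectrum x" "isCont \<psi> 1"
    using normalize_triple_spectral_map[OF 1 2 3] by blast
  interpret multiplicative_isospectral \<psi> by unfold_locales (use \<psi> in auto)
  show "\<exists>f :: 'a \<Rightarrow> 'b. algebra_isomorphism f"
    using algebra_isomorphism_comp[OF algebra_isomorphism_D algebra_isomorphism_of_renormed] by blast
qed

end
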